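(* Let $M$ be a perfect matching of $\mathcal{H}(v^*,f^* )$, let $T$ be the associated directed spanning tree of $G$ rooted at $v^*$, and let $h$ be the height function associated with $M$ (unique up to a global additive constant). Let $\gamma$ be a simple directed path in $T$ from a vertex $v'$ to a vertex $v''$, viewed as the link path $$v'=v_0,e_0,v_1,e_1,\ldots,v_{r-1},e_{r-1},v_r=v''$$ in $\mathcal{H}(G)$, and let $e_r$ be an edge-node adjacent to $v_r$ towards which the path can be continued. Let $f_1,\ldots,f_k$ be the chain of facets of $\mathcal{H}(G)$ that share a node with $\gamma$ and lie to the left of $\gamma$, where $f_1$ contains the first link $v_0e_0$ and $f_k$ contains the link $e_{r-1}v_r$. Let $d_1$ and $d_k$ be the diagonals of $f_1$ and $f_k$, and write $h(f_i)=h(d_i)$ for $i\in\{1,k\}$. Let $c_1$ be the counterclockwise angle from the vector $v_0e_0$ to the diagonal $d_1$, and let $c_k$ be the counterclockwise angle from the vector $v_re_r$ to the diagonal $d_k$. Then the winding number of $\gamma$ is equal to $$(h(f_k)-c_k)-(h(f_1)-c_1).$$ Here heights may be viewed as being defined on the facets, since even if a facet $f_j$ has more than one diagonal, $h(f_j)-c_j$ has the same value no matter which diagonal is used.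
   Context: Graphs. $G$ is a finite connected directed graph embedded in the plane (multiple edges and self-loops allowed; an undirected edge is regarded as two oppositely directed edges embedded so as to coincide). $\mathcal{H}(G)$ is the plane graph with a node $\overline{v}$ for each vertex $v$ of $G$, a node $\overline{e}$ for each edge $e$, and a node $\overline{f}$ for each face $f$ (including the unbounded one), with a link joining an edge-node to a vertex-node when the vertex is an endpoint of the edge, and to a face-node when the edge bounds the face. A node $\overline{v}$, $\overline{e}$ or $\overline{f}$ is also written $v$, $e$ or $f$. Fix a vertex $v^*$ and a face $f^*$ of $G$ incident with each other; $\mathcal{H}(v^*,f^* )$ is $\mathcal{H}(G)$ with the nodes $v^*,f^*$ deleted. Trees and matchings. A directed spanning tree of $G$ rooted at $v^*$ is a connected, contractible union $T$ of directed edges such that every vertex other than $v^*$ has exactly one outgoing edge in $T$. Its dual tree $T^\perp$ is the spanning tree of the dual graph consisting of the dual edges $e^\perp$ that do not cross edges of $T$, oriented towards $f^*$. The matching $M$ of $\mathcal{H}(v^*,f^* )$ associated with $T$ pairs each $v\neq v^*$ with the edge $e$ of $T$ pointing away from $v$, and each $f\neq f^*$ with the edge $e$ bounding $f$ such that $e^\perp\in T^\perp$ points away from $f$; $T$ is recovered from $M$ as the set of edges whose nodes are paired with vertex-nodes. In particular, $M$ matches $v_i$ with $e_i$ for $0\le i\le r-1$. Embedding. $\mathcal{H}(G)$ is embedded in the plane with straight edges, so that either one of $f^*$, $v^*$ is the outer node, or both $f^*$ and $v^*$ are on the outer facet. A node may be drawn in extended form (as a spread-out region rather than a dot); diagonals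 incident to an extended node may be drawn from any point in it. Diagonals. Each facet of $\mathcal{H}(G)$ is a quadrilateral containing one vertex-node $\bar v$ and one face-node $\bar f$, opposite each other, and two edge-nodes. Its diagonal $d$ is directed from $\bar v$ to $\bar f$. $\mathbb{D}$ is the set of all diagonals. A facet bounded by an extended node may have several diagonals drawn in it, each with its own height. Height function. Cut the plane along the links of $M$, and make one additional cut from $v^*$ to $f^*$, so that every vertex-node and every face-node is at the end of one cut. If both $v^*$ and $f^*$ border the outer facet, the additional cut passes through $\infty$; if one of them is the outer node, that node is viewed as being at $\infty$, so that the cut still goes to $\infty$. This cut splits the diagonal from $v^*$ to $f^*$, so that $\mathbb{D}$ contains two diagonals from $v^*$ to $f^*$, one on either side of the cut. A height function associated with $M$ is a function $h:\mathbb{D}\to\mathbb{R}$ satisfying the following local constraint: whenever two diagonals $d,d'$ share a vertex-node or face-node $x$, $h(d')=h(d)+\theta$, where $\theta$ is the signed angle (counterclockwise positive) of the rotation from $d$ to $d'$ around $x$ that does not encounter the cut containing $x$. Winding number. The winding number of $\gamma$ is the total angle (in radians) of the left turns minus the total angle of the right turns, from $v_0$ to $v_r$, where the initial direction of $\gamma$ is the direction of $v_0e_0$ and the final direction of $\gamma$ is the direction of $v_re_r$.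
   Formalization: Diagonals must be straight segments lying in their facets; if v* and f* are both drawn as points on the outer facet, the split diagonal is then available on at most one side of the cut (with the context's two copies through infinity, no consistent height function exists). *)

theory Defs
  imports
    "HOL-Complex_Analysis.Winding_Numbers"
    "HOL-Combinatorics.Orbits"
    "Graph_Theory.Digraph_Component"
begin

section \<open>Plane graphs\<close>

text \<open>
  A plane graph is given by its combinatorial map.  The darts are the oriented edges, starting at
  their tail; \<open>opp\<close> reverses a dart and \<open>rot\<close> maps a dart to the next one counterclockwise around
  the tail.  Loops and parallel edges are allowed.  The set \<open>dir\<close> consists of those darts that are
  directed edges of the graph: an edge with both orientations in \<open>dir\<close> is an undirected edge.
\<close>

record 'd plane_graph =
  darts :: "'d set"
  rot :: "'d \<Rightarrow> 'd"
  opp :: "'d \<Rightarrow> 'd"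
  dir :: "'d set"

definition vertex :: "'d plane_graph \<Rightarrow> 'd \<Rightarrow> 'd set" where
  "vertex G h = orbit (rot G) h"

definition edge :: "'d plane_graph \<Rightarrow> 'd \<Rightarrow> 'd set" where
  "edge G h = orbit (opp G) h"

text \<open>The next dart on the boundary walk of the face to the left of a dart.\<close>

definition face_next :: "'d plane_graph \<Rightarrow> 'd \<Rightarrow> 'd" where
  "face_next G = inv (rot G) \<circ> opp G"

definition face :: "'d plane_graph \<Rightarrow> 'd \<Rightarrow> 'd set" where
  "face G h = orbit (face_next G) h"

text \<open>
  The last conjunct is Euler's formula, i.e. the connected surface of the map is a sphere.
\<close>

definition finite_connected_plane_graph :: "'d plane_graph \<Rightarrow> bool" where
  "finite_connected_plane_graph G \<longleftrightarrow>
     finite (darts G) \<and> darts G \<noteq> {} \<and>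
     rot G permutes darts G \<and> opp G permutes darts G \<and>
     (\<forall>h\<in>darts G. opp G h \<noteq> h \<and> opp G (opp G h) = h) \<and>
     dir G \<subseteq> darts G \<and> (\<forall>h\<in>darts G. h \<in> dir G \<or> opp G h \<in> dir G) \<and>
     (\<forall>h\<in>darts G. \<forall>h'\<in>darts G.
        (h, h') \<in> ({(k, rot G k) |k. k \<in> darts G} \<union> {(k, opp G k) |k. k \<in> darts G})\<^sup>*) \<and>
     card (vertex G ` darts G) + card (face G ` darts G) = card (edge G ` darts G) + 2"


section \<open>Spanning trees\<close>

text \<open>
  For \<open>cell = vertex G\<close> this is the digraph on the vertices with arc set \<open>A\<close>; for \<open>cell = face G\<close> it is
  the digraph on the faces in which the dart \<open>h\<close> stands for the dual edge that crosses \<open>h\<close> from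
  left to right.
\<close>

definition digraph_of :: "'d plane_graph \<Rightarrow> ('d \<Rightarrow> 'd set) \<Rightarrow> 'd set \<Rightarrow> ('d set, 'd) pre_digraph" where
  "digraph_of G cell A = \<lparr>verts = cell ` darts G, arcs = A, tail = cell, head = cell \<circ> opp G\<rparr>"

text \<open>
  Contractibility: connected, and no cycle when edges may be traversed both ways.  Cycles have to
  be sought in the symmetric closure: \<open>forest\<close> from the library only excludes
  directed cycles.
\<close>

definition rooted_spanning_tree ::
    "'d plane_graph \<Rightarrow> ('d \<Rightarrow> 'd set) \<Rightarrow> 'd set \<Rightarrow> 'd set \<Rightarrow> 'd set \<Rightarrow> bool" where
  "rooted_spanning_tree G cell A r T \<longleftrightarrow>
     T \<subseteq> A \<and>
     Digraph_Component.connected (digraph_of G cell T) \<and>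
     \<not> (\<exists>p. pre_digraph.cycle (digraph_of G cell (T \<union> opp G ` T)) p \<and> distinct (map (edge G) p)) \<and>
     (\<forall>v\<in>cell ` darts G - {r}. \<exists>!h. h \<in> T \<and> cell h = v) \<and>
     (\<forall>h\<in>T. cell h \<noteq> r)"

definition directed_spanning_tree :: "'d plane_graph \<Rightarrow> 'd set \<Rightarrow> 'd set \<Rightarrow> bool" where
  "directed_spanning_tree G vs T \<longleftrightarrow> rooted_spanning_tree G (vertex G) (dir G) vs T"

definition dual_tree :: "'d plane_graph \<Rightarrow> 'd set \<Rightarrow> 'd set \<Rightarrow> 'd set \<Rightarrow> bool" where
  "dual_tree G fs T T' \<longleftrightarrow>
     rooted_spanning_tree G (face G) (darts G) fs T' \<and>
     edge G ` T' = edge G ` darts G - edge G ` T"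


section \<open>The graph of vertices, edges and faces; matchings\<close>

datatype 'd node = VNode "'d set" | ENode "'d set" | FNode "'d set"

text \<open>
  \<open>VLink h\<close> joins the edge of \<open>h\<close> to the tail of \<open>h\<close>, and \<open>FLink h\<close> joins it to the face on the
  left of \<open>h\<close>.  A loop is thus linked twice to its vertex and a bridge twice to its face.
\<close>

datatype 'd link = VLink 'd | FLink 'd

definition nodes :: "'d plane_graph \<Rightarrow> 'd node set" where
  "nodes G = (VNode \<circ> vertex G) ` darts G \<union> (ENode \<circ> edge G) ` darts G \<union> (FNode \<circ> face G) ` darts G"

definition links :: "'d plane_graph \<Rightarrow> 'd link set" where
  "links G = VLink ` darts G \<union> FLink ` darts G"

fun outer_end :: "'d plane_graph \<Rightarrow> 'd link \<Rightarrow> 'd node" where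
  "outer_end G (VLink h) = VNode (vertex G h)"
| "outer_end G (FLink h) = FNode (face G h)"

fun edge_end :: "'d plane_graph \<Rightarrow> 'd link \<Rightarrow> 'd node" where
  "edge_end G (VLink h) = ENode (edge G h)"
| "edge_end G (FLink h) = ENode (edge G h)"

definition ends :: "'d plane_graph \<Rightarrow> 'd link \<Rightarrow> 'd node set" where
  "ends G l = {outer_end G l, edge_end G l}"

definition perfect_matching ::
    "'d plane_graph \<Rightarrow> 'd set \<Rightarrow> 'd set \<Rightarrow> 'd link set \<Rightarrow> bool" where
  "perfect_matching G vs fs M \<longleftrightarrow>
     M \<subseteq> links G \<and>
     (\<forall>l\<in>M. ends G l \<subseteq> nodes G - {VNode vs, FNode fs}) \<and>
     (\<forall>x\<in>nodes G - {VNode vs, FNode fs}. \<exists>!l. l \<in> M \<and> x \<in> ends G l)"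

definition associated_matching ::
    "'d plane_graph \<Rightarrow> 'd set \<Rightarrow> 'd set \<Rightarrow> 'd link set \<Rightarrow> bool" where
  "associated_matching G fs T M \<longleftrightarrow> (\<exists>T'. dual_tree G fs T T' \<and> M = VLink ` T \<union> FLink ` T')"


section \<open>Straight-line drawings\<close>

text \<open>
  A node is drawn as a closed set \<open>region\<close> (a point, or a Jordan region for an extended node), and a
  link as the straight segment from \<open>tip\<close> (in its vertex or face) to \<open>base\<close> (in its edge).
  \<open>facet h\<close> is the facet at the corner of \<open>G\<close> between the darts \<open>h\<close> and \<open>rot G h\<close>.
\<close>

record 'd drawing =
  region :: "'d node \<Rightarrow> complex set"
  tip :: "'d link \<Rightarrow> complex"
  base :: "'d link \<Rightarrow> complex"
  facet :: "'d \<Rightarrow> complex set"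

definition seg :: "'d drawing \<Rightarrow> 'd link \<Rightarrow> complex set" where
  "seg D l = closed_segment (tip D l) (base D l)"

definition bounded_region :: "complex set \<Rightarrow> bool" where
  "bounded_region K \<longleftrightarrow> (\<exists>z. K = {z}) \<or>
     (\<exists>g. simple_path g \<and> pathfinish g = pathstart g \<and> K = path_image g \<union> inside (path_image g))"

definition outer_region :: "complex set \<Rightarrow> bool" where
  "outer_region K \<longleftrightarrow>
     (\<exists>g. simple_path g \<and> pathfinish g = pathstart g \<and> K = path_image g \<union> outside (path_image g))"

text \<open>The points immediately to the left of the open segment directed from \<open>a\<close> to \<open>b\<close> are in \<open>W\<close>.\<close>

definition on_left :: "complex set \<Rightarrow> complex \<Rightarrow> complex \<Rightarrow> bool" where
  "on_left W a b \<longleftrightarrow>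
     (\<forall>s\<in>{0<..<1}. \<forall>\<^sub>F t in at_right 0. linepath a b s + of_real t * (\<i> * (b - a)) \<in> W)"

text \<open>
  In \<open>straight_drawing\<close>, the facets are the components of the complement of the drawing, and
  \<open>facet h\<close> has the links \<open>VLink h\<close>, \<open>FLink h\<close>, \<open>FLink (opp G (rot G h))\<close> and \<open>VLink (rot G h)\<close> on
  its boundary, traversed counterclockwise.  As every side of every link belongs to exactly one
  facet, this forces the links to leave each node in the cyclic order given by the map.
\<close>

definition straight_drawing :: "'d plane_graph \<Rightarrow> 'd drawing \<Rightarrow> bool" where
  "straight_drawing G D \<longleftrightarrow>
     disjoint_family_on (region D) (nodes G) \<and>
     (\<forall>l\<in>links G. tip D l \<in> region D (outer_end G l) \<and> base D l \<in> region D (edge_end G l)) \<and>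
     (\<forall>l\<in>links G. \<forall>x\<in>nodes G. open_segment (tip D l) (base D l) \<inter> region D x = {}) \<and>
     disjoint_family_on (\<lambda>l. open_segment (tip D l) (base D l)) (links G) \<and>
     bij_betw (facet D) (darts G)
       (components (- (\<Union> (region D ` nodes G) \<union> \<Union> (seg D ` links G)))) \<and>
     (\<forall>h\<in>darts G.
        on_left (facet D h) (tip D (VLink h)) (base D (VLink h)) \<and>
        on_left (facet D h) (base D (FLink h)) (tip D (FLink h)) \<and>
        on_left (facet D h) (tip D (FLink (opp G (rot G h)))) (base D (FLink (opp G (rot G h)))) \<and>
        on_left (facet D h) (base D (VLink (rot G h))) (tip D (VLink (rot G h))))"

definition ray :: "complex set \<Rightarrow> complex set \<Rightarrow> (real \<Rightarrow> complex) \<Rightarrow> bool" where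
  "ray K U g \<longleftrightarrow>
     continuous_on {0..} g \<and> inj_on g {0..} \<and> g 0 \<in> K \<and> g ` {0<..} \<subseteq> U \<and>
     filterlim g at_infinity at_top"

text \<open>
  \<open>C\<close> is the additional cut from \<open>vs\<close> to \<open>fs\<close>, drawn in \<open>facet k\<close>.  If one of the two nodes is the
  outer node, its region contains a neighbourhood of infinity, and the cut runs from the other node
  to this region; if both nodes are on the outer facet, it consists of two rays, so that it passes
  through infinity.
\<close>

definition outer_node_and_cut ::
    "'d plane_graph \<Rightarrow> 'd drawing \<Rightarrow> 'd set \<Rightarrow> 'd set \<Rightarrow> 'd \<Rightarrow> complex set \<Rightarrow> bool" where
  "outer_node_and_cut G D vs fs k C \<longleftrightarrow>
     k \<in> darts G \<and> vertex G k = vs \<and> face G k = fs \<and>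
     ((\<exists>x\<in>{VNode vs, FNode fs}.
         outer_region (region D x) \<and> (\<forall>y\<in>nodes G - {x}. bounded_region (region D y)) \<and>
         (\<exists>g. arc g \<and> pathstart g \<in> region D (VNode vs) \<and> pathfinish g \<in> region D (FNode fs) \<and>
              g ` {0<..<1} \<subseteq> facet D k \<and> C = path_image g)) \<or>
      ((\<forall>y\<in>nodes G. bounded_region (region D y)) \<and> \<not> bounded (facet D k) \<and>
         (\<exists>g g'. ray (region D (VNode vs)) (facet D k) g \<and> ray (region D (FNode fs)) (facet D k) g' \<and>
                 g ` {0..} \<inter> g' ` {0..} = {} \<and> C = g ` {0..} \<union> g' ` {0..})))"


section \<open>Diagonals\<close>

text \<open>
  A diagonal of \<open>facet (corner d)\<close> is a segment across this facet from the vertex-node to the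
  face-node.  Its ends at extended nodes are arbitrary; only the part outside of the nodes is
  recorded, which does not affect directions.  Diagonals in the facet of the additional cut \<open>C\<close> lie
  on either side of \<open>C\<close>.
\<close>

datatype 'd diagonal = Diagonal (corner: 'd) (src: complex) (dst: complex)

definition diagonals :: "'d plane_graph \<Rightarrow> 'd drawing \<Rightarrow> complex set \<Rightarrow> 'd diagonal set" where
  "diagonals G D C =
     {Diagonal h a b |h a b. h \<in> darts G \<and>
        a \<in> region D (VNode (vertex G h)) \<and> b \<in> region D (FNode (face G h)) \<and>
        open_segment a b \<subseteq> facet D h - C}"

definition diag_mid :: "'d diagonal \<Rightarrow> complex" where
  "diag_mid d = midpoint (src d) (dst d)"

text \<open>
  \<open>d\<close> is drawn in the facet to the left of the segment directed from \<open>a\<close> to \<open>b\<close>.  The facet that is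
  split by the additional cut \<open>C\<close> counts as two.
\<close>

definition diagonal_on_left ::
    "'d drawing \<Rightarrow> complex set \<Rightarrow> 'd diagonal \<Rightarrow> complex \<Rightarrow> complex \<Rightarrow> bool" where
  "diagonal_on_left D C d a b \<longleftrightarrow>
     on_left (connected_component_set (facet D (corner d) - C) (diag_mid d)) a b"


section \<open>Rotation about a node\<close>

text \<open>
  An arm is a pair consisting of its hinge on a node and its free end; here always half of a diagonal
  or half of a link.  \<open>rotation_along K B A A' q \<theta>\<close> says that the arm \<open>A\<close> turns by the signed angle
  \<open>\<theta>\<close> into \<open>A'\<close> when its free end moves along \<open>q\<close> while its hinge moves within the node \<open>K\<close>, and that
  this motion does not encounter the obstacle \<open>B\<close>: the free end does not meet \<open>B\<close>, and \<open>B\<close> is not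
  encircled by the closed curve that bounds the swept area.  (The real part of the winding number of
  a path that is not closed is its change of argument divided by \<open>2 * pi\<close>.)  If \<open>K\<close> is a point and
  \<open>B\<close> a segment starting there, this is the rotation about this point that avoids \<open>B\<close>.
\<close>

type_synonym arm = "complex \<times> complex"

definition rotation_along ::
    "complex set \<Rightarrow> complex set \<Rightarrow> arm \<Rightarrow> arm \<Rightarrow> (real \<Rightarrow> complex) \<Rightarrow> real \<Rightarrow> bool" where
  "rotation_along K B A A' q \<theta> \<longleftrightarrow>
     (\<exists>p. path p \<and> path_image p \<subseteq> K \<and> pathstart p = fst A \<and> pathfinish p = fst A' \<and>
          path q \<and> pathstart q = snd A \<and> pathfinish q = snd A' \<and> q ` {0<..<1} \<subseteq> - (K \<union> B) \<and>
          (let c = linepath (fst A) (snd A) +++ q +++ linepath (snd A') (fst A') +++ reversepath p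
           in \<forall>z\<in>B - path_image c. winding_number c z = 0) \<and>
          \<theta> = 2 * pi * Re (winding_number (\<lambda>t. q t - p t) 0))"

definition rotation :: "complex set \<Rightarrow> complex set \<Rightarrow> arm \<Rightarrow> arm \<Rightarrow> real \<Rightarrow> bool" where
  "rotation K B A A' \<theta> \<longleftrightarrow> (\<exists>q. rotation_along K B A A' q \<theta>)"

text \<open>
  The variant in which \<open>A\<close> is part of the obstacle \<open>B\<close> and departs to its left, i.e. starts to
  rotate counterclockwise.
\<close>

definition left_rotation :: "complex set \<Rightarrow> complex set \<Rightarrow> arm \<Rightarrow> arm \<Rightarrow> real \<Rightarrow> bool" where
  "left_rotation K B A A' \<theta> \<longleftrightarrow>
     (\<exists>q. rotation_along K B A A' q \<theta> \<and>
          (\<forall>\<^sub>F t in at_right 0. Im ((q t - snd A) / (snd A - fst A)) > 0))"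

definition tip_arm :: "'d drawing \<Rightarrow> 'd link \<Rightarrow> arm" where
  "tip_arm D l = (tip D l, midpoint (tip D l) (base D l))"

definition base_arm :: "'d drawing \<Rightarrow> 'd link \<Rightarrow> arm" where
  "base_arm D l = (base D l, midpoint (tip D l) (base D l))"

definition src_arm :: "'d diagonal \<Rightarrow> arm" where
  "src_arm d = (src d, diag_mid d)"

definition dst_arm :: "'d diagonal \<Rightarrow> arm" where
  "dst_arm d = (dst d, diag_mid d)"


section \<open>Height functions\<close>

definition cut_at ::
    "'d plane_graph \<Rightarrow> 'd drawing \<Rightarrow> 'd set \<Rightarrow> 'd set \<Rightarrow> complex set \<Rightarrow> 'd link set \<Rightarrow> 'd node \<Rightarrow> complex set"
  where
  "cut_at G D vs fs C M x =
     (if x \<in> {VNode vs, FNode fs} then C else \<Union> (seg D ` {l \<in> M. x \<in> ends G l}))"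

definition height_function ::
    "'d plane_graph \<Rightarrow> 'd drawing \<Rightarrow> 'd set \<Rightarrow> 'd set \<Rightarrow> complex set \<Rightarrow> 'd link set \<Rightarrow>
     ('d diagonal \<Rightarrow> real) \<Rightarrow> bool" where
  "height_function G D vs fs C M ht \<longleftrightarrow>
     (\<forall>d\<in>diagonals G D C. \<forall>d'\<in>diagonals G D C.
        (vertex G (corner d) = vertex G (corner d') \<longrightarrow>
           (let x = VNode (vertex G (corner d)) in
            \<forall>\<theta>. rotation (region D x) (cut_at G D vs fs C M x) (src_arm d) (src_arm d') \<theta> \<longrightarrow>
                ht d' = ht d + \<theta>)) \<and>
        (face G (corner d) = face G (corner d') \<longrightarrow>
           (let x = FNode (face G (corner d)) in
            \<forall>\<theta>. rotation (region D x) (cut_at G D vs fs C M x) (dst_arm d) (dst_arm d') \<theta> \<longrightarrow>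
                ht d' = ht d + \<theta>)))"


section \<open>Angles and winding along a path\<close>

text \<open>
  The counterclockwise angle from a link (as seen from a vertex) to a diagonal.  At a vertex drawn as
  a point it is in \<open>{0..<2 * pi}\<close>; at an extended vertex, it is the angle swept when turning
  counterclockwise from the link to the diagonal without crossing the links in \<open>B\<close>.
\<close>

definition ccw_angle :: "complex set \<Rightarrow> complex set \<Rightarrow> arm \<Rightarrow> arm \<Rightarrow> real \<Rightarrow> bool" where
  "ccw_angle K B A A' c \<longleftrightarrow>
     (if is_singleton K then c = Arg2pi ((snd A' - fst A') / (snd A - fst A))
      else left_rotation K B A A' c)"

text \<open>
  The left turn (right turns being negative) at a node that is entered along the link \<open>l\<close> with arm
  \<open>A\<close> and left along the link \<open>l'\<close> with arm \<open>A'\<close>.  At a node drawn as a point it is the angle, in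
  \<open>{-pi<..pi}\<close>, between the two directions of travel.  This is \<open>pi\<close> minus the angle enclosed on the
  left, which also makes sense at an extended node.
\<close>

definition left_turn :: "complex set \<Rightarrow> complex set \<Rightarrow> arm \<Rightarrow> arm \<Rightarrow> real \<Rightarrow> bool" where
  "left_turn K B A A' \<tau> \<longleftrightarrow>
     (if is_singleton K then \<tau> = Arg ((snd A' - fst A') / (fst A - snd A))
      else \<exists>\<omega>. left_rotation K B A' A \<omega> \<and> \<tau> = pi - \<omega>)"

text \<open>
  The path consists of the darts \<open>\<gamma>\<close>; its final direction is that of the link \<open>VLink er\<close>.  It turns
  by \<open>\<alpha> i\<close> at its \<open>i\<close>-th edge, and by \<open>\<beta> i\<close> at the head of this edge.
\<close>

definition winding :: "'d plane_graph \<Rightarrow> 'd drawing \<Rightarrow> 'd list \<Rightarrow> 'd \<Rightarrow> real \<Rightarrow> bool" where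
  "winding G D \<gamma> er w \<longleftrightarrow>
     (\<exists>\<alpha> \<beta>.
        (\<forall>i<length \<gamma>.
           let l = VLink (\<gamma> ! i); l' = VLink (opp G (\<gamma> ! i)); l'' = VLink ((\<gamma> @ [er]) ! Suc i) in
           left_turn (region D (edge_end G l)) (seg D l \<union> seg D l')
             (base_arm D l) (base_arm D l') (\<alpha> i) \<and>
           left_turn (region D (outer_end G l')) (seg D l' \<union> seg D l'')
             (tip_arm D l') (tip_arm D l'') (\<beta> i)) \<and>
        w = (\<Sum>i<length \<gamma>. \<alpha> i + \<beta> i))"

end

theory Submission
  imports Defs "HOL-Complex_Analysis.Riemann_Mapping"
begin

text \<open>
  Angles are measured in full turns, as real parts of winding numbers.  If one travels from \<open>m\<close> along
  a straight arm to a hinge \<open>x\<close> of a node, then within the node along a path \<open>P\<close> to \<open>x'\<close>, and then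
  along a straight arm to \<open>m'\<close>, the total turning depends on \<open>P\<close> only up to the way in which \<open>P\<close>
  passes around the node; this is the corner turn.  Left turns are corner turns, and the
  counterclockwise angles \<open>c\<^sub>1\<close> and \<open>c\<^sub>k\<close> are half a turn minus a corner turn.

  To the left of the \<open>i\<close>-th edge of \<open>\<gamma>\<close> take diagonals \<open>a\<^sub>i\<close> at its tail and \<open>b\<^sub>i\<close> at its head.  The two
  halves of the edge, \<open>b\<^sub>i\<close> and \<open>a\<^sub>i\<close> bound a quadrilateral whose corners are drawn as nodes.  By the
  theorem of turning tangents its four corner turns add up to one.  The corner at the face-node is
  half a turn minus the height difference \<open>h(b\<^sub>i) - h(a\<^sub>i)\<close>, because the rotation about the face-node
  that sweeps over the quadrilateral avoids the cut there: a closed curve inside one facet, some of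
  its sides, and the nodes winds equally often around all other facets.  At an interior vertex \<open>v\<^sub>i\<close>
  of the path the cut is the next link of \<open>\<gamma>\<close>, so that \<open>h(a\<^sub>i) - h(b\<^bsub>i-1\<^esub>)\<close> is a difference of two
  corner turns with that link.  In the sum of these identities all corner turns between diagonals
  and links cancel, except those given by \<open>c\<^sub>1\<close> and \<open>c\<^sub>k\<close>.
\<close>

text \<open>Extended nodes have arbitrary shape, so angles cannot be followed at a point. Everything
  rests on one exchange identity: for disjoint paths \<open>p\<close> and \<open>q\<close>, a
  logarithm of \<open>q s - p t\<close> on the unit square relates the turning of \<open>q\<close>
  seen from the ends of \<open>p\<close> to the turning of \<open>p\<close> seen from the ends of
  \<open>q\<close>. Geometric claims thus become linear relations between real numbers. The obstacle
  is that equality up to full turns does not suffice: it has to be shown that certain closed curves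
  do not wind around the cuts. The quadrilateral occupies two facets, the second of which may
  contain the additional cut. Hence its boundary is split into curves that each live in one facet,
  and the view from infinity, through the outer node or the unbounded facet, fixes their winding
  numbers outside. If the face-node is the outer node, this view is blocked, and a loop inside that
  node compensates. If the last vertex is the outer node, corner turns depend on the path inside it,
  so the paths that come with the given left rotations must be kept.\<close>

hide_const (open) Digraph_Component.connected

section \<open>Winding numbers of paths that are not closed\<close>

definition turns :: "complex \<Rightarrow> (real \<Rightarrow> complex) \<Rightarrow> real" where
  "turns z g = Re (winding_number g z)"

lemma turns_join:
  assumes "path g" "path h" "pathfinish g = pathstart h" "z \<notin> path_image g" "z \<notin> path_image h"
  shows "turns z (g +++ h) = turns z g + turns z h"
  using assms by (simp add: turns_def winding_number_join)

lemma turns_reversepath: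
  assumes "path g" "z \<notin> path_image g"
  shows "turns z (reversepath g) = - turns z g"
  using assms by (simp add: turns_def winding_number_reversepath)

lemma turns_trivial [simp]: "z \<noteq> a \<Longrightarrow> turns z (linepath a a) = 0"
  by (simp add: turns_def)

lemma turns_eq_log:
  assumes "path L" "\<And>t. t \<in> {0..1} \<Longrightarrow> g t - z = exp (L t)"
  shows "turns z g = Im (L 1 - L 0) / (2 * pi)"
proof -
  have "winding_number g z = winding_number (\<lambda>t. g t - z) 0"
    by (rule winding_number_offset)
  also have "\<dots> = winding_number (exp \<circ> L) 0"
    using assms(2) by (intro winding_number_cong) (auto simp: o_def)
  also have "\<dots> = (L 1 - L 0) / (2 * complex_of_real pi * \<i>)"
    using winding_number_compose_exp[OF assms(1)] by (simp add: pathfinish_def pathstart_def)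
  also have "Re \<dots> = Im (L 1 - L 0) / (2 * pi)"
    by (simp add: Re_divide power2_eq_square field_simps)
  finally show ?thesis by (simp add: turns_def)
qed

text \<open>The difference \<open>q s - p t\<close> has no zero on the square of all pairs
  \<open>(s, t)\<close>, so it has a continuous logarithm there. The change along the diagonal
  equals the change along either pair of consecutive sides, and on a side one of the two points
  stands still.\<close>

lemma turns_rectangle:
  assumes p: "path p" and q: "path q" and disj: "path_image p \<inter> path_image q = {}"
  shows turns_diff: "turns 0 (\<lambda>t. q t - p t) = turns (pathstart p) q + turns (pathfinish q) p"
    and turns_diff': "turns 0 (\<lambda>t. q t - p t) = turns (pathstart q) p + turns (pathfinish p) q"
proof -
  define S where "S = {0..1::real} \<times> {0..1::real}"
  define f where "f = (\<lambda>(s, t). q s - p t)"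
  have cq: "continuous_on {0..1} q" and cp: "continuous_on {0..1} p"
    using p q by (auto simp: path_def)
  have cont: "continuous_on S f"
    unfolding f_def S_def case_prod_unfold
    by (intro continuous_intros continuous_on_compose2[OF cq] continuous_on_compose2[OF cp]) auto
  have "contractible S" unfolding S_def
    by (intro convex_imp_contractible convex_Times) auto
  moreover have nz: "f u \<noteq> 0" if "u \<in> S" for u
    using that disj by (fastforce simp: f_def S_def path_image_def)
  ultimately obtain g where g: "continuous_on S g" and fg: "\<And>u. u \<in> S \<Longrightarrow> f u = exp (g u)"
    using continuous_logarithm_on_contractible[OF cont] by blast
  have ex: "q s - p t = exp (g (s, t))" if "s \<in> {0..1}" "t \<in> {0..1}" for s t
    using fg[of "(s, t)"] that by (auto simp: f_def S_def)
  have pth: "path (\<lambda>t. g (a t, b t) + c)" if "continuous_on {0..1} a" "continuous_on {0..1} b"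
      "\<And>t. t \<in> {0..1} \<Longrightarrow> a t \<in> {0..1} \<and> b t \<in> {0..1}" for a b c
    unfolding path_def
  proof (intro continuous_on_add continuous_on_const)
    show "continuous_on {0..1} (\<lambda>t. g (a t, b t))"
    proof (rule continuous_on_compose2[OF g])
      show "continuous_on {0..1} (\<lambda>t. (a t, b t))" using that(1,2) by (rule continuous_on_Pair)
      show "(\<lambda>t. (a t, b t)) ` {0..1} \<subseteq> S" using that(3) unfolding S_def by blast
    qed
  qed
  have ei: "exp (z + complex_of_real pi * \<i>) = - exp z" for z
    by (simp add: exp_add exp_pi_i')
  have 1: "turns 0 (\<lambda>t. q t - p t) = Im (g (1, 1) - g (0, 0)) / (2 * pi)"
    using pth[of "\<lambda>t. t" "\<lambda>t. t" 0] by (intro turns_eq_log) (auto simp: ex)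
  have 2: "turns (p 0) q = Im (g (1, 0) - g (0, 0)) / (2 * pi)"
    using pth[of "\<lambda>t. t" "\<lambda>t. 0" 0]
    by (intro turns_eq_log[where L = "\<lambda>t. g (t, 0)"]) (auto simp: ex intro!: continuous_intros)
  have 3: "turns (p 1) q = Im (g (1, 1) - g (0, 1)) / (2 * pi)"
    using pth[of "\<lambda>t. t" "\<lambda>t. 1" 0]
    by (intro turns_eq_log[where L = "\<lambda>t. g (t, 1)"]) (auto simp: ex intro!: continuous_intros)
  \<comment> \<open>Here \<open>q\<close> stands still, and \<open>p t - q s\<close> is the negative
    of the function with logarithm \<open>g\<close>; hence the summand
    \<open>pi * i\<close>.\<close>
  have 4: "turns (q 0) p = Im (g (0, 1) - g (0, 0)) / (2 * pi)"
    using turns_eq_log[where L = "\<lambda>t. g (0, t) + of_real pi * \<i>" and g = p and z = "q 0"]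
      pth[of "\<lambda>t. 0" "\<lambda>t. t" "of_real pi * \<i>"]
    by (auto simp: ei ex[symmetric] intro!: continuous_intros)
  have 5: "turns (q 1) p = Im (g (1, 1) - g (1, 0)) / (2 * pi)"
    using turns_eq_log[where L = "\<lambda>t. g (1, t) + of_real pi * \<i>" and g = p and z = "q 1"]
      pth[of "\<lambda>t. 1" "\<lambda>t. t" "of_real pi * \<i>"]
    by (auto simp: ei ex[symmetric] intro!: continuous_intros)
  show "turns 0 (\<lambda>t. q t - p t) = turns (pathstart p) q + turns (pathfinish q) p"
    "turns 0 (\<lambda>t. q t - p t) = turns (pathstart q) p + turns (pathfinish p) q"
    unfolding pathstart_def pathfinish_def 1 2 3 4 5 by (simp_all add: field_simps)
qed

text \<open>The viewpoint from which \<open>q\<close> is observed moves along \<open>p\<close>, at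
  the price of the turning of \<open>p\<close> as seen from the two ends of \<open>q\<close>. This
  takes the place of homotopies.\<close>

lemma turns_exchange:
  assumes "path p" "path q" "path_image p \<inter> path_image q = {}"
  shows "turns (pathstart p) q + turns (pathfinish q) p = turns (pathstart q) p + turns (pathfinish p) q"
  using turns_rectangle[OF assms] by simp

lemma turns_linepath:
  assumes "z \<notin> closed_segment a b"
  shows "turns z (linepath a b) = Arg ((b - z) / (a - z)) / (2 * pi)"
proof -
  define w where "w = (b - z) / (a - z)"
  have az: "a \<noteq> z" using assms by auto
  \<comment> \<open>The segment from 1 to \<open>w\<close> misses the branch cut of
    \<open>Ln\<close>: otherwise \<open>w\<close> would be a nonpositive real \<open>c\<close>, and
    \<open>z\<close> the point of the segment from \<open>a\<close> to \<open>b\<close> with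
    parameter \<open>1 / (1 - c)\<close>.\<close>
  have nn: "1 - of_real t + of_real t * w \<notin> \<real>\<^sub>\<le>\<^sub>0" if t: "t \<in> {0..1}" for t
  proof
    assume "1 - of_real t + of_real t * w \<in> \<real>\<^sub>\<le>\<^sub>0"
    then obtain r where r: "r \<le> 0" "1 - of_real t + of_real t * w = of_real r"
      by (auto simp: nonpos_Reals_def)
    have tp: "t > 0" using r t by (cases "t = 0") auto
    have "w = of_real ((r - 1 + t) / t)"
      using r tp by (simp add: field_simps)
    then obtain c where c: "c = (r - 1 + t) / t" "w = of_real c" by blast
    have "c \<le> 0" unfolding c(1) using r tp t by (intro divide_nonpos_pos) auto
    have bz: "b - z = of_real c * (a - z)" using c az by (simp add: w_def field_simps)
    define u where "u = 1 / (1 - c)"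
    have u: "0 \<le> u" "u \<le> 1" "1 - u + u * c = 0"
      using \<open>c \<le> 0\<close> by (auto simp: u_def field_simps)
    have "(1 - of_real u) * a + of_real u * b - z = (1 - of_real u) * (a - z) + of_real u * (b - z)"
      by (simp add: algebra_simps)
    also have "\<dots> = of_real (1 - u + u * c) * (a - z)"
      unfolding bz by (simp add: algebra_simps)
    also have "\<dots> = 0" using u by simp
    finally have "z = (1 - u) *\<^sub>R a + u *\<^sub>R b" by (simp add: scaleR_conv_of_real)
    then have "z \<in> closed_segment a b" using u by (auto simp: in_segment)
    then show False using assms by blast
  qed
  have "turns z (linepath a b) = Im ((Ln (a - z) + Ln (1 - of_real 1 + of_real 1 * w)) - (Ln (a - z) + Ln (1 - of_real 0 + of_real 0 * w))) / (2 * pi)"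
  proof (rule turns_eq_log)
    show "path (\<lambda>t. Ln (a - z) + Ln (1 - of_real t + of_real t * w))"
      unfolding path_def using nn by (intro continuous_intros) auto
    fix t :: real assume t: "t \<in> {0..1}"
    have "1 - of_real t + of_real t * w \<noteq> 0" using nn[OF t] by auto
    then have "exp (Ln (a - z) + Ln (1 - of_real t + of_real t * w)) = (a - z) * (1 - of_real t + of_real t * w)"
      using az by (simp add: exp_add)
    also have "\<dots> = linepath a b t - z"
      using az by (simp add: w_def linepath_def scaleR_conv_of_real field_simps)
    finally show "linepath a b t - z = exp (Ln (a - z) + Ln (1 - of_real t + of_real t * w))" by simp
  qed
  moreover have "w \<noteq> 0" using nn[of 1] by auto
  ultimately show ?thesis by (simp add: w_def[symmetric] Arg_eq_Im_Ln)
qed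

text \<open>A point that is on the line of a segment but not on the segment sees no turning; this
  position forces \<open>r\<close> to be positive.\<close>

lemma turns_linepath_eq_0:
  assumes "z \<notin> closed_segment a b" "b - z = of_real r * (a - z)"
  shows "turns z (linepath a b) = 0"
proof -
  have az: "a \<noteq> z" using assms by auto
  have "r > 0"
  proof (rule ccontr)
    assume "\<not> r > 0"
    define u where "u = 1 / (1 - r)"
    have u: "0 \<le> u" "u \<le> 1" "1 - u + u * r = 0"
      using \<open>\<not> r > 0\<close> by (auto simp: u_def field_simps)
    have "(1 - of_real u) * a + of_real u * b - z = (1 - of_real u) * (a - z) + of_real u * (b - z)"
      by (simp add: algebra_simps)
    also have "\<dots> = of_real (1 - u + u * r) * (a - z)"
      unfolding assms by (simp add: algebra_simps)
    also have "\<dots> = 0" using u by simp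
    finally have "z = (1 - u) *\<^sub>R a + u *\<^sub>R b" by (simp add: scaleR_conv_of_real)
    then have "z \<in> closed_segment a b" using u by (auto simp: in_segment)
    then show False using assms by blast
  qed
  have "(b - z) / (a - z) = of_real r" using az assms by (simp add: field_simps)
  then show ?thesis using turns_linepath[OF assms(1)] \<open>r > 0\<close> by simp
qed

lemma turns_linepath_on_line:
  assumes "z \<notin> closed_segment (x + of_real s * u) (x + of_real t * u)" "z = x + of_real r * u"
  shows "turns z (linepath (x + of_real s * u) (x + of_real t * u)) = 0"
proof -
  have "s \<noteq> r" using assms by auto
  then show ?thesis
    using assms by (intro turns_linepath_eq_0[OF assms(1), where r = "(t - r) / (s - r)"])
      (simp add: field_simps)
qed

section \<open>Closed curves: integrality, constancy, the view from infinity\<close>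

lemma turns_closed_Ints:
  assumes "path g" "pathfinish g = pathstart g" "z \<notin> path_image g"
  shows "turns z g \<in> \<int>"
  using integer_winding_number[OF assms] by (auto simp: turns_def elim!: Ints_cases)

lemma turns_constant:
  assumes "path g" "pathfinish g = pathstart g" "connected S" "S \<inter> path_image g = {}" "y \<in> S" "z \<in> S"
  shows "turns y g = turns z g"
  using winding_number_constant[OF assms(1-4)] assms(5,6) by (auto simp: turns_def constant_on_def)

text \<open>The set \<open>S\<close> connects \<open>z\<close> to points near infinity, where the
  winding number vanishes.\<close>

lemma turns_unbounded_eq_0:
  assumes "path g" "pathfinish g = pathstart g" "connected S" "S \<inter> path_image g = {}" "z \<in> S" "\<not> bounded S"
  shows "turns z g = 0"
proof -
  obtain B where B: "\<And>z. B \<le> cmod z \<Longrightarrow> winding_number g z = 0"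
    using winding_number_zero_at_infinity[OF assms(1,2)] by blast
  obtain y where "y \<in> S" "cmod y > B" using assms(6) unfolding bounded_iff by (meson not_le)
  then show ?thesis using turns_constant[OF assms(1-5), of y] B[of y] by (simp add: turns_def)
qed

lemma turns_locally_constant:
  assumes "path g" "pathfinish g = pathstart g" "z \<notin> path_image g"
  obtains e where "e > 0" "\<And>y. y \<in> ball z e \<Longrightarrow> y \<notin> path_image g" "\<And>y. y \<in> ball z e \<Longrightarrow> turns y g = turns z g"
proof -
  have "open (- path_image g)" using closed_path_image[OF assms(1)] by auto
  then obtain e where e: "e > 0" "ball z e \<subseteq> - path_image g"
    using assms(3) openE by blast
  have "turns y g = turns z g" if "y \<in> ball z e" for y
    by (rule turns_constant[OF assms(1,2) connected_ball[of z e]]) (use e that in auto)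
  then show thesis using e that by blast
qed

text \<open>The winding number is constant near \<open>z\<close>, and points of \<open>S\<close>
  come arbitrarily close. This carries values from a facet to the links on its boundary, and from a
  link to its ends.\<close>

lemma turns_closure:
  assumes "path g" "pathfinish g = pathstart g" "z \<notin> path_image g" "z \<in> closure S"
    "\<And>y. y \<in> S \<Longrightarrow> y \<notin> path_image g \<Longrightarrow> turns y g = c"
  shows "turns z g = c"
proof -
  obtain e where e: "e > 0" "\<And>y. y \<in> ball z e \<Longrightarrow> y \<notin> path_image g" "\<And>y. y \<in> ball z e \<Longrightarrow> turns y g = turns z g"
    using turns_locally_constant[OF assms(1-3)] by metis
  obtain y where "y \<in> S" "dist y z < e" using assms(4) e(1) closure_approachable by blast
  then show ?thesis using e(2,3)[of y] assms(5)[of y] by (auto simp: dist_commute)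
qed

text \<open>Nested to the right, so that a list of four pieces unfolds to exactly the closed curve
  in \<open>rotation_along\<close>.\<close>

fun join_all :: "(real \<Rightarrow> complex) list \<Rightarrow> real \<Rightarrow> complex" where
  "join_all [] = linepath 0 0"
| "join_all [g] = g"
| "join_all (g # h # gs) = g +++ join_all (h # gs)"

fun linked :: "(real \<Rightarrow> complex) list \<Rightarrow> bool" where
  "linked [] \<longleftrightarrow> False"
| "linked [g] \<longleftrightarrow> path g"
| "linked (g # h # gs) \<longleftrightarrow> path g \<and> pathfinish g = pathstart h \<and> linked (h # gs)"

lemma join_all_linked:
  assumes "linked gs"
  shows path_join_all: "path (join_all gs)"
    and path_image_join_all: "path_image (join_all gs) = \<Union> (path_image ` set gs)"
    and pathstart_join_all: "pathstart (join_all gs) = pathstart (hd gs)"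
    and pathfinish_join_all: "pathfinish (join_all gs) = pathfinish (last gs)"
  using assms by (induction gs rule: linked.induct) (auto simp: path_image_join)

lemma turns_join_all:
  assumes "linked gs" "\<And>g. g \<in> set gs \<Longrightarrow> z \<notin> path_image g"
  shows "turns z (join_all gs) = sum_list (map (turns z) gs)"
  using assms
  by (induction gs rule: linked.induct) (auto simp: turns_join join_all_linked)

section \<open>Segments, half segments and corner turns\<close>

lemma turns_linepath_split:
  assumes "c \<in> closed_segment a b" "z \<notin> closed_segment a b"
  shows "turns z (linepath a b) = turns z (linepath a c) + turns z (linepath c b)"
  using winding_number_split_linepath[OF assms] by (simp add: turns_def)

lemma turns_linepath_rev:
  assumes "z \<notin> closed_segment a b"
  shows "turns z (linepath b a) = - turns z (linepath a b)"
  using turns_reversepath[of "linepath a b" z] assms by simp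

lemma half_segments:
  fixes x y :: complex
  assumes "x \<noteq> y"
  shows "closed_segment x (midpoint x y) \<subseteq> insert x (open_segment x y)"
    and "closed_segment (midpoint x y) y \<subseteq> insert y (open_segment x y)"
    and "y \<notin> closed_segment x (midpoint x y)" and "x \<notin> closed_segment (midpoint x y) y"
proof -
  have m: "midpoint x y = (1 - 1/2) *\<^sub>R x + (1/2) *\<^sub>R y"
    by (simp add: midpoint_def scaleR_right_distrib)
  show "closed_segment x (midpoint x y) \<subseteq> insert x (open_segment x y)"
  proof
    fix z assume "z \<in> closed_segment x (midpoint x y)"
    then obtain u where u: "0 \<le> u" "u \<le> 1" "z = (1 - u) *\<^sub>R x + u *\<^sub>R midpoint x y"
      by (auto simp: in_segment)
    then have "z = (1 - u/2) *\<^sub>R x + (u/2) *\<^sub>R y"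
      by (simp add: midpoint_def scaleR_conv_of_real field_simps)
    then show "z \<in> insert x (open_segment x y)"
      using u assms by (cases "u = 0") (auto simp: in_segment intro!: exI[of _ "u/2"])
  qed
  show "closed_segment (midpoint x y) y \<subseteq> insert y (open_segment x y)"
  proof
    fix z assume "z \<in> closed_segment (midpoint x y) y"
    then obtain u where u: "0 \<le> u" "u \<le> 1" "z = (1 - u) *\<^sub>R midpoint x y + u *\<^sub>R y"
      by (auto simp: in_segment)
    then have "z = (1 - (1+u)/2) *\<^sub>R x + ((1+u)/2) *\<^sub>R y"
      by (simp add: midpoint_def scaleR_conv_of_real add_divide_distrib diff_divide_distrib algebra_simps)
    then show "z \<in> insert y (open_segment x y)"
      using u assms by (cases "u = 1") (auto simp: in_segment intro!: exI[of _ "(1+u)/2"])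
  qed
  have "dist x (midpoint x y) = dist x y / 2" "dist (midpoint x y) y = dist x y / 2"
    by (auto simp: dist_midpoint)
  moreover have "dist x y > 0" using assms by simp
  ultimately have "\<not> dist x y \<le> dist x (midpoint x y)" "\<not> dist x y \<le> dist (midpoint x y) y"
    by linarith+
  then show "y \<notin> closed_segment x (midpoint x y)" "x \<notin> closed_segment (midpoint x y) y"
    using dist_in_closed_segment[of y x "midpoint x y"] dist_in_closed_segment[of x "midpoint x y" y]
    by (metis dist_commute)+
qed

lemma turns_half_segments:
  fixes x y :: complex
  assumes "x \<noteq> y"
  shows "turns y (linepath x (midpoint x y)) = 0" "turns x (linepath (midpoint x y) y) = 0"
proof -
  have "midpoint x y - y = of_real (1/2) * (x - y)" "y - x = of_real 2 * (midpoint x y - x)"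
    by (simp_all add: midpoint_def scaleR_conv_of_real algebra_simps)
  then show "turns y (linepath x (midpoint x y)) = 0" "turns x (linepath (midpoint x y) y) = 0"
    using half_segments[OF assms] turns_linepath_eq_0 by blast+
qed

text \<open>
  The first two terms rotate the direction from \<open>m\<close> to \<open>x\<close> into that from \<open>m\<close> to \<open>m'\<close>, the target
  moving along \<open>P\<close>; the other two rotate this into the direction from \<open>x'\<close> to \<open>m'\<close>, the source moving
  along \<open>P\<close>.  So this is the total turning on the way from \<open>m\<close> over \<open>P\<close> to \<open>m'\<close>.
\<close>

definition corner_turn :: "complex \<Rightarrow> complex \<Rightarrow> (real \<Rightarrow> complex) \<Rightarrow> complex \<Rightarrow> complex \<Rightarrow> real" where
  "corner_turn m x P x' m' =
     turns m P + turns m (linepath x' m') + turns m' (linepath m x) + turns m' P"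

text \<open>The free end slides outwards along its arm from the midpoint to \<open>y\<close>.
  Exchanging the outer half of the arm with the rest of the corner shows that nothing changes, since
  \<open>x'\<close> sees no turning along its own arm.\<close>

lemma corner_turn_midpoint:
  assumes P: "path P" "pathstart P = x" "pathfinish P = x'" and "x' \<noteq> y"
    and disj: "(closed_segment m x \<union> path_image P) \<inter> closed_segment x' y \<subseteq> {x'}" "m \<noteq> x'"
  shows "corner_turn m x P x' (midpoint x' y) = corner_turn m x P x' y"
proof -
  define h where "h = midpoint x' y"
  note half = half_segments[OF \<open>x' \<noteq> y\<close>, folded h_def]
  have sub: "closed_segment h y \<subseteq> closed_segment x' y"
    by (simp add: h_def subset_closed_segment)
  have m: "m \<notin> closed_segment x' y" using disj by auto
  have W: "(closed_segment m x \<union> path_image P) \<inter> closed_segment h y = {}"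
    using disj sub half(4) by blast
  have "turns h (linepath m x +++ P) + turns x' (linepath h y) =
      turns m (linepath h y) + turns y (linepath m x +++ P)"
    using turns_exchange[of "linepath h y" "linepath m x +++ P"] P W
    by (simp add: path_image_join)
       (metis Int_commute)
  moreover have "turns h (linepath m x +++ P) = turns h (linepath m x) + turns h P"
      "turns y (linepath m x +++ P) = turns y (linepath m x) + turns y P"
    using P W by (intro turns_join; force)+
  moreover have "turns m (linepath x' y) = turns m (linepath x' h) + turns m (linepath h y)"
    using m by (intro turns_linepath_split) (auto simp: h_def)
  moreover have "turns x' (linepath h y) = 0"
    using turns_half_segments[OF \<open>x' \<noteq> y\<close>] by (simp add: h_def)
  ultimately show ?thesis by (simp add: corner_turn_def h_def)
qed

text \<open>At its start, on the segment, \<open>q\<close> is seen from \<open>x\<close> and from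
  \<open>y\<close> in opposite directions; this is the source of the half turn. The viewpoint is
  moved from \<open>y\<close> to \<open>x\<close> along the segment, except near the start of
  \<open>q\<close>.\<close>

lemma turns_left_start:
  assumes q: "path q" "pathstart q = midpoint x y" and xy: "x \<noteq> y"
    and avoid: "q ` {0<..1} \<inter> closed_segment x y = {}"
    and left: "\<forall>\<^sub>F t in at_right 0. Im ((q t - midpoint x y) / (midpoint x y - x)) > 0"
  shows "turns x q = turns y q + 1 / 2 + turns (pathfinish q) (linepath y x)"
proof -
  define m where "m = midpoint x y"
  define u where "u = m - x"
  define w where "w = (\<lambda>t. (q t - m) / u)"
  define m' where "m' = pathfinish q"
  have u0: "u \<noteq> 0" using xy by (auto simp: u_def m_def midpoint_eq_endpoint)
  have xm: "x = m + of_real (-1) * u" and ym: "y = m + of_real 1 * u"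
    by (simp_all add: u_def m_def midpoint_def scaleR_conv_of_real field_simps)
  have on_seg: "m + of_real r * u \<in> closed_segment x y" if "-1 \<le> r" "r \<le> 1" for r
  proof -
    have "m + of_real r * u = (1 - (1+r)/2) *\<^sub>R x + ((1+r)/2) *\<^sub>R y"
      unfolding xm ym by (simp add: scaleR_conv_of_real field_simps)
    then show ?thesis using that unfolding in_segment
      by (intro exI[of _ "(1+r)/2"]) auto
  qed
  have cw: "continuous_on {0..1} w"
    using q u0 unfolding w_def path_def by (intro continuous_intros) auto
  have w0: "w 0 = 0" using q by (simp add: w_def m_def pathstart_def)
  obtain d where d: "d > 0" "\<And>t. 0 < t \<Longrightarrow> t < d \<Longrightarrow> Im (w t) > 0"
    using left unfolding eventually_at_right_field w_def u_def m_def by auto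
  define d' where "d' = min d 1 / 2"
  have d': "0 < d'" "d' < 1" "d' < d" using d by (auto simp: d'_def)
  have wne: "w t \<noteq> of_real r" if "0 < t" "t \<le> 1" "-1 \<le> r" "r \<le> 1" for t r
  proof
    assume "w t = of_real r"
    then have "q t = m + of_real r * u" using u0 by (simp add: w_def field_simps)
    then have "q t \<in> closed_segment x y" using on_seg[OF that(3,4)] by simp
    moreover have "q t \<in> q ` {0<..1}" using that(1,2) by auto
    ultimately show False using avoid by blast
  qed
  have "\<exists>s>0. \<forall>t\<in>{d'..1}. s < cmod (w t)"
  proof -
    have "continuous_on {d'..1} (\<lambda>t. cmod (w t))"
      using d' by (intro continuous_intros continuous_on_subset[OF cw]) auto
    then obtain t0 where t0: "t0 \<in> {d'..1}" "\<And>t. t \<in> {d'..1} \<Longrightarrow> cmod (w t0) \<le> cmod (w t)"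
      using continuous_attains_inf[of "{d'..1}" "\<lambda>t. cmod (w t)"] d' by auto
    have "w t0 \<noteq> 0" using wne[of t0 0] t0 d' by auto
    then have "cmod (w t0) / 2 < cmod (w t)" if "t \<in> {d'..1}" for t
      using t0(2)[OF that] zero_less_norm_iff[of "w t0"] by linarith
    then show ?thesis using \<open>w t0 \<noteq> 0\<close> by (intro exI[of _ "cmod (w t0) / 2"]) auto
  qed
  then obtain s0 where s0: "s0 > 0" "\<And>t. t \<in> {d'..1} \<Longrightarrow> s0 < cmod (w t)" by blast
  define s where "s = min s0 (1/2)"
  have s: "0 < s" "s < 1" "\<And>t. t \<in> {d'..1} \<Longrightarrow> s < cmod (w t)"
    using s0 by (auto simp: s_def min_less_iff_disj)
  \<comment> \<open>The part of the segment from \<open>z\<close> to \<open>z'\<close> is replaced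
    by a detour \<open>rho\<close> to the right of \<open>m\<close> within distance
    \<open>s * cmod u\<close>. The curve \<open>q\<close> is to the left up to time
    \<open>d'\<close> and farther than that from \<open>m\<close> afterwards, so it misses
    \<open>rho\<close>. Seen from \<open>m\<close>, the detour is a clockwise half turn.\<close>
  define z where "z = m + of_real s * u"
  define z' where "z' = m + of_real (- s) * u"
  define r where "r = m - \<i> * of_real s * u"
  define rho where "rho = linepath z r +++ linepath r z'"
  have rho_pts: "\<exists>v. p = m + v * u \<and> v \<noteq> 0 \<and> Im v \<le> 0 \<and> cmod v \<le> s" if "p \<in> path_image rho" for p
  proof -
    from that have "p \<in> closed_segment z r \<or> p \<in> closed_segment r z'"
      by (auto simp: rho_def path_image_join)
    then obtain c k where k: "0 \<le> k" "k \<le> 1" and c: "c = 1 \<or> c = (-1::real)"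
      and p: "p = (1 - k) *\<^sub>R r + k *\<^sub>R (m + of_real (c * s) * u)"
    proof (elim disjE)
      assume "p \<in> closed_segment z r"
      then have "p \<in> closed_segment r z" by (simp add: closed_segment_commute)
      then show thesis using that[of _ 1] by (auto simp: in_segment z_def)
    next
      assume "p \<in> closed_segment r z'"
      then show thesis using that[of _ "-1"] by (auto simp: in_segment z'_def)
    qed
    define v where "v = of_real (k * c * s) - \<i> * of_real ((1 - k) * s)"
    have "p = m + v * u"
      unfolding p r_def v_def by (simp add: scaleR_conv_of_real algebra_simps)
    moreover have "v \<noteq> 0" using s c k by (auto simp: v_def complex_eq_iff)
    moreover have "Im v \<le> 0" using s k by (simp add: v_def)
    moreover have "cmod v \<le> s"
    proof -
      have "cmod v \<le> \<bar>k * c * s\<bar> + \<bar>(1 - k) * s\<bar>"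
        unfolding v_def
        by (rule order_trans[OF norm_triangle_ineq4]) (simp add: norm_mult del: of_real_mult of_real_diff)
      also have "\<dots> = k * s + (1 - k) * s" using s k c by (auto simp: abs_mult)
      finally show ?thesis by (simp add: algebra_simps)
    qed
    ultimately show ?thesis by blast
  qed
  have disj: "path_image rho \<inter> path_image q = {}"
  proof (rule ccontr)
    assume "path_image rho \<inter> path_image q \<noteq> {}"
    then obtain t where t: "t \<in> {0..1}" "q t \<in> path_image rho" unfolding path_image_def[of q] by blast
    then obtain v where v: "q t = m + v * u" "v \<noteq> 0" "Im v \<le> 0" "cmod v \<le> s"
      using rho_pts by blast
    then have wv: "w t = v" using u0 by (simp add: w_def)
    show False
    proof (cases "t < d'")
      case True
      then show ?thesis using d(2)[of t] d' t w0 v wv by (cases "t = 0") auto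
    next
      case False
      then show ?thesis using s(3)[of t] t wv v by auto
    qed
  qed
  have prho: "path rho" "pathstart rho = z" "pathfinish rho = z'"
    by (auto simp: rho_def)
  have m_rho: "m \<notin> path_image rho" using rho_pts[of m] u0 by auto
  have 1: "turns z q + turns m' rho = turns m rho + turns z' q"
    using turns_exchange[OF prho(1) q(1) disj] q prho by (simp add: m_def m'_def)
  have 2: "turns m rho = - (1/2)"
  proof -
    have A: "Arg (- \<i>) = - (pi / 2)"
      by simp
    have i: "m \<notin> closed_segment z r" "m \<notin> closed_segment r z'"
      using m_rho by (auto simp: rho_def path_image_join)
    have "turns m rho = turns m (linepath z r) + turns m (linepath r z')"
      unfolding rho_def using i by (intro turns_join) auto
    moreover have "(r - m) / (z - m) = - \<i>" "(z' - m) / (r - m) = - \<i>"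
      using u0 s by (auto simp: r_def z_def z'_def field_simps)
    ultimately show ?thesis using i by (simp add: turns_linepath A)
  qed
  have mq: "m' = m + w 1 * u" "s < cmod (w 1)" 
    using u0 s(3)[of 1] d' by (auto simp: w_def m'_def pathfinish_def)
  have "q 1 \<in> q ` {0<..1}" by (rule imageI) simp
  then have m'seg: "m' \<notin> closed_segment x y"
    using avoid unfolding m'_def pathfinish_def by blast
  have zz: "z \<in> closed_segment x y" "z' \<in> closed_segment x y"
    using on_seg[of s] on_seg[of "-s"] s(1,2) by (simp_all add: z_def z'_def)
  have seg_sub: "closed_segment z z' \<subseteq> closed_segment x y" "closed_segment y z \<subseteq> closed_segment x y" "closed_segment z' x \<subseteq> closed_segment x y"
    using zz by (simp_all add: subset_closed_segment)
  \<comment> \<open>The point \<open>m'\<close> is outside the disc that contains the detour, so it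
    cannot distinguish it from the straight piece.\<close>
  have 3: "turns m' rho = turns m' (linepath z z')"
  proof -
    have ball: "path_image (rho +++ linepath z' z) \<subseteq> cball m (s * cmod u)"
    proof -
      have "path_image rho \<subseteq> cball m (s * cmod u)"
      proof
        fix p assume "p \<in> path_image rho"
        then obtain v where "p = m + v * u" "cmod v \<le> s" using rho_pts by blast
        then show "p \<in> cball m (s * cmod u)" by (simp add: dist_norm norm_mult mult_right_mono)
      qed
      moreover have "z \<in> cball m (s * cmod u)" "z' \<in> cball m (s * cmod u)"
        using s by (auto simp: z_def z'_def dist_norm norm_mult)
      then have "closed_segment z' z \<subseteq> cball m (s * cmod u)"
        by (intro closed_segment_subset) auto
      ultimately show ?thesis using prho by (simp add: path_image_join)
    qed
    have m'ball: "m' \<notin> cball m (s * cmod u)"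
      using mq u0 by (simp add: dist_norm norm_mult)
    have "turns m' (rho +++ linepath z' z) = 0"
      unfolding turns_def
      by (subst winding_number_zero_outside[OF _ _ _ m'ball ball]) (use prho in auto)
    moreover have "m' \<notin> path_image rho" "m' \<notin> closed_segment z' z"
      using ball m'ball prho by (auto simp: path_image_join)
    then have "turns m' (rho +++ linepath z' z) = turns m' rho + turns m' (linepath z' z)"
      using prho by (intro turns_join) auto
    ultimately show ?thesis
      using turns_linepath_rev[of m' z' z] \<open>m' \<notin> closed_segment z' z\<close> by simp
  qed
  have qseg: "closed_segment a b \<inter> path_image q = {}" if "closed_segment a b \<subseteq> closed_segment x y"
      "m \<notin> closed_segment a b" for a b
  proof (rule ccontr)
    assume "closed_segment a b \<inter> path_image q \<noteq> {}"
    then obtain t where t: "t \<in> {0..1}" "q t \<in> closed_segment a b" unfolding path_image_def by blast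
    then have "q t \<in> closed_segment x y" using that by auto
    then have "t \<notin> {0<..1}" using avoid by blast
    then have "t = 0" using t by auto
    then show False using t that q by (auto simp: m_def pathstart_def)
  qed
  have nm: "m \<notin> closed_segment (m + of_real a * u) (m + of_real b * u)" if "a > 0 \<and> b > 0 \<or> a < 0 \<and> b < 0" for a b
  proof
    assume "m \<in> closed_segment (m + of_real a * u) (m + of_real b * u)"
    then obtain k where k: "0 \<le> k" "k \<le> 1" "m = (1 - k) *\<^sub>R (m + of_real a * u) + k *\<^sub>R (m + of_real b * u)"
      by (auto simp: in_segment)
    then have "of_real ((1 - k) * a + k * b) * u = 0"
      by (simp add: scaleR_conv_of_real algebra_simps)
    then have "(1 - k) * a + k * b = 0" using u0 by (simp only: mult_eq_0_iff of_real_eq_0_iff) auto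
    moreover have "(1 - k) * a + k * b \<noteq> 0"
      using that k by (smt (verit) mult_nonneg_nonneg mult_nonneg_nonpos mult_pos_pos mult_pos_neg)
    ultimately show False by simp
  qed
  have nm1: "m \<notin> closed_segment y z" and nm2: "m \<notin> closed_segment z' x"
    unfolding xm ym z_def z'_def using s(1,2) nm[of 1 s] nm[of "-s" "-1"] by auto
  have t0: "turns m (linepath y z) = 0" "turns m (linepath z' x) = 0"
    using turns_linepath_on_line[of m m 1 u s 0] turns_linepath_on_line[of m m "-s" u "-1" 0] nm1 nm2
    unfolding xm ym z_def z'_def by auto
  have 4: "turns y q + turns m' (linepath y z) = turns z q"
    using turns_exchange[of "linepath y z" q] qseg[OF seg_sub(2) nm1] q t0 by (simp add: m'_def m_def)
  have 5: "turns z' q + turns m' (linepath z' x) = turns x q"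
    using turns_exchange[of "linepath z' x" q] qseg[OF seg_sub(3) nm2] q t0 by (simp add: m'_def m_def)
  have 6: "turns m' (linepath y x) = turns m' (linepath y z') + turns m' (linepath z' x)"
    using m'seg zz by (intro turns_linepath_split) (simp_all add: closed_segment_commute[of y x])
  have "z \<in> closed_segment y z'"
  proof -
    have "z = (1 - (1-s)/(1+s)) *\<^sub>R y + ((1-s)/(1+s)) *\<^sub>R z'"
    proof -
      have "1 + complex_of_real s \<noteq> 0" using s(1) by (simp add: complex_eq_iff)
      moreover have "1 + s \<noteq> 0" using s(1) by simp
      ultimately show ?thesis unfolding ym z_def z'_def
        by (simp add: scaleR_conv_of_real divide_simps) (simp add: algebra_simps)
    qed
    then show ?thesis using s unfolding in_segment by (intro exI[of _ "(1-s)/(1+s)"]) auto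
  qed
  moreover have "closed_segment y z' \<subseteq> closed_segment x y"
    using zz by (simp add: subset_closed_segment)
  ultimately have 7: "turns m' (linepath y z') = turns m' (linepath y z) + turns m' (linepath z z')"
    using m'seg zz by (intro turns_linepath_split) auto
  show ?thesis using 1 2 3 4 5 6 7 by (simp add: m'_def)
qed

text \<open>By \<open>turns_left_start\<close>, the view of \<open>q\<close> from \<open>x\<close>
  can be replaced by that from the outer end \<open>y\<close> of the link. There the motions of free
  end and hinge balance, because \<open>y\<close> is not encircled; what remains is half a turn
  minus the corner turn at the link.\<close>

lemma turns_left_rotation:
  assumes p: "path p" "pathstart p = x" "pathfinish p = x'"
    and q: "path q" "pathstart q = midpoint x y" "pathfinish q = m'" and xy: "x \<noteq> y"
    and pq: "path_image p \<inter> path_image q = {}"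
    and avoid: "q ` {0<..1} \<inter> closed_segment x y = {}"
    and left: "\<forall>\<^sub>F t in at_right 0. Im ((q t - midpoint x y) / (midpoint x y - x)) > 0"
    and py: "path_image p \<inter> closed_segment x y \<subseteq> {x}"
    and arm: "closed_segment m' x' \<inter> closed_segment x y \<subseteq> {x}"
    and enc: "turns y (join_all [linepath x (midpoint x y), q, linepath m' x', reversepath p]) = 0"
  shows "turns 0 (\<lambda>t. q t - p t) = 1 / 2 - corner_turn m' x' (reversepath p) x (midpoint x y)"
proof -
  define m where "m = midpoint x y"
  have m'p: "m' \<notin> path_image p" using pq q pathfinish_in_path_image[of q] by blast
  have "q 1 \<in> q ` {0<..1}" by (rule imageI) simp
  then have m': "m' \<notin> closed_segment x y"
    using avoid q(3) unfolding pathfinish_def by blast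
  have yq: "y \<notin> path_image q"
  proof
    assume "y \<in> path_image q"
    then obtain t where t: "t \<in> {0..1}" "q t = y" unfolding path_image_def by blast
    have "q 0 \<noteq> y" using q(2) xy by (simp add: pathstart_def midpoint_eq_endpoint)
    then have "t \<in> {0<..1}" using t by (cases "t = 0") auto
    then have "y \<in> q ` {0<..1}" using t by blast
    then show False using avoid by auto
  qed
  have yp: "y \<notin> path_image p" and yarm: "y \<notin> closed_segment m' x'"
    using py arm xy by auto
  have "turns y (join_all [linepath x m, q, linepath m' x', reversepath p])
      = sum_list (map (turns y) [linepath x m, q, linepath m' x', reversepath p])"
    using p q yq yp yarm half_segments[OF xy] by (intro turns_join_all) (auto simp: m_def)
  then have 1: "turns y q + turns y (linepath m' x') - turns y p = 0"
    using enc turns_half_segments(1)[OF xy] p yp by (simp add: m_def turns_reversepath)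
  have 2: "turns x q = turns y q + 1 / 2 + turns m' (linepath y x)"
    using turns_left_start[OF q(1,2) xy avoid left] q(3) by simp
  have 3: "turns 0 (\<lambda>t. q t - p t) = turns x q + turns m' p"
    using turns_diff[OF p(1) q(1) pq] p q by simp
  have "corner_turn m' x' (reversepath p) x m = corner_turn m' x' (reversepath p) x y"
    unfolding m_def
  proof (rule corner_turn_midpoint)
    show "(closed_segment m' x' \<union> path_image (reversepath p)) \<inter> closed_segment x y \<subseteq> {x}"
      using py arm by auto
  qed (use p xy m' in auto)
  then show ?thesis
    using 1 2 3 p m'p yp m' yarm turns_linepath_rev[of m' y x]
    by (simp add: corner_turn_def turns_reversepath m_def closed_segment_commute)
qed

text \<open>By \<open>turns_diff'\<close> the left-hand side is the angle of the rotation whose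
  hinge moves from \<open>x1\<close> over \<open>c\<close> to \<open>x2\<close>. As the swept
  boundary does not encircle \<open>z\<close>, this is the same as turning via the arm from
  \<open>c\<close> to \<open>z\<close>, so the angle is the difference of the two corner turns into
  that arm.\<close>

lemma turns_rotation_between:
  assumes a: "path a" "pathstart a = c" "pathfinish a = x1"
    and b: "path b" "pathstart b = c" "pathfinish b = x2"
    and q: "path q" "pathstart q = m1" "pathfinish q = m2"
    and aq: "path_image a \<inter> path_image q = {}" and bq: "path_image b \<inter> path_image q = {}"
    and zq: "closed_segment c z \<inter> path_image q = {}"
    and z: "z \<notin> path_image a" "z \<notin> path_image b" "z \<notin> closed_segment x1 m1" "z \<notin> closed_segment x2 m2"
    and enc: "turns z (linepath x1 m1) + turns z q + turns z (linepath m2 x2) - turns z b + turns z a = 0"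
  shows "turns x2 q + turns m1 (reversepath a +++ b) =
    corner_turn m1 x1 (reversepath a) c z - corner_turn m2 x2 (reversepath b) c z"
proof -
  have m12: "m1 \<in> path_image q" "m2 \<in> path_image q" using q by auto
  have m: "m1 \<notin> path_image a" "m2 \<notin> path_image a" "m1 \<notin> path_image b" "m2 \<notin> path_image b"
    "m1 \<notin> closed_segment c z" "m2 \<notin> closed_segment c z"
    using aq bq zq m12 by auto
  have 1: "turns c q + turns m2 b = turns m1 b + turns x2 q"
    using turns_exchange[OF b(1) q(1) bq] b q by simp
  have 2: "turns z q + turns m2 (linepath z c) = turns m1 (linepath z c) + turns c q"
    using turns_exchange[of "linepath z c" q] q zq by (simp add: closed_segment_commute)
  have 3: "turns m1 (reversepath a +++ b) = - turns m1 a + turns m1 b"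
    using a b m by (simp add: turns_join turns_reversepath)
  show ?thesis
    unfolding corner_turn_def 3
    using 1 2 enc m z a b turns_linepath_rev[of m1 c z] turns_linepath_rev[of m2 c z]
      turns_linepath_rev[of z x1 m1]
    by (simp add: turns_reversepath closed_segment_commute)
qed

text \<open>A point on a side sees the rest of a closed curve perform half a turn if the exterior is
  to the right of the side. Instead of a limit, the view from one point \<open>z\<close> slightly to
  the right is computed exactly.\<close>

lemma turns_right_side:
  assumes Z: "path Z" "pathstart Z = y" "pathfinish Z = x" and xy: "x \<noteq> y"
    and disj: "path_image Z \<inter> open_segment x y = {}"
    and right: "\<forall>\<^sub>F t in at_right 0. turns (midpoint x y - of_real t * (\<i> * (y - x))) (Z +++ linepath x y) = 0"
  shows "turns (midpoint x y) Z = 1 / 2"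
proof -
  define m where "m = midpoint x y"
  define h where "h = (y - x) / 2"
  have h0: "h \<noteq> 0" using xy by (simp add: h_def)
  have xm: "x = m - h" and ym: "y = m + h"
    by (simp_all add: h_def m_def midpoint_def scaleR_conv_of_real field_simps)
  have mZ: "m \<notin> path_image Z" using disj xy by (auto simp: m_def)
  have "open (- path_image Z)" using closed_path_image[OF Z(1)] by auto
  then obtain e where e: "e > 0" "ball m e \<subseteq> - path_image Z"
    using mZ openE by blast
  obtain d where d: "d > 0" "\<And>t. 0 < t \<Longrightarrow> t < d \<Longrightarrow> turns (m - of_real t * (\<i> * (y - x))) (Z +++ linepath x y) = 0"
    using right unfolding eventually_at_right_field m_def by auto
  define t where "t = min d (e / cmod (y - x)) / 2"
  have t: "0 < t" "t < d" "t * cmod (y - x) < e"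
    using d(1) e(1) xy by (auto simp: t_def min_def field_simps split: if_splits)
  define r where "r = 2 * t"
  have r: "r > 0" using t by (simp add: r_def)
  define z where "z = m - \<i> * of_real r * h"
  have zt: "z = m - of_real t * (\<i> * (y - x))" by (simp add: z_def r_def h_def)
  have zball: "z \<in> ball m e"
    using t by (simp add: zt dist_norm norm_mult)
  have seg: "closed_segment m z \<inter> path_image Z = {}"
    using e zball closed_segment_subset[of m "ball m e" z] by auto
  have zZ: "z \<notin> path_image Z" using e zball by auto
  have 1: "turns m Z + turns x (linepath m z) = turns y (linepath m z) + turns z Z"
    using turns_exchange[of "linepath m z" Z] Z seg by simp
  have notin: "w \<notin> closed_segment u v" if "Im ((w - u) / h) * Im ((v - u) / h) < 0 \<or> (Im ((v - u) / h) = 0 \<and> Im ((w - u) / h) \<noteq> 0)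
      \<or> (Re ((v - u) / h) = 0 \<and> Re ((w - u) / h) \<noteq> 0)" for u v w
  proof
    assume "w \<in> closed_segment u v"
    then obtain k where k: "0 \<le> k" "w = (1 - k) *\<^sub>R u + k *\<^sub>R v" by (auto simp: in_segment)
    define X where "X = (v - u) / h"
    have "(w - u) / h = of_real k * X"
      unfolding k X_def by (simp add: scaleR_conv_of_real field_simps)
    then have "Im ((w - u) / h) = k * Im ((v - u) / h)" "Re ((w - u) / h) = k * Re ((v - u) / h)"
      unfolding X_def[symmetric] by simp_all
    then show False using that k(1) by (auto simp: mult_less_0_iff zero_less_mult_iff)
  qed
  have ne: "x \<notin> closed_segment m z" "y \<notin> closed_segment m z" "z \<notin> closed_segment x y"
    using h0 r by (intro notin; simp add: xm ym z_def diff_divide_distrib)+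
  have 2: "turns z (Z +++ linepath x y) = turns z Z + turns z (linepath x y)"
    using Z zZ ne by (intro turns_join) auto
  \<comment> \<open>\<open>A\<close> is the angle at \<open>x\<close> and at \<open>y\<close>
    between the side and the direction to \<open>z\<close>. It enters with both signs and cancels in
    the end.\<close>
  define A where "A = Arg (1 + \<i> * of_real r)"
  have A: "0 < A" "A < pi / 2"
    using r Arg_lt_pi[of "1 + \<i> * of_real r"] Re_Ln_pos_lt_imp[of "1 + \<i> * of_real r"] Arg_eq_Im_Ln[of "1 + \<i> * of_real r"]
    by (auto simp: A_def complex_eq_iff)
  have y1: "turns y (linepath m z) = A / (2 * pi)"
  proof -
    have "(z - y) / (m - y) = 1 + \<i> * of_real r" using h0 by (simp add: ym z_def field_simps)
    then show ?thesis using turns_linepath[OF ne(2)] by (simp add: A_def)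
  qed
  have x1: "turns x (linepath m z) = - A / (2 * pi)"
  proof -
    have "(z - x) / (m - x) = cnj (1 + \<i> * of_real r)" using h0 by (simp add: xm z_def field_simps)
    moreover have "Arg (cnj (1 + \<i> * of_real r)) = - A"
      using r by (subst Arg_cnj) (simp add: A_def complex_is_Real_iff)
    ultimately show ?thesis using turns_linepath[OF ne(1)] by simp
  qed
  have z1: "turns z (linepath x y) = (2 * A - pi) / (2 * pi)"
  proof -
    define c where "c = 1 + \<i> * complex_of_real r"
    have c: "c = of_real (cmod c) * exp (\<i> * of_real A)" "c \<noteq> 0"
      using Arg_eq[of c] by (auto simp: c_def A_def complex_eq_iff)
    have "(y - z) / (x - z) = c / (- cnj c)" using h0 by (simp add: xm ym z_def c_def field_simps)
    moreover have "Arg (c / (- cnj c)) = 2 * A - pi"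
    proof (rule Arg_unique[of 1])
      have "cnj c = of_real (cmod c) * exp (- (\<i> * of_real A))"
        by (subst c(1)) (simp add: exp_cnj)
      then have "c / (- cnj c) = - (exp (\<i> * of_real A) / exp (- (\<i> * of_real A)))"
        using c by (metis (no_types, lifting) c(2) complex_mod_cnj divide_minus_right mult_divide_mult_cancel_left norm_eq_zero of_real_eq_0_iff)
      also have "\<dots> = exp (\<i> * of_real (2 * A)) * exp (- (\<i> * of_real pi))"
        by (simp add: exp_minus exp_pi_i' field_simps flip: exp_add)
      also have "\<dots> = exp (\<i> * of_real (2 * A - pi))"
        by (simp add: algebra_simps flip: exp_add)
      finally show "complex_of_real 1 * exp (\<i> * complex_of_real (2 * A - pi)) = c / (- cnj c)" by simp
    qed (use A in auto)
    ultimately show ?thesis using turns_linepath[OF ne(3)] by simp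
  qed
  have "turns z (Z +++ linepath x y) = 0" using d(2)[OF t(1,2)] by (simp add: zt)
  then have "turns m Z = - turns z (linepath x y) + turns y (linepath m z) - turns x (linepath m z)"
    using 1 2 by linarith
  also have "\<dots> = 1 / 2" unfolding x1 y1 z1 by (simp add: field_simps)
  finally show ?thesis by (simp add: m_def)
qed

section \<open>Turning tangents of a quadrilateral\<close>

fun disjoint_list :: "'a set list \<Rightarrow> bool" where
  "disjoint_list [] \<longleftrightarrow> True"
| "disjoint_list (A # As) \<longleftrightarrow> (\<forall>B\<in>set As. A \<inter> B = {}) \<and> disjoint_list As"

lemma disjoint_notin_right: "A \<inter> B = {} \<Longrightarrow> x \<in> A \<Longrightarrow> x \<notin> B"
  and disjoint_notin_left: "A \<inter> B = {} \<Longrightarrow> x \<in> B \<Longrightarrow> x \<notin> A"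
  by blast+

lemma disjoint_subset2: "A \<subseteq> X \<union> Y \<Longrightarrow> B \<subseteq> Z \<union> W \<Longrightarrow> X \<inter> Z = {} \<Longrightarrow> X \<inter> W = {} \<Longrightarrow>
    Y \<inter> Z = {} \<Longrightarrow> Y \<inter> W = {} \<Longrightarrow> A \<inter> B = {}"
  and disjoint_subset1: "A \<subseteq> X \<union> Y \<Longrightarrow> X \<inter> Z = {} \<Longrightarrow> Y \<inter> Z = {} \<Longrightarrow> A \<inter> Z = {}"
  by blast+

text \<open>Two successive corners share the side from \<open>x\<close> to \<open>y\<close>, and
  their curves meet in its midpoint. The exchange identity is therefore applied to pieces:
  \<open>p\<close> with \<open>q\<close>, and each half of the side with the curve that it does not
  touch.\<close>

lemma turns_adjacent:
  assumes p: "path p" "pathfinish p = x" and q: "path q" "pathstart q = y" and xy: "x \<noteq> y"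
    and disj: "path_image p \<inter> path_image q = {}" "path_image p \<inter> open_segment x y = {}"
      "path_image q \<inter> open_segment x y = {}"
  defines "m \<equiv> midpoint x y"
  shows "turns (pathstart p) (linepath m y) + turns (pathstart p) q
      + turns (pathfinish q) p + turns (pathfinish q) (linepath x m) = turns m p + turns m q"
proof -
  note half = half_segments[OF xy, folded m_def]
  have "y \<notin> path_image p" "x \<notin> path_image q"
    using disj(1) p q pathfinish_in_path_image[of p] pathstart_in_path_image[of q] by blast+
  then have d: "closed_segment m y \<inter> path_image p = {}" "closed_segment x m \<inter> path_image q = {}"
    using half(1,2) disj(2,3) by blast+
  show ?thesis
    using turns_exchange[OF p(1) q(1) disj(1)] turns_exchange[of "linepath m y" p] d
      turns_exchange[of "linepath x m" q] turns_half_segments[OF xy, folded m_def] p q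
    by simp
qed

text \<open>\<open>W\<close> runs from the midpoint of one side around the corner to the midpoint of
  the next side. \<open>p\<close> and \<open>q\<close> each omit one half-side, which keeps the
  curves of adjacent corners apart.\<close>

lemma corner_pieces:
  assumes P: "path P" "pathstart P = ya" "pathfinish P = xb" and ne: "xa \<noteq> ya" "xb \<noteq> yb"
  defines "ma \<equiv> midpoint xa ya" and "mb \<equiv> midpoint xb yb"
  defines "p \<equiv> linepath ma ya +++ P" and "q \<equiv> P +++ linepath xb mb"
    and "W \<equiv> linepath ma ya +++ P +++ linepath xb mb"
  shows "path W" "pathstart W = ma" "pathfinish W = mb"
    "path_image W \<subseteq> open_segment xa ya \<union> path_image P \<union> open_segment xb yb"
    "path p" "pathstart p = ma" "pathfinish p = xb"
    "path_image p \<subseteq> open_segment xa ya \<union> path_image P"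
    "path q" "pathstart q = ya" "pathfinish q = mb"
    "path_image q \<subseteq> path_image P \<union> open_segment xb yb"
    "ma \<in> open_segment xa ya" "ya \<in> path_image P" "xb \<in> path_image P" "mb \<in> open_segment xb yb"
    "closed_segment ma ya \<subseteq> open_segment xa ya \<union> path_image P"
    "closed_segment xb mb \<subseteq> open_segment xb yb \<union> path_image P"
    "\<And>z. z \<notin> open_segment xa ya \<union> path_image P \<union> open_segment xb yb \<Longrightarrow>
       turns z W = turns z (linepath ma ya) + turns z P + turns z (linepath xb mb)"
    "\<And>z. z \<notin> open_segment xa ya \<union> path_image P \<Longrightarrow> turns z p = turns z (linepath ma ya) + turns z P"
    "\<And>z. z \<notin> path_image P \<union> open_segment xb yb \<Longrightarrow> turns z q = turns z P + turns z (linepath xb mb)"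
proof -
  have xy: "ya \<in> path_image P" "xb \<in> path_image P" using P by auto
  then show "ya \<in> path_image P" "xb \<in> path_image P" .
  show seg: "closed_segment ma ya \<subseteq> open_segment xa ya \<union> path_image P"
    "closed_segment xb mb \<subseteq> open_segment xb yb \<union> path_image P"
    using half_segments(2)[OF ne(1)] half_segments(1)[OF ne(2)] xy by (auto simp: ma_def mb_def)
  show "path W" "pathstart W = ma" "pathfinish W = mb" "path p" "pathstart p = ma" "pathfinish p = xb"
    "path q" "pathstart q = ya" "pathfinish q = mb"
    using P by (auto simp: W_def p_def q_def)
  show "ma \<in> open_segment xa ya" "mb \<in> open_segment xb yb"
    using ne by (auto simp: ma_def mb_def)
  show "path_image W \<subseteq> open_segment xa ya \<union> path_image P \<union> open_segment xb yb"
    "path_image p \<subseteq> open_segment xa ya \<union> path_image P"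
    "path_image q \<subseteq> path_image P \<union> open_segment xb yb"
    using P seg by (auto simp: W_def p_def q_def path_image_join)
  show "turns z W = turns z (linepath ma ya) + turns z P + turns z (linepath xb mb)"
    if z: "z \<notin> open_segment xa ya \<union> path_image P \<union> open_segment xb yb" for z
  proof -
    have "z \<notin> path_image P" "z \<notin> closed_segment ma ya" "z \<notin> closed_segment xb mb" using z seg by auto
    then show ?thesis using P by (simp add: W_def turns_join path_image_join)
  qed
  show "turns z p = turns z (linepath ma ya) + turns z P"
    if z: "z \<notin> open_segment xa ya \<union> path_image P" for z
  proof -
    have "z \<notin> path_image P" "z \<notin> closed_segment ma ya" using z seg by auto
    then show ?thesis using P by (simp add: p_def turns_join)
  qed
  show "turns z q = turns z P + turns z (linepath xb mb)"
    if z: "z \<notin> path_image P \<union> open_segment xb yb" for z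
  proof -
    have "z \<notin> path_image P" "z \<notin> closed_segment xb mb" using z seg by auto
    then show ?thesis using P by (simp add: q_def turns_join)
  qed
qed

lemma closed_segment_halves:
  fixes x y :: complex
  shows "closed_segment x y = closed_segment x (midpoint x y) \<union> closed_segment (midpoint x y) y"
  by (rule Un_closed_segment[symmetric]) simp

lemma turns_linepath_halves:
  "z \<notin> closed_segment x y \<Longrightarrow>
   turns z (linepath x y) = turns z (linepath x (midpoint x y)) + turns z (linepath (midpoint x y) y)"
  by (intro turns_linepath_split) auto

text \<open>The left-hand side is a rotation about the corner whose free end follows the rest of the
  boundary while the hinge moves back along \<open>P\<close>. Exchanging \<open>Z\<close> with the
  half-side next to \<open>ya\<close> turns it into the view of the boundary from the midpoint of
  the side, which is half a turn in the applications.\<close>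

lemma turns_interior_angle:
  assumes P: "path P" "pathstart P = ya" "pathfinish P = xb" and ne: "xa \<noteq> ya" "xb \<noteq> yb"
    and Z: "path Z" "pathstart Z = midpoint xb yb" "pathfinish Z = xa"
    and disj: "path_image Z \<inter> open_segment xa ya = {}" "ya \<notin> path_image Z"
      "midpoint xa ya \<notin> path_image P" "midpoint xa ya \<notin> open_segment xb yb"
      "midpoint xb yb \<notin> path_image P" 
  shows "turns ya (Z +++ linepath xa (midpoint xa ya)) + turns (midpoint xb yb) (reversepath P) =
    turns (midpoint xa ya) P + turns (midpoint xa ya) (linepath xb (midpoint xb yb)) + turns (midpoint xa ya) Z
    - corner_turn (midpoint xa ya) ya P xb (midpoint xb yb)"
proof -
  define ma mb where "ma = midpoint xa ya" and "mb = midpoint xb yb"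
  note half = half_segments[OF ne(1), folded ma_def]
  have d: "closed_segment ma ya \<inter> path_image Z = {}" using half(2) disj(1,2) by blast
  have "turns ma Z + turns xa (linepath ma ya) = turns mb (linepath ma ya) + turns ya Z"
    using turns_exchange[of "linepath ma ya" Z] Z d by (simp add: mb_def)
  moreover have "turns ya (Z +++ linepath xa ma) = turns ya Z + turns ya (linepath xa ma)"
    using Z disj half by (intro turns_join) auto
  ultimately show ?thesis
    using turns_half_segments[OF ne(1), folded ma_def] P disj
    by (simp add: corner_turn_def turns_reversepath ma_def mb_def)
qed

context
  fixes x0 y0 x1 y1 x2 y2 x3 y3 :: complex and P0 P1 P2 P3 :: "real \<Rightarrow> complex"
  assumes P0: "path P0" "pathstart P0 = y3" "pathfinish P0 = x0"
    and P1: "path P1" "pathstart P1 = y0" "pathfinish P1 = x1"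
    and P2: "path P2" "pathstart P2 = y1" "pathfinish P2 = x2"
    and P3: "path P3" "pathstart P3 = y2" "pathfinish P3 = x3"
    and ne: "x0 \<noteq> y0" "x1 \<noteq> y1" "x2 \<noteq> y2" "x3 \<noteq> y3"
    and disj: "disjoint_list [open_segment x0 y0, path_image P1, open_segment x1 y1, path_image P2,
      open_segment x2 y2, path_image P3, open_segment x3 y3, path_image P0]"
begin

text \<open>
  Hopf's proof of the theorem of turning tangents, with the secants between adjacent and between
  opposite sides in place of a continuous family.  The premise on the point \<open>midpoint x1 y1\<close> of the
  boundary fixes the orientation.
\<close>

lemma quadrilateral_turns:
  assumes R: "turns (midpoint x1 y1) (join_all [P2, linepath x2 y2, P3, linepath x3 y3, P0, linepath x0 y0, P1]) = 1 / 2"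
  shows quadrilateral_sum: "corner_turn (midpoint x0 y0) y0 P1 x1 (midpoint x1 y1) + corner_turn (midpoint x1 y1) y1 P2 x2 (midpoint x2 y2)
      + corner_turn (midpoint x2 y2) y2 P3 x3 (midpoint x3 y3) + corner_turn (midpoint x3 y3) y3 P0 x0 (midpoint x0 y0) = 1"
    and quadrilateral_angle2: "turns y1 (join_all [linepath (midpoint x2 y2) y2, P3, linepath x3 y3, P0, linepath x0 y0, P1, linepath x1 (midpoint x1 y1)])
      + turns (midpoint x2 y2) (reversepath P2) = 1 / 2 - corner_turn (midpoint x1 y1) y1 P2 x2 (midpoint x2 y2)"
    and quadrilateral_angle3: "turns y2 (join_all [linepath (midpoint x3 y3) y3, P0, linepath x0 y0, P1, linepath x1 y1, P2, linepath x2 (midpoint x2 y2)])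
      + turns (midpoint x3 y3) (reversepath P3) = 1 / 2 - corner_turn (midpoint x2 y2) y2 P3 x3 (midpoint x3 y3)"
proof -
  let ?m0 = "midpoint x0 y0" and ?m1 = "midpoint x1 y1" and ?m2 = "midpoint x2 y2" and ?m3 = "midpoint x3 y3"
  note c0 = corner_pieces[OF P0 ne(4,1)] and c1 = corner_pieces[OF P1 ne(1,2)]
    and c2 = corner_pieces[OF P2 ne(2,3)] and c3 = corner_pieces[OF P3 ne(3,4)]
  define W0 where "W0 = linepath ?m3 y3 +++ P0 +++ linepath x0 ?m0"
  define W1 where "W1 = linepath ?m0 y0 +++ P1 +++ linepath x1 ?m1"
  define W2 where "W2 = linepath ?m1 y1 +++ P2 +++ linepath x2 ?m2"
  define W3 where "W3 = linepath ?m2 y2 +++ P3 +++ linepath x3 ?m3"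
  define p0 where "p0 = linepath ?m3 y3 +++ P0"
  define p1 where "p1 = linepath ?m0 y0 +++ P1"
  define p2 where "p2 = linepath ?m1 y1 +++ P2"
  define p3 where "p3 = linepath ?m2 y2 +++ P3"
  define q0 where "q0 = P0 +++ linepath x0 ?m0"
  define q1 where "q1 = P1 +++ linepath x1 ?m1"
  define q2 where "q2 = P2 +++ linepath x2 ?m2"
  define q3 where "q3 = P3 +++ linepath x3 ?m3"
  define E0 where "E0 = open_segment x0 y0"
  define E1 where "E1 = open_segment x1 y1"
  define E2 where "E2 = open_segment x2 y2"
  define E3 where "E3 = open_segment x3 y3"
  define I0 where "I0 = path_image P0"
  define I1 where "I1 = path_image P1"
  define I2 where "I2 = path_image P2"
  define I3 where "I3 = path_image P3"
  note Is = I0_def[symmetric] I1_def[symmetric] I2_def[symmetric] I3_def[symmetric]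
    E0_def[symmetric] E1_def[symmetric] E2_def[symmetric] E3_def[symmetric]
  have D: "E0 \<inter> I1 = {}" "E0 \<inter> E1 = {}" "E0 \<inter> I2 = {}" "E0 \<inter> E2 = {}" "E0 \<inter> I3 = {}" "E0 \<inter> E3 = {}" "E0 \<inter> I0 = {}"
    "I1 \<inter> E1 = {}" "I1 \<inter> I2 = {}" "I1 \<inter> E2 = {}" "I1 \<inter> I3 = {}" "I1 \<inter> E3 = {}" "I1 \<inter> I0 = {}"
    "E1 \<inter> I2 = {}" "E1 \<inter> E2 = {}" "E1 \<inter> I3 = {}" "E1 \<inter> E3 = {}" "E1 \<inter> I0 = {}"
    "I2 \<inter> E2 = {}" "I2 \<inter> I3 = {}" "I2 \<inter> E3 = {}" "I2 \<inter> I0 = {}"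
    "E2 \<inter> I3 = {}" "E2 \<inter> E3 = {}" "E2 \<inter> I0 = {}" "I3 \<inter> E3 = {}" "I3 \<inter> I0 = {}" "E3 \<inter> I0 = {}"
    using disj unfolding Is by simp_all
  note DC = D[THEN trans[OF Int_commute]]
  note c0 = c0[folded W0_def p0_def q0_def, unfolded Is] and c1 = c1[folded W1_def p1_def q1_def, unfolded Is]
    and c2 = c2[folded W2_def p2_def q2_def, unfolded Is] and c3 = c3[folded W3_def p3_def q3_def, unfolded Is]
  have mE: "?m0 \<in> E0" "?m1 \<in> E1" "?m2 \<in> E2" "?m3 \<in> E3"
    using c0(13,16) c1(13,16) c2(13,16) c3(13,16) ne unfolding E0_def E1_def E2_def E3_def by simp_all
  note notin = D(1-7)[THEN disjoint_notin_right, OF mE(1)]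
    D(2,8)[THEN disjoint_notin_left, OF mE(2)] D(14-18)[THEN disjoint_notin_right, OF mE(2)]
    D(4,10,15,19)[THEN disjoint_notin_left, OF mE(3)] D(23-25)[THEN disjoint_notin_right, OF mE(3)]
    D(6,12,17,21,24,26)[THEN disjoint_notin_left, OF mE(4)] D(28)[THEN disjoint_notin_right, OF mE(4)]
  note d0 = disjoint_subset2[OF c0(8) c1(12) DC(12) DC(17)
      DC(13) DC(18)]
    disjoint_subset1[OF c0(8) DC(6) DC(7)]
    disjoint_subset1[OF c1(12) DC(1) DC(2)]
  \<comment> \<open>The relations \<open>a0\<close> to \<open>a3\<close> belong to secants between
    adjacent corners, \<open>o1\<close> and \<open>o2\<close> to secants between opposite corners.
    Together with the premise they give the sum of the corner turns by linear arithmetic.\<close>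
  have a0: "turns ?m3 (linepath ?m0 y0) + turns ?m3 q1 + turns ?m1 p0 + turns ?m1 (linepath x0 ?m0) = turns ?m0 p0 + turns ?m0 q1"
    using turns_adjacent[of p0 x0 q1 y0, unfolded Is, OF _ _ _ _ _ d0] c0(5-7) c1(9-11) ne by simp
  note d1 = disjoint_subset2[OF c1(8) c2(12) D(3) D(4)
      D(9) D(10)]
    disjoint_subset1[OF c1(8) D(2) D(8)]
    disjoint_subset1[OF c2(12) DC(14) DC(15)]
  have a1: "turns ?m0 (linepath ?m1 y1) + turns ?m0 q2 + turns ?m2 p1 + turns ?m2 (linepath x1 ?m1) = turns ?m1 p1 + turns ?m1 q2"
    using turns_adjacent[of p1 x1 q2 y1, unfolded Is, OF _ _ _ _ _ d1] c1(5-7) c2(9-11) ne by simp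
  note d2 = disjoint_subset2[OF c2(8) c3(12) D(16) D(17)
      D(20) D(21)]
    disjoint_subset1[OF c2(8) D(15) D(19)]
    disjoint_subset1[OF c3(12) DC(23) DC(24)]
  have a2: "turns ?m1 (linepath ?m2 y2) + turns ?m1 q3 + turns ?m3 p2 + turns ?m3 (linepath x2 ?m2) = turns ?m2 p2 + turns ?m2 q3"
    using turns_adjacent[of p2 x2 q3 y2, unfolded Is, OF _ _ _ _ _ d2] c2(5-7) c3(9-11) ne by simp
  note d3 = disjoint_subset2[OF c3(8) c0(12) D(25) DC(4)
      D(27) DC(5)]
    disjoint_subset1[OF c3(8) D(24) D(26)]
    disjoint_subset1[OF c0(12) DC(28) D(6)]
  have a3: "turns ?m2 (linepath ?m3 y3) + turns ?m2 q0 + turns ?m0 p3 + turns ?m0 (linepath x3 ?m3) = turns ?m3 p3 + turns ?m3 q0"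
    using turns_adjacent[of p3 x3 q0 y3, unfolded Is, OF _ _ _ _ _ d3] c3(5-7) c0(9-11) ne by simp
  have o1: "turns ?m0 W3 + turns ?m3 W1 = turns ?m2 W1 + turns ?m1 W3"
  proof -
    have "path_image W1 \<inter> path_image W3 = {}" 
    proof -
      have "(E0 \<union> I1 \<union> E1) \<inter> (E2 \<union> I3 \<union> E3) = {}"
        by (simp add: Int_Un_distrib Int_Un_distrib2 D DC)
      then show ?thesis using c1(4) c3(4) by blast
    qed
    then show ?thesis using turns_exchange[of W1 W3] c1(1-3) c3(1-3) by simp
  qed
  have o2: "turns ?m3 W2 + turns ?m2 W0 = turns ?m1 W0 + turns ?m0 W2"
  proof -
    have "path_image W0 \<inter> path_image W2 = {}" 
    proof -
      have "(E3 \<union> I0 \<union> E0) \<inter> (E1 \<union> I2 \<union> E2) = {}"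
        by (simp add: Int_Un_distrib Int_Un_distrib2 D DC)
      then show ?thesis using c0(4) c2(4) by blast
    qed
    then show ?thesis using turns_exchange[of W0 W2] c0(1-3) c2(1-3) by simp
  qed
  note ex = c0(19-21) c1(19-21) c2(19-21) c3(19-21)
  note expand = ex[of ?m0] ex[of ?m1] ex[of ?m2] ex[of ?m3]
  have seg: "closed_segment x0 y0 \<subseteq> E0 \<union> I0 \<union> I1" "closed_segment x1 y1 \<subseteq> E1 \<union> I1 \<union> I2"
    "closed_segment x2 y2 \<subseteq> E2 \<union> I2 \<union> I3" "closed_segment x3 y3 \<subseteq> E3 \<union> I3 \<union> I0"
    unfolding E0_def E1_def E2_def E3_def closed_segment_eq_open
    using c0(14,15) c1(14,15) c2(14,15) c3(14,15) by (simp_all add: le_supI1)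
  have m1seg: "?m1 \<notin> closed_segment x0 y0" "?m1 \<notin> closed_segment x2 y2" "?m1 \<notin> closed_segment x3 y3"
    and m2seg: "?m2 \<notin> closed_segment x0 y0" "?m2 \<notin> closed_segment x1 y1" "?m2 \<notin> closed_segment x3 y3"
    by (rule contra_subsetD[OF seg(1)] contra_subsetD[OF seg(2)] contra_subsetD[OF seg(3)] contra_subsetD[OF seg(4)],
        simp add: notin)+
  have linked: "linked [P2, linepath x2 y2, P3, linepath x3 y3, P0, linepath x0 y0, P1]"
    using P0 P1 P2 P3 by simp
  have R': "turns ?m1 P2 + turns ?m1 (linepath x2 y2) + turns ?m1 P3 + turns ?m1 (linepath x3 y3) + turns ?m1 P0
      + turns ?m1 (linepath x0 y0) + turns ?m1 P1 = 1 / 2"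
  proof -
    have "?m1 \<notin> path_image g" if "g \<in> set [P2, linepath x2 y2, P3, linepath x3 y3, P0, linepath x0 y0, P1]" for g
      using that notin m1seg by (auto simp: Is)
    then show ?thesis using R turns_join_all[OF linked, of ?m1] by simp
  qed
  have halves: "turns z (linepath x0 y0) = turns z (linepath x0 ?m0) + turns z (linepath ?m0 y0)"
    "turns z (linepath x2 y2) = turns z (linepath x2 ?m2) + turns z (linepath ?m2 y2)"
    "turns z (linepath x3 y3) = turns z (linepath x3 ?m3) + turns z (linepath ?m3 y3)" if "z = ?m1" for z
    using m1seg unfolding that by (intro turns_linepath_halves; simp)+
  have halves': "turns z (linepath x0 y0) = turns z (linepath x0 ?m0) + turns z (linepath ?m0 y0)"
    "turns z (linepath x1 y1) = turns z (linepath x1 ?m1) + turns z (linepath ?m1 y1)"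
    "turns z (linepath x3 y3) = turns z (linepath x3 ?m3) + turns z (linepath ?m3 y3)" if "z = ?m2" for z
    using m2seg unfolding that by (intro turns_linepath_halves; simp)+
  show sum: "corner_turn ?m0 y0 P1 x1 ?m1 + corner_turn ?m1 y1 P2 x2 ?m2
      + corner_turn ?m2 y2 P3 x3 ?m3 + corner_turn ?m3 y3 P0 x0 ?m0 = 1"
    unfolding corner_turn_def
    using a0 a1 a2 a3 o1 o2 R' halves notin by (simp add: expand)
  \<comment> \<open>The half-turn property passes from the midpoint of one side to that of the next,
    so the third corner can be treated like the second.\<close>
  have R2: "turns ?m2 P3 + turns ?m2 (linepath x3 ?m3) + (turns ?m2 (linepath ?m3 y3) + turns ?m2 P0 + turns ?m2 (linepath x0 y0)
      + turns ?m2 P1 + turns ?m2 (linepath x1 y1) + turns ?m2 P2) = 1 / 2"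
    using a0 a1 a2 a3 o1 o2 R' halves halves' notin by (simp add: expand)
  define Z2 where "Z2 = join_all [linepath ?m2 y2, P3, linepath x3 y3, P0, linepath x0 y0, P1]"
  define Z3 where "Z3 = join_all [linepath ?m3 y3, P0, linepath x0 y0, P1, linepath x1 y1, P2]"
  have l2: "linked [linepath ?m2 y2, P3, linepath x3 y3, P0, linepath x0 y0, P1]"
    and l2': "linked [linepath ?m2 y2, P3, linepath x3 y3, P0, linepath x0 y0, P1, linepath x1 ?m1]"
    and l3: "linked [linepath ?m3 y3, P0, linepath x0 y0, P1, linepath x1 y1, P2]"
    and l3': "linked [linepath ?m3 y3, P0, linepath x0 y0, P1, linepath x1 y1, P2, linepath x2 ?m2]"
    using P0 P1 P2 P3 by simp_all
  have "closed_segment ?m2 y2 \<subseteq> E2 \<union> I3" "closed_segment ?m3 y3 \<subseteq> E3 \<union> I0"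
    using c3(17) c0(17) by simp_all
  then have iZ2: "path_image Z2 \<subseteq> E2 \<union> I3 \<union> E3 \<union> I0 \<union> E0 \<union> I1"
    and iZ3: "path_image Z3 \<subseteq> E3 \<union> I0 \<union> E0 \<union> I1 \<union> E1 \<union> I2"
    unfolding Z2_def path_image_join_all[OF l2] Z3_def path_image_join_all[OF l3] using seg by (auto simp: Is)
  have Z2: "path Z2" "pathstart Z2 = ?m2" "pathfinish Z2 = x1" and Z3: "path Z3" "pathstart Z3 = ?m3" "pathfinish Z3 = x2"
    using join_all_linked[OF l2] join_all_linked[OF l3] P1 P2 by (simp_all add: Z2_def Z3_def)
  have yI: "y1 \<in> I2" "y2 \<in> I3" using c2(14) c3(14) by simp_all
  have *: "path_image Z2 \<inter> E1 = {}" "y1 \<notin> path_image Z2" "path_image Z3 \<inter> E2 = {}" "y2 \<notin> path_image Z3"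
  proof -
    have "(E2 \<union> I3 \<union> E3 \<union> I0 \<union> E0 \<union> I1) \<inter> (E1 \<union> I2) = {}"
      "(E3 \<union> I0 \<union> E0 \<union> I1 \<union> E1 \<union> I2) \<inter> (E2 \<union> I3) = {}"
      by (simp_all add: Int_Un_distrib Int_Un_distrib2 D DC)
    then show "path_image Z2 \<inter> E1 = {}" "y1 \<notin> path_image Z2" "path_image Z3 \<inter> E2 = {}" "y2 \<notin> path_image Z3"
      using iZ2 iZ3 yI by blast+
  qed
  have m1Z2: "turns ?m1 Z2 = turns ?m1 (linepath ?m2 y2) + turns ?m1 P3 + turns ?m1 (linepath x3 y3) + turns ?m1 P0 + turns ?m1 (linepath x0 y0) + turns ?m1 P1"
  proof -
    have "?m1 \<notin> closed_segment ?m2 y2" by (rule contra_subsetD[OF c3(17)]) (simp add: notin)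
    then have "?m1 \<notin> path_image g" if "g \<in> set [linepath ?m2 y2, P3, linepath x3 y3, P0, linepath x0 y0, P1]" for g
      using that notin m1seg by (auto simp: Is)
    then show ?thesis using turns_join_all[OF l2, of ?m1] by (simp add: Z2_def)
  qed
  have m2Z3: "turns ?m2 Z3 = turns ?m2 (linepath ?m3 y3) + turns ?m2 P0 + turns ?m2 (linepath x0 y0) + turns ?m2 P1 + turns ?m2 (linepath x1 y1) + turns ?m2 P2"
  proof -
    have "?m2 \<notin> closed_segment ?m3 y3" by (rule contra_subsetD[OF c0(17)]) (simp add: notin)
    then have "?m2 \<notin> path_image g" if "g \<in> set [linepath ?m3 y3, P0, linepath x0 y0, P1, linepath x1 y1, P2]" for g
      using that notin m2seg by (auto simp: Is)
    then show ?thesis using turns_join_all[OF l3, of ?m2] by (simp add: Z3_def)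
  qed
  have y1Z: "turns y1 (join_all [linepath ?m2 y2, P3, linepath x3 y3, P0, linepath x0 y0, P1, linepath x1 ?m1])
      = turns y1 (Z2 +++ linepath x1 ?m1)"
  proof -
    have n: "y1 \<notin> closed_segment x1 ?m1" using half_segments(3)[OF ne(2)] .
    have g1: "y1 \<notin> path_image g" if "g \<in> set [linepath ?m2 y2, P3, linepath x3 y3, P0, linepath x0 y0, P1]" for g
      using that *(2) unfolding Z2_def path_image_join_all[OF l2] by (meson UN_I)
    have g2: "y1 \<notin> path_image g" if "g \<in> set [linepath ?m2 y2, P3, linepath x3 y3, P0, linepath x0 y0, P1, linepath x1 ?m1]" for g
    proof -
      have "g \<in> set [linepath ?m2 y2, P3, linepath x3 y3, P0, linepath x0 y0, P1] \<or> g = linepath x1 ?m1" using that by simp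
      then show ?thesis using g1[of g] n by (metis path_image_linepath)
    qed
    show ?thesis
      using turns_join_all[OF l2' g2] turns_join_all[OF l2 g1] turns_join[of Z2 "linepath x1 ?m1" y1] Z2 *(2) n
      by (simp add: Z2_def)
  qed
  have y2Z: "turns y2 (join_all [linepath ?m3 y3, P0, linepath x0 y0, P1, linepath x1 y1, P2, linepath x2 ?m2])
      = turns y2 (Z3 +++ linepath x2 ?m2)"
  proof -
    have n: "y2 \<notin> closed_segment x2 ?m2" using half_segments(3)[OF ne(3)] .
    have g1: "y2 \<notin> path_image g" if "g \<in> set [linepath ?m3 y3, P0, linepath x0 y0, P1, linepath x1 y1, P2]" for g
      using that *(4) unfolding Z3_def path_image_join_all[OF l3] by (meson UN_I)
    have g2: "y2 \<notin> path_image g" if "g \<in> set [linepath ?m3 y3, P0, linepath x0 y0, P1, linepath x1 y1, P2, linepath x2 ?m2]" for g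
    proof -
      have "g \<in> set [linepath ?m3 y3, P0, linepath x0 y0, P1, linepath x1 y1, P2] \<or> g = linepath x2 ?m2" using that by simp
      then show ?thesis using g1[of g] n by (metis path_image_linepath)
    qed
    show ?thesis
      using turns_join_all[OF l3' g2] turns_join_all[OF l3 g1] turns_join[of Z3 "linepath x2 ?m2" y2] Z3 *(4) n
      by (simp add: Z3_def)
  qed
  show "turns y1 (join_all [linepath ?m2 y2, P3, linepath x3 y3, P0, linepath x0 y0, P1, linepath x1 ?m1])
      + turns ?m2 (reversepath P2) = 1 / 2 - corner_turn ?m1 y1 P2 x2 ?m2"
    unfolding y1Z
    using turns_interior_angle[OF P2 ne(2,3) Z2, unfolded Is] *(1,2) notin m1Z2 R' halves[OF refl] by simp
  show "turns y2 (join_all [linepath ?m3 y3, P0, linepath x0 y0, P1, linepath x1 y1, P2, linepath x2 ?m2])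
      + turns ?m3 (reversepath P3) = 1 / 2 - corner_turn ?m2 y2 P3 x3 ?m3"
    unfolding y2Z
    using turns_interior_angle[OF P3 ne(3,4) Z3, unfolded Is] *(3,4) notin m2Z3 R2 by simp
qed

end

section \<open>Nodes drawn as regions\<close>

text \<open>The exterior angle theorem for the triangle with sides 1, \<open>r\<close> and
  \<open>1 + r\<close>. No multiple of \<open>2 * pi\<close> intervenes, because the three arguments
  have the same sign.\<close>

lemma Arg_add_one:
  assumes "r \<notin> \<real>\<^sub>\<le>\<^sub>0"
  shows "Arg (1 + r) + Arg (r / (1 + r)) = Arg r"
proof -
  have r0: "r \<noteq> 0" and r1: "1 + r \<noteq> 0"
    using assms by (auto simp: add_eq_0_iff)
  have Im: "Im (r / (1 + r)) = Im r / (cmod (1 + r))\<^sup>2"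
    by (simp add: Im_divide cmod_power2) (simp add: power2_eq_square algebra_simps)
  have p: "(cmod (1 + r))\<^sup>2 > 0" using r1 by simp
  have prod: "Arg r = Arg (1 + r) + Arg (r / (1 + r)) + (if Arg (1 + r) + Arg (r / (1 + r)) \<in> {- pi<..pi} then 0
        else if pi < Arg (1 + r) + Arg (r / (1 + r)) then - 2 * pi else 2 * pi)"
    using Arg_times'[of "1 + r" "r / (1 + r)"] r0 r1 by simp
  consider "Im r > 0" | "Im r < 0" | "Im r = 0" by linarith
  then show ?thesis
  proof cases
    case 1
    then have "0 < Arg r" "0 < Arg (1 + r) \<and> Arg (1 + r) < pi" "0 < Arg (r / (1 + r)) \<and> Arg (r / (1 + r)) < pi"
      using p Arg_lt_pi[of r] Arg_lt_pi[of "1 + r"] Arg_lt_pi[of "r / (1 + r)"] by (simp_all add: Im)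
    then show ?thesis using prod by (auto split: if_splits)
  next
    case 2
    then have "Arg r < 0" "Arg (1 + r) < 0" "Arg (r / (1 + r)) < 0" "- pi < Arg (1 + r)" "- pi < Arg (r / (1 + r))"
      using p mpi_less_Arg by (auto simp: Arg_neg_iff Im divide_neg_pos)
    then show ?thesis using prod by (auto split: if_splits)
  next
    case 3
    then have "Re r > 0" using assms by (auto simp: complex_nonpos_Reals_iff)
    then have "r = of_real (Re r)" using 3 by (simp add: complex_eq_iff)
    then obtain s where s: "r = of_real s" "s > 0" using \<open>Re r > 0\<close> by blast
    have z: "Arg (of_real t) = 0" if "t > 0" for t using that by (simp add: Arg_of_real)
    have e: "1 + r = of_real (1 + s)" "r / (1 + r) = of_real (s / (1 + s))" by (simp_all add: s)
    have "Arg (1 + r) = 0" unfolding e(1) by (rule z) (use s in simp)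
    moreover have "Arg (r / (1 + r)) = 0" unfolding e(2) by (rule z) (use s in simp)
    moreover have "Arg r = 0" unfolding s(1) by (rule z) (use s in simp)
    ultimately show ?thesis by simp
  qed
qed

text \<open>Reconciles corner turns with the principal values used by \<open>left_turn\<close> at a
  point. As the arms meet only in \<open>x\<close>, the path does not turn back on itself, which is
  where \<open>Arg\<close> would jump.\<close>

lemma corner_turn_point:
  assumes "m \<noteq> x" "closed_segment x m \<inter> closed_segment x m' \<subseteq> {x}" "m' \<noteq> x"
  shows "corner_turn m x (linepath x x) x m' = Arg ((m' - x) / (x - m)) / (2 * pi)"
proof -
  define r where "r = (m' - x) / (x - m)"
  have r: "r \<notin> \<real>\<^sub>\<le>\<^sub>0"
  proof
    assume "r \<in> \<real>\<^sub>\<le>\<^sub>0"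
    then obtain s where s: "r = - of_real s" "s \<ge> 0" 
      by (metis nonpos_Reals_cases minus_minus neg_0_le_iff_le of_real_minus)
    have s0: "s > 0" using assms s by (cases "s = 0") (auto simp: r_def)
    have e: "m' - x = of_real s * (m - x)" using s assms(1) by (simp add: r_def field_simps)
    \<comment> \<open>If the arms pointed in the same direction, the end of the shorter one would be
      a common point other than \<open>x\<close>.\<close>
    define t where "t = min 1 s"
    have t: "0 < t" "t \<le> 1" "t \<le> s" using s0 by (auto simp: t_def)
    define y where "y = x + of_real t * (m - x)"
    have "y = (1 - t) *\<^sub>R x + t *\<^sub>R m" by (simp add: y_def scaleR_conv_of_real algebra_simps)
    then have "y \<in> closed_segment x m" using t unfolding in_segment by (intro exI[of _ t]) auto
    moreover have "y = (1 - t / s) *\<^sub>R x + (t / s) *\<^sub>R m'"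
    proof -
      have m': "m' = x + of_real s * (m - x)" using e by (simp add: algebra_simps)
      show ?thesis using s0 unfolding y_def m' by (simp add: scaleR_conv_of_real field_simps)
    qed
    then have "y \<in> closed_segment x m'" using t s0 unfolding in_segment by (intro exI[of _ "t / s"]) auto
    moreover have "y \<noteq> x" using t assms(1) by (simp add: y_def)
    ultimately show False using assms(2) by auto
  qed
  have m: "m \<notin> closed_segment x m'" "m' \<notin> closed_segment m x"
    using assms by (auto simp: closed_segment_commute)
  have mm: "m \<noteq> m'" using m by auto
  have q: "(m' - m) / (x - m) = 1 + r" "(x - m') / (m - m') = r / (1 + r)"
  proof -
    show 1: "(m' - m) / (x - m) = 1 + r" using assms by (simp add: r_def field_simps)
    have "r / (1 + r) = (m' - x) / (m' - m)" unfolding 1[symmetric] using assms(1) by (simp add: r_def)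
    also have "\<dots> = (x - m') / (m - m')" using minus_divide_divide[of "m' - x" "m' - m"] by simp
    finally show "(x - m') / (m - m') = r / (1 + r)" by simp
  qed
  show ?thesis
    unfolding corner_turn_def using assms m turns_linepath[OF m(1)] turns_linepath[OF m(2)] Arg_add_one[OF r]
    by (simp add: q r_def[symmetric] add_divide_distrib[symmetric])
qed

text \<open>The ranges fit: \<open>pi - Arg v\<close> lies in \<open>{0..<2 * pi}\<close>. So at a
  point \<open>ccw_angle\<close> is half a turn minus a corner turn, without any correction.\<close>

lemma Arg2pi_eq_pi_minus_Arg:
  assumes "w \<noteq> 0"
  shows "Arg2pi w = pi - Arg (- 1 / w)"
proof (rule Arg2pi_unique[of "cmod w"])
  define v where "v = - 1 / w"
  have "v \<noteq> 0" using assms by (simp add: v_def)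
  have w: "w = - 1 / v" using assms by (simp add: v_def)
  have v: "v = of_real (cmod v) * exp (\<i> * of_real (Arg v))" using Arg_eq[OF \<open>v \<noteq> 0\<close>] .
  have "exp (\<i> * of_real (pi - Arg v)) = - 1 / exp (\<i> * of_real (Arg v))"
    by (simp add: right_diff_distrib exp_diff mult.commute[of \<i>] exp_pi_i)
  moreover have "cmod w = 1 / cmod v" by (simp add: w norm_divide)
  ultimately have "of_real (cmod w) * exp (\<i> * of_real (pi - Arg v)) = - 1 / (of_real (cmod v) * exp (\<i> * of_real (Arg v)))"
    by simp
  also have "\<dots> = w" using v w by simp
  finally show "of_real (cmod w) * exp (\<i> * of_real (pi - Arg (- 1 / w))) = w" by (simp add: v_def)
  show "0 < cmod w" using assms by simp
  show "0 \<le> pi - Arg (- 1 / w)" "pi - Arg (- 1 / w) < 2 * pi"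
    using Arg_le_pi[of v] mpi_less_Arg[of v] by (simp_all add: v_def)
qed

lemma corner_turn_path_independent:
  assumes "path P" "path P'" "pathstart P = pathstart P'" "pathfinish P = pathfinish P'"
    and "path_image P \<subseteq> K" "path_image P' \<subseteq> K" "bounded K" "connected (- K)" "m \<notin> K" "m' \<notin> K"
  shows "corner_turn m x P x' m' = corner_turn m x P' x' m'"
proof -
  have "turns z P = turns z P'" if "z \<notin> K" for z
  proof -
    have z: "z \<notin> path_image P" "z \<notin> path_image P'" using that assms by auto
    have "turns z (P +++ reversepath P') = 0"
    proof (rule turns_unbounded_eq_0[of _ "- K"])
      show "- K \<inter> path_image (P +++ reversepath P') = {}" 
        using assms by (subst path_image_join) auto
      show "\<not> bounded (- K)" using assms cobounded_imp_unbounded[of "- K"] by auto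
    qed (use assms that in auto)
    then show ?thesis using assms z by (simp add: turns_join turns_reversepath)
  qed
  then show ?thesis using assms by (simp add: corner_turn_def)
qed

section \<open>Loops with prescribed winding numbers and Jordan regions\<close>

lemma closed_path_multiple:
  assumes "path g" "pathstart g = a" "pathfinish g = a"
  obtains h where "path h" "pathstart h = a" "pathfinish h = a" "path_image h \<subseteq> path_image g"
    "\<And>z. z \<notin> path_image g \<Longrightarrow> turns z h = of_int k * turns z g"
proof -
  have nat: "\<exists>h. path h \<and> pathstart h = a \<and> pathfinish h = a \<and> path_image h \<subseteq> path_image g \<and>
    (\<forall>z. z \<notin> path_image g \<longrightarrow> turns z h = real n * turns z g)" for n
  proof (induction n)
    case 0
    have "a \<in> path_image g" using assms by auto
    then have "turns z (\<lambda>_. a) = 0" if "z \<notin> path_image g" for z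
    proof -
      have "a \<noteq> z" using that \<open>a \<in> path_image g\<close> by blast
      then show ?thesis by (simp add: turns_def winding_number_zero_const)
    qed
    then show ?case using \<open>a \<in> path_image g\<close>
      by (intro exI[of _ "\<lambda>_. a"]) (auto simp: path_def pathstart_def pathfinish_def path_image_def)
  next
    case (Suc n)
    then obtain h where "path h \<and> pathstart h = a \<and> pathfinish h = a \<and> path_image h \<subseteq> path_image g \<and>
      (\<forall>z. z \<notin> path_image g \<longrightarrow> turns z h = real n * turns z g)" by (elim exE)
    then have h: "path h" "pathstart h = a" "pathfinish h = a" "path_image h \<subseteq> path_image g"
      "\<And>z. z \<notin> path_image g \<Longrightarrow> turns z h = real n * turns z g" by simp_all
    have "turns z (h +++ g) = real (Suc n) * turns z g" if "z \<notin> path_image g" for z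
      using h assms that by (subst turns_join) (auto simp: algebra_simps)
    then show ?case using h assms by (intro exI[of _ "h +++ g"]) (auto simp: path_image_join)
  qed
  obtain h where "path h \<and> pathstart h = a \<and> pathfinish h = a \<and> path_image h \<subseteq> path_image g \<and>
      (\<forall>z. z \<notin> path_image g \<longrightarrow> turns z h = real (nat \<bar>k\<bar>) * turns z g)" using nat[of "nat \<bar>k\<bar>"] by (elim exE)
  then have h: "path h" "pathstart h = a" "pathfinish h = a" "path_image h \<subseteq> path_image g"
      "\<And>z. z \<notin> path_image g \<Longrightarrow> turns z h = real (nat \<bar>k\<bar>) * turns z g" by simp_all
  show thesis
  proof (cases "k \<ge> 0")
    case True
    then show thesis using that[OF h(1-4)] h(5) by simp
  next
    case False
    have "turns z (reversepath h) = of_int k * turns z g" if "z \<notin> path_image g" for z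
      using h that False by (subst turns_reversepath) auto
    then show thesis using that[of "reversepath h"] h by simp
  qed
qed

text \<open>A path leads out to a large circle, which is traversed \<open>k\<close> times; the way
  out and the way back cancel.\<close>

lemma exists_loop_around:
  assumes S: "compact S" "connected S" "connected (- S)" and b: "b \<notin> S"
  obtains h where "path h" "pathstart h = b" "pathfinish h = b" "path_image h \<subseteq> - S"
    "\<And>z. z \<in> S \<Longrightarrow> turns z h = of_int k"
proof -
  obtain R where R: "R > 0" "S \<subseteq> ball 0 R"
    using compact_imp_bounded[OF S(1)] bounded_subset_ballD by blast
  have "path_connected (- S)"
    using S by (intro connected_open_path_connected) (auto simp: compact_imp_closed)
  moreover have RS: "complex_of_real R \<notin> S" using R by (auto simp: subset_iff)
  ultimately obtain \<rho> where r: "path \<rho>" "path_image \<rho> \<subseteq> - S" "pathstart \<rho> = b" "pathfinish \<rho> = of_real R"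
    using b unfolding path_connected_def by (metis ComplI)
  have c: "path (circlepath 0 R)" "pathstart (circlepath 0 R) = of_real R" "pathfinish (circlepath 0 R) = of_real R"
    by auto
  have cS: "path_image (circlepath 0 R) \<inter> S = {}" using R by (auto simp: sphere_def)
  obtain g where g: "path g" "pathstart g = of_real R" "pathfinish g = of_real R" "path_image g \<subseteq> path_image (circlepath 0 R)"
    "\<And>z. z \<notin> path_image (circlepath 0 R) \<Longrightarrow> turns z g = of_int k * turns z (circlepath 0 R)"
    using closed_path_multiple[OF c] by metis
  have l: "linked [\<rho>, g, reversepath \<rho>]" using r g by simp
  show thesis
  proof (rule that[of "join_all [\<rho>, g, reversepath \<rho>]"])
    show "path (join_all [\<rho>, g, reversepath \<rho>])" "pathstart (join_all [\<rho>, g, reversepath \<rho>]) = b" "pathfinish (join_all [\<rho>, g, reversepath \<rho>]) = b"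
      using join_all_linked[OF l] r by simp_all
    show "path_image (join_all [\<rho>, g, reversepath \<rho>]) \<subseteq> - S"
      unfolding path_image_join_all[OF l] using r g(4) cS by auto
    fix z assume z: "z \<in> S"
    have "turns z (circlepath 0 R) = 1"
      using winding_number_circlepath[of z 0 R] z R by (auto simp: turns_def)
    moreover have zc: "z \<notin> path_image (circlepath 0 R)" using z cS by blast
    ultimately have "turns z g = of_int k" using g(5) by simp
    moreover have "z \<notin> path_image \<rho>" using z r by blast
    moreover from this have "z \<notin> path_image g'" if "g' \<in> set [\<rho>, g, reversepath \<rho>]" for g'
      using that zc g(4) by auto
    ultimately show "turns z (join_all [\<rho>, g, reversepath \<rho>]) = of_int k"
      using turns_join_all[OF l, of z] r(1) by (simp add: turns_reversepath)
  qed
qed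

lemma Jordan_loop:
  assumes g: "simple_path g" "pathfinish g = pathstart g" and a: "a \<in> path_image g"
  obtains h where "path h" "pathstart h = a" "pathfinish h = a" "path_image h \<subseteq> path_image g"
    "\<And>z. z \<in> inside (path_image g) \<Longrightarrow> turns z h = of_int k"
proof -
  obtain t where t: "t \<in> {0..1}" "a = g t" using a by (auto simp: path_image_def)
  define s where "s = shiftpath t g"
  have p: "path g" using g simple_path_imp_path by blast
  have s: "path s" "pathstart s = a" "pathfinish s = a" "path_image s = path_image g"
    using t p g by (auto simp: s_def path_shiftpath pathstart_shiftpath pathfinish_shiftpath path_image_shiftpath)
  have w: "turns z s = turns z g" if "z \<in> inside (path_image g)" for z
  proof -
    have "z \<notin> path_image g" using that inside_no_overlap[of "path_image g"] by blast
    then show ?thesis using winding_number_shiftpath[OF p _ g(2) t(1)] by (simp add: turns_def s_def)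
  qed
  \<comment> \<open>The orientation of the Jordan curve is unknown; its sign \<open>e\<close> is
    absorbed into the multiplicity \<open>k * e\<close>.\<close>
  obtain e :: int where e: "e * e = 1" "\<And>z. z \<in> inside (path_image g) \<Longrightarrow> turns z g = of_int e"
  proof (rule simple_closed_path_winding_number_inside[OF g(1)])
    assume "\<And>z. z \<in> inside (path_image g) \<Longrightarrow> winding_number g z = 1"
    then show thesis using that[of 1] by (simp add: turns_def)
  next
    assume "\<And>z. z \<in> inside (path_image g) \<Longrightarrow> winding_number g z = - 1"
    then show thesis using that[of "-1"] by (simp add: turns_def)
  qed
  obtain h where h: "path h" "pathstart h = a" "pathfinish h = a" "path_image h \<subseteq> path_image s"
    "\<And>z. z \<notin> path_image s \<Longrightarrow> turns z h = of_int (k * e) * turns z s"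
    using closed_path_multiple[OF s(1-3)] by metis
  have "turns z h = of_int k" if "z \<in> inside (path_image g)" for z
  proof -
    have "z \<notin> path_image s" using that s(4) inside_no_overlap[of "path_image g"] by blast
    then have "turns z h = of_int (k * e) * of_int e" using h(5) w[OF that] e(2)[OF that] by simp
    also have "\<dots> = of_int (k * (e * e))" by simp
    finally show ?thesis using e by simp
  qed
  then show thesis using that h s by auto
qed

lemma Jordan_region:
  fixes g :: "real \<Rightarrow> complex"
  assumes g: "simple_path g" "pathfinish g = pathstart g"
    and K: "K = path_image g \<union> inside (path_image g) \<or> K = path_image g \<union> outside (path_image g)"
  shows "closed K" "connected K" "connected (- K)" "K \<inter> closure (- K) \<subseteq> path_image g"
proof -
  note J = Jordan_inside_outside[OF g]
  have cl: "closed (path_image g)" using g(1) closed_simple_path_image by blast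
  have un: "- path_image g = inside (path_image g) \<union> outside (path_image g)" using J by blast
  have K': "K = - outside (path_image g) \<or> K = - inside (path_image g)"
    using K J inside_no_overlap[of "path_image g"] outside_no_overlap[of "path_image g"] by blast
  then show "closed K" "connected (- K)" using J by auto
  have "closure (inside (path_image g)) = path_image g \<union> inside (path_image g)"
    "closure (outside (path_image g)) = path_image g \<union> outside (path_image g)"
    using J closure_Un_frontier[of "inside (path_image g)"] closure_Un_frontier[of "outside (path_image g)"] by auto
  then show "connected K" using K J connected_imp_connected_closure by metis
  have "interior K = K - frontier K" by (metis Diff_Diff_Int \<open>closed K\<close> closure_closed frontier_def inf.absorb2 interior_subset)
  have "open (inside (path_image g))" "open (outside (path_image g))" using J by auto
  then show "K \<inter> closure (- K) \<subseteq> path_image g"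
    using K K' J by (auto simp: closure_complement) (metis Un_iff interior_maximal subsetD Un_upper2)+
qed

text \<open>Paths are provided between frontier points, where all links and diagonals end; for a
  Jordan region they can run along the curve itself.\<close>

lemma bounded_region_props:
  assumes "bounded_region K"
  shows "closed K" "bounded K" "connected K" "connected (- K)"
    and "a \<in> K \<inter> closure (- K) \<Longrightarrow> b \<in> K \<inter> closure (- K) \<Longrightarrow>
      \<exists>p. path p \<and> path_image p \<subseteq> K \<and> pathstart p = a \<and> pathfinish p = b"
proof -
  have "closed K \<and> bounded K \<and> connected K \<and> connected (- K) \<and>
    (a \<in> K \<inter> closure (- K) \<longrightarrow> b \<in> K \<inter> closure (- K) \<longrightarrow>
      (\<exists>p. path p \<and> path_image p \<subseteq> K \<and> pathstart p = a \<and> pathfinish p = b))" for a b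
    using assms unfolding bounded_region_def
  proof (elim disjE exE conjE)
    fix z assume z: "K = {z}"
    have "connected (- {z})" by (rule connected_punctured_universe) simp
    then show ?thesis using z
      by (auto intro!: exI[of _ "linepath z z"])
  next
    fix g assume g: "simple_path g" "pathfinish g = pathstart g" "K = path_image g \<union> inside (path_image g)"
    note J = Jordan_region[OF g(1,2) disjI1[OF g(3)]]
    have "bounded K" using g(3) bounded_simple_path_image[OF g(1)] Jordan_inside_outside[OF g(1,2)] by simp
    moreover have "path_connected (path_image g)" using g(1) by (intro path_connected_path_image simple_path_imp_path)
    ultimately show ?thesis using J g(3) unfolding path_connected_def by blast
  qed
  then show "closed K" "bounded K" "connected K" "connected (- K)"
    "a \<in> K \<inter> closure (- K) \<Longrightarrow> b \<in> K \<inter> closure (- K) \<Longrightarrow>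
      \<exists>p. path p \<and> path_image p \<subseteq> K \<and> pathstart p = a \<and> pathfinish p = b" by auto
qed

text \<open>The loops in the last claim serve to repair a path inside an outer node by any number of
  full turns.\<close>

lemma outer_region_props:
  assumes "outer_region K"
  shows "closed K" "bounded (- K)" "\<not> bounded K" "connected K" "connected (- K)" "\<not> is_singleton K"
    and "a \<in> K \<inter> closure (- K) \<Longrightarrow> b \<in> K \<inter> closure (- K) \<Longrightarrow>
      \<exists>p. path p \<and> path_image p \<subseteq> K \<and> pathstart p = a \<and> pathfinish p = b"
    and "a \<in> K \<inter> closure (- K) \<Longrightarrow>
      \<exists>p. path p \<and> path_image p \<subseteq> K \<and> pathstart p = a \<and> pathfinish p = a \<and> (\<forall>z\<in>- K. turns z p = of_int k)"
proof -
  obtain g where g: "simple_path g" "pathfinish g = pathstart g" "K = path_image g \<union> outside (path_image g)"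
    using assms unfolding outer_region_def by blast
  note J = Jordan_region[OF g(1,2) disjI2[OF g(3)]] and JJ = Jordan_inside_outside[OF g(1,2)]
  have cK: "- K = inside (path_image g)" using g(3) JJ inside_no_overlap[of "path_image g"] by blast
  show "closed K" "connected K" "connected (- K)" using J by auto
  show "bounded (- K)" using cK JJ by simp
  then show nb: "\<not> bounded K" using cobounded_imp_unbounded by blast
  then show "\<not> is_singleton K" by (auto simp: is_singleton_def)
  have "path_connected (path_image g)" using g(1) by (intro path_connected_path_image simple_path_imp_path)
  then show "\<exists>p. path p \<and> path_image p \<subseteq> K \<and> pathstart p = a \<and> pathfinish p = b"
    if "a \<in> K \<inter> closure (- K)" "b \<in> K \<inter> closure (- K)"
    using J(4) g(3) that unfolding path_connected_def by blast
  show "\<exists>p. path p \<and> path_image p \<subseteq> K \<and> pathstart p = a \<and> pathfinish p = a \<and> (\<forall>z\<in>- K. turns z p = of_int k)"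
    if "a \<in> K \<inter> closure (- K)"
  proof -
    have "a \<in> path_image g" using J(4) that by blast
    then obtain h where "path h" "pathstart h = a" "pathfinish h = a" "path_image h \<subseteq> path_image g"
      "\<And>z. z \<in> inside (path_image g) \<Longrightarrow> turns z h = of_int k"
      using Jordan_loop[OF g(1,2)] by metis
    then show ?thesis unfolding cK using g(3) by blast
  qed
qed

section \<open>Plane maps and their drawings\<close>

text \<open>Follow the cycle of \<open>x\<close> from its successor around to its predecessor: no
  step of this walk touches \<open>x\<close>.\<close>

lemma permutes_invariant_around:
  assumes f: "f permutes S" "finite S" and fx: "f x \<noteq> x"
    and inv: "\<And>y. y \<in> S \<Longrightarrow> y \<noteq> x \<Longrightarrow> f y \<noteq> x \<Longrightarrow> N (f y) = N y" and x: "x \<in> S"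
  shows "N (f x) = N (inv f x)"
proof -
  have "permutation f" using f by (auto simp: permutation_permutes)
  then have "x \<in> orbit f x" by (rule permutation_self_in_orbit)
  then have ex: "\<exists>n. 0 < n \<and> (f ^^ n) x = x" by (auto simp: orbit_altdef)
  define n where "n = (LEAST n. 0 < n \<and> (f ^^ n) x = x)"
  have n: "0 < n" "(f ^^ n) x = x" using LeastI_ex[OF ex] by (auto simp: n_def)
  have least: "(f ^^ j) x \<noteq> x" if "0 < j" "j < n" for j
    using not_less_Least[of j "\<lambda>n. 0 < n \<and> (f ^^ n) x = x"] that by (auto simp: n_def)
  have inS: "(f ^^ j) x \<in> S" for j using x f by (induction j) (auto simp: permutes_in_image)
  have const: "N ((f ^^ Suc j) x) = N (f x)" if "Suc j < n" for j
    using that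
  proof (induction j)
    case (Suc j)
    have "N (f ((f ^^ Suc j) x)) = N ((f ^^ Suc j) x)"
      using Suc.prems least[of "Suc j"] least[of "Suc (Suc j)"] inS[of "Suc j"] by (intro inv) auto
    then show ?case using Suc by simp
  qed simp
  have "n \<noteq> 1" using n fx by auto
  then obtain j where j: "n = Suc (Suc j)" using n(1) by (metis One_nat_def not0_implies_Suc not_gr_zero)
  have "inv f x = (f ^^ Suc j) x"
    using n(2) f(1) unfolding j by (simp add: permutes_inv_eq)
  then show ?thesis using const[of j] j by simp
qed

section \<open>Combinatorics of the map\<close>

locale plane_map =
  fixes G :: "'d plane_graph"
  assumes plane_graph: "finite_connected_plane_graph G"
begin

lemma finite_darts: "finite (darts G)" and darts_nonempty: "darts G \<noteq> {}"
  and rot_permutes: "rot G permutes darts G" and opp_permutes: "opp G permutes darts G"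
  and opp_neq: "h \<in> darts G \<Longrightarrow> opp G h \<noteq> h" and opp_opp: "h \<in> darts G \<Longrightarrow> opp G (opp G h) = h"
  and dir_subset: "dir G \<subseteq> darts G"
  and darts_connected: "h \<in> darts G \<Longrightarrow> h' \<in> darts G \<Longrightarrow>
        (h, h') \<in> ({(k, rot G k) |k. k \<in> darts G} \<union> {(k, opp G k) |k. k \<in> darts G})\<^sup>*"
  using plane_graph unfolding finite_connected_plane_graph_def by auto

lemma face_next_permutes: "face_next G permutes darts G"
  unfolding face_next_def by (intro permutes_compose opp_permutes permutes_inv rot_permutes)

lemma rot_in: "rot G h \<in> darts G \<longleftrightarrow> h \<in> darts G"
  and opp_in: "opp G h \<in> darts G \<longleftrightarrow> h \<in> darts G"
  and face_next_in: "face_next G h \<in> darts G \<longleftrightarrow> h \<in> darts G"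
  using rot_permutes opp_permutes face_next_permutes by (simp_all add: permutes_in_image)

lemma rot_face_next: "rot G (face_next G h) = opp G h"
  using rot_permutes by (simp add: face_next_def permutes_inverses)

lemma rot_eq_iff: "rot G h = rot G h' \<longleftrightarrow> h = h'"
  using permutes_inj[OF rot_permutes] by (simp add: inj_eq)

lemma permutation_rot: "permutation (rot G)" and permutation_opp: "permutation (opp G)"
  and permutation_face_next: "permutation (face_next G)"
  using finite_darts rot_permutes opp_permutes face_next_permutes by (auto simp: permutation_permutes)

lemma self_in_vertex: "h \<in> vertex G h" and self_in_face: "h \<in> face G h" and self_in_edge: "h \<in> edge G h"
  using permutation_rot permutation_opp permutation_face_next
  by (simp_all add: vertex_def face_def edge_def permutation_self_in_orbit)

lemma vertex_rot: "vertex G (rot G h) = vertex G h"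
  using permutation_rot by (simp add: vertex_def permutation_orbit_step)

lemma face_face_next: "face G (face_next G h) = face G h"
  using permutation_face_next by (simp add: face_def permutation_orbit_step)

lemma edge_opp: "edge G (opp G h) = edge G h"
  using permutation_opp by (simp add: edge_def permutation_orbit_step)

lemma vertex_face_next: "vertex G (face_next G h) = vertex G (opp G h)"
  using vertex_rot[of "face_next G h"] by (simp add: rot_face_next)

lemma edge_eqD:
  assumes "edge G h = edge G h'" and h: "h \<in> darts G"
  shows "h' = h \<or> h' = opp G h"
proof -
  have *: "y = h \<or> y = opp G h" if "y \<in> orbit (opp G) h" for y
    using that by (induction rule: orbit.induct) (use opp_opp[OF h] in auto)
  have "h' \<in> orbit (opp G) h" using self_in_edge[of h'] \<open>edge G h = edge G h'\<close> by (simp add: edge_def)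
  then show ?thesis by (rule *)
qed

lemma only_dart_at_vertex: "rot G h = h \<Longrightarrow> vertex G h' = vertex G h \<Longrightarrow> h' = h"
  using self_in_vertex[of h'] orbit_eq_singleton_iff[of "rot G" h] by (simp add: vertex_def)

lemma face_next_neq:
  assumes "vertex G (opp G h) \<noteq> vertex G h"
  shows "face_next G h \<noteq> h" "face_next G (face_next G h) \<noteq> face_next G h" "rot G h \<noteq> opp G h"
proof -
  show 1: "face_next G h \<noteq> h" using assms vertex_face_next[of h] by metis
  then show "face_next G (face_next G h) \<noteq> face_next G h"
    using permutes_inj[OF face_next_permutes] by (simp add: inj_eq)
  show "rot G h \<noteq> opp G h" using assms vertex_rot[of h] by metis
qed

text \<open>Facets \<open>h\<close> and \<open>rot h\<close> share a link, and so do \<open>h\<close> and \<open>face_next h\<close>.  The four facets around the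
  edge of \<open>x\<close> form a cycle, so removing \<open>x\<close> does not disconnect the facets.\<close>

lemma invariant_without_dart:
  fixes N :: "'d \<Rightarrow> real"
  assumes x: "x \<in> darts G" "face_next G x \<noteq> x"
    and rot: "\<And>y. y \<in> darts G \<Longrightarrow> y \<noteq> x \<Longrightarrow> rot G y \<noteq> x \<Longrightarrow> N (rot G y) = N y"
    and fn: "\<And>y. y \<in> darts G \<Longrightarrow> y \<noteq> x \<Longrightarrow> face_next G y \<noteq> x \<Longrightarrow> N (face_next G y) = N y"
    and y: "y \<in> darts G" "y \<noteq> x"
  shows "N y = N (face_next G x)"
proof -
  \<comment> \<open>Giving \<open>x\<close> the value of a neighbour makes the function invariant
    under all moves, so connectivity of the full map applies.\<close>
  define N' where "N' = (\<lambda>y. if y = x then N (face_next G x) else N y)"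
  have inv_fn: "N (inv (face_next G) x) = N (face_next G x)"
    using permutes_invariant_around[where N = N, OF face_next_permutes finite_darts x(2) fn x(1)] by simp
  have fn': "N' (face_next G y) = N' y" if "y \<in> darts G" for y
  proof -
    have "y = inv (face_next G) x" if "face_next G y = x"
      using that face_next_permutes by (metis permutes_inverses(2))
    then show ?thesis
      using inv_fn fn[OF that] x(2) by (cases "y = x"; cases "face_next G y = x") (simp_all add: N'_def)
  qed
  have rot': "N' (rot G y) = N' y" if y: "y \<in> darts G" for y
  proof (cases "rot G x = x")
    case True
    show ?thesis
    proof (cases "y = x")
      case False
      then have "rot G y \<noteq> x" using rot_eq_iff[of y x] True by simp
      then show ?thesis using rot[OF y False] False by (simp add: N'_def)
    qed (simp add: True)
  next
    case False
    have ir2: "rot G (inv (rot G) x) = x"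
      using rot_permutes by (simp add: permutes_inverses)
    have ir: "inv (rot G) x \<in> darts G" using rot_in[of "inv (rot G) x"] ir2 x by simp
    have irx: "inv (rot G) x \<noteq> x" using False ir2 by metis
    have fo: "face_next G (opp G x) = inv (rot G) x"
      using x by (simp add: face_next_def opp_opp)
    \<comment> \<open>The other facets around the edge of \<open>x\<close> are
      \<open>face_next G x\<close>, \<open>opp G x\<close> and \<open>inv (rot G) x\<close>, in this
      order; passing through them bypasses \<open>x\<close>.\<close>
    have "N (inv (rot G) x) = N (opp G x)"
      using fn[of "opp G x"] irx x opp_neq[of x] by (simp add: fo opp_in)
    also have "\<dots> = N (face_next G x)"
      using rot[of "face_next G x"] x opp_neq[of x] by (simp add: rot_face_next face_next_in)
    finally have 1: "N (inv (rot G) x) = N (face_next G x)" .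
    have 2: "N (rot G x) = N (inv (rot G) x)"
      using permutes_invariant_around[where N = N, OF rot_permutes finite_darts False rot x(1)] by simp
    have "y = inv (rot G) x" if "rot G y = x"
      using that rot_permutes by (metis permutes_inverses(2))
    then show ?thesis
      using 1 2 rot[OF y] False by (cases "y = x"; cases "rot G y = x") (simp_all add: N'_def)
  qed
  have opp': "N' (opp G y) = N' y" if "y \<in> darts G" for y
    using rot'[of "face_next G y"] fn'[OF that] that by (simp add: rot_face_next face_next_in)
  have "N' b = N' x" if "(x, b) \<in> ({(k, rot G k) |k. k \<in> darts G} \<union> {(k, opp G k) |k. k \<in> darts G})\<^sup>*" for b
    using that by (induction rule: rtrancl_induct) (auto simp: rot' opp')
  then have "N' y = N' x" using darts_connected[OF x(1) y(1)] by blast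
  then show ?thesis using y by (simp add: N'_def)
qed

end

lemma on_left_closure:
  assumes "on_left W a b" "z \<in> open_segment a b"
  shows "z \<in> closure W"
proof -
  obtain s where s: "0 < s" "s < 1" "z = linepath a b s"
    using assms(2) by (auto simp: in_segment linepath_def)
  define f where "f = (\<lambda>t::real. linepath a b s + of_real t * (\<i> * (b - a)))"
  have "\<forall>\<^sub>F t in at_right 0. f t \<in> W"
    using assms(1) s by (auto simp: on_left_def f_def)
  then have ev: "\<forall>\<^sub>F t in at_right 0. f t \<in> closure W"
    by (rule eventually_mono) (rule subsetD[OF closure_subset])
  have "(f \<longlongrightarrow> linepath a b s + of_real 0 * (\<i> * (b - a))) (at_right 0)"
    unfolding f_def by (intro tendsto_intros)
  then have lim: "(f \<longlongrightarrow> z) (at_right 0)" using s by simp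
  show ?thesis
    by (rule Lim_in_closed_set[OF closed_closure ev trivial_limit_at_right_real lim])
qed

text \<open>Closedness of the regions is a separate assumption because it will come from
  \<open>outer_node_and_cut\<close>, which says which kind of region each node has.\<close>

locale plane_drawing = plane_map G for G :: "'d plane_graph" +
  fixes D :: "'d drawing"
  assumes drawing: "straight_drawing G D"
    and closed_region: "x \<in> nodes G \<Longrightarrow> closed (region D x)"
begin

definition frame :: "complex set" where
  "frame = \<Union> (region D ` nodes G) \<union> \<Union> (seg D ` links G)"

definition side :: "'d link \<Rightarrow> complex set" where
  "side l = open_segment (tip D l) (base D l)"

section \<open>Disjointness and adjacency of nodes, links and facets\<close>

lemma finite_nodes: "finite (nodes G)" and finite_links: "finite (links G)"
  using finite_darts by (auto simp: nodes_def links_def)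

lemma nodes_intros:
  "h \<in> darts G \<Longrightarrow> VNode (vertex G h) \<in> nodes G" "h \<in> darts G \<Longrightarrow> ENode (edge G h) \<in> nodes G"
  "h \<in> darts G \<Longrightarrow> FNode (face G h) \<in> nodes G"
  by (auto simp: nodes_def)

lemma links_iff: "VLink h \<in> links G \<longleftrightarrow> h \<in> darts G" "FLink h \<in> links G \<longleftrightarrow> h \<in> darts G"
  by (auto simp: links_def)

lemma regions_disjoint: "x \<in> nodes G \<Longrightarrow> y \<in> nodes G \<Longrightarrow> x \<noteq> y \<Longrightarrow> region D x \<inter> region D y = {}"
  using drawing by (auto simp: straight_drawing_def disjoint_family_on_def)

lemma ends_nodes: "l \<in> links G \<Longrightarrow> outer_end G l \<in> nodes G" "l \<in> links G \<Longrightarrow> edge_end G l \<in> nodes G"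
  by (auto simp: links_def nodes_def)

lemma tip_in: "l \<in> links G \<Longrightarrow> tip D l \<in> region D (outer_end G l)"
  and base_in: "l \<in> links G \<Longrightarrow> base D l \<in> region D (edge_end G l)"
  using drawing by (auto simp: straight_drawing_def)

lemma tip_neq_base: "l \<in> links G \<Longrightarrow> tip D l \<noteq> base D l"
proof -
  assume l: "l \<in> links G"
  have "outer_end G l \<noteq> edge_end G l" by (cases l) auto
  then show ?thesis using regions_disjoint[OF ends_nodes[OF l]] tip_in[OF l] base_in[OF l] by auto
qed

lemma side_region: "l \<in> links G \<Longrightarrow> x \<in> nodes G \<Longrightarrow> side l \<inter> region D x = {}"
  using drawing by (auto simp: straight_drawing_def side_def)

lemma sides_disjoint: "l \<in> links G \<Longrightarrow> l' \<in> links G \<Longrightarrow> l \<noteq> l' \<Longrightarrow> side l \<inter> side l' = {}"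
  using drawing by (auto simp: straight_drawing_def side_def disjoint_family_on_def)

lemma seg_eq: "seg D l = side l \<union> {tip D l, base D l}"
  by (auto simp: seg_def side_def closed_segment_eq_open)

lemma closed_frame: "closed frame"
  unfolding frame_def using finite_nodes finite_links closed_region
  by (intro closed_Un closed_UN) (auto simp: seg_def)

lemma facet_component: "h \<in> darts G \<Longrightarrow> facet D h \<in> components (- frame)"
  using drawing by (auto simp: straight_drawing_def frame_def bij_betw_def)

lemma facet_open: "h \<in> darts G \<Longrightarrow> open (facet D h)"
  using facet_component closed_frame open_components open_Compl by blast

lemma facet_connected: "h \<in> darts G \<Longrightarrow> connected (facet D h)"
  using facet_component in_components_connected by blast

lemma facet_frame: "h \<in> darts G \<Longrightarrow> facet D h \<inter> frame = {}"
  using facet_component in_components_subset by blast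

lemma facets_disjoint: "h \<in> darts G \<Longrightarrow> h' \<in> darts G \<Longrightarrow> h \<noteq> h' \<Longrightarrow> facet D h \<inter> facet D h' = {}"
proof -
  assume h: "h \<in> darts G" "h' \<in> darts G" "h \<noteq> h'"
  have "inj_on (facet D) (darts G)" using drawing by (simp add: straight_drawing_def bij_betw_def)
  then have "facet D h \<noteq> facet D h'" using h by (auto dest: inj_onD)
  then show ?thesis using components_nonoverlap[OF facet_component[OF h(1)] facet_component[OF h(2)]] by blast
qed

lemma facet_nonempty: "h \<in> darts G \<Longrightarrow> facet D h \<noteq> {}"
  using facet_component in_components_nonempty by blast

lemma facet_region: "h \<in> darts G \<Longrightarrow> x \<in> nodes G \<Longrightarrow> facet D h \<inter> region D x = {}"
  and facet_seg: "h \<in> darts G \<Longrightarrow> l \<in> links G \<Longrightarrow> facet D h \<inter> seg D l = {}"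
  using facet_frame[of h] unfolding frame_def by blast+

lemma facet_side: "h \<in> darts G \<Longrightarrow> l \<in> links G \<Longrightarrow> facet D h \<inter> side l = {}"
  using facet_seg[of h l] seg_eq[of l] by blast

lemma left_of_links:
  assumes "h \<in> darts G"
  shows "on_left (facet D h) (tip D (VLink h)) (base D (VLink h))"
    "on_left (facet D h) (base D (FLink h)) (tip D (FLink h))"
    "on_left (facet D h) (tip D (FLink (opp G (rot G h)))) (base D (FLink (opp G (rot G h))))"
    "on_left (facet D h) (base D (VLink (rot G h))) (tip D (VLink (rot G h)))"
  using drawing assms by (auto simp: straight_drawing_def)

lemma side_closure_facet:
  assumes h: "h \<in> darts G"
  shows "side (VLink h) \<subseteq> closure (facet D h)" "side (FLink h) \<subseteq> closure (facet D h)"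
    "side (VLink (rot G h)) \<subseteq> closure (facet D h)" "side (FLink h) \<subseteq> closure (facet D (face_next G h))"
proof -
  have fn: "face_next G h \<in> darts G" using h by (simp add: face_next_in)
  show "side (VLink h) \<subseteq> closure (facet D h)"
    using on_left_closure[OF left_of_links(1)[OF h]] by (auto simp: side_def)
  show "side (FLink h) \<subseteq> closure (facet D h)"
    using on_left_closure[OF left_of_links(2)[OF h]] by (auto simp: side_def open_segment_commute)
  show "side (VLink (rot G h)) \<subseteq> closure (facet D h)"
    using on_left_closure[OF left_of_links(4)[OF h]] by (auto simp: side_def open_segment_commute)
  show "side (FLink h) \<subseteq> closure (facet D (face_next G h))"
    using on_left_closure[OF left_of_links(3)[OF fn]] h by (auto simp: side_def rot_face_next opp_opp)
qed

text \<open>All facets but \<open>x\<close> are connected through links other than the sides of facet \<open>x\<close>, so a closed curve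
  within facet \<open>x\<close>, some of its sides, and nodes winds equally often around all of them.\<close>

lemma turns_constant_outside_facet:
  assumes x: "x \<in> darts G" "face_next G x \<noteq> x" "rot G x \<noteq> x \<or> VLink x \<in> X"
    and X: "X \<subseteq> {VLink x, FLink x, VLink (rot G x), FLink (opp G (rot G x))}"
    and g: "path g" "pathfinish g = pathstart g"
      "path_image g \<subseteq> facet D x \<union> \<Union> (region D ` nodes G) \<union> \<Union> (side ` X)"
  obtains m where
    "\<And>y z. y \<in> darts G \<Longrightarrow> y \<noteq> x \<Longrightarrow> z \<in> facet D y \<Longrightarrow> z \<notin> path_image g \<and> turns z g = m"
    "\<And>l z. l \<in> links G \<Longrightarrow> l \<notin> X \<Longrightarrow> z \<in> side l \<Longrightarrow> z \<notin> path_image g \<and> turns z g = m"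
proof -
  have Xl: "X \<subseteq> links G" using X x by (auto simp: links_def opp_in rot_in)
  have fac: "facet D y \<inter> path_image g = {}" if y: "y \<in> darts G" "y \<noteq> x" for y
  proof -
    have "facet D y \<inter> side l = {}" if "l \<in> X" for l using facet_side[OF y(1)] that Xl by auto
    then have "facet D y \<inter> (facet D x \<union> \<Union> (region D ` nodes G) \<union> \<Union> (side ` X)) = {}"
      using facets_disjoint[OF y(1) x(1) y(2)] facet_region[OF y(1)] by blast
    then show ?thesis using g(3) by auto
  qed
  have lin: "side l \<inter> path_image g = {}" if l: "l \<in> links G" "l \<notin> X" for l
  proof -
    have "side l \<inter> side l' = {}" if "l' \<in> X" for l' using sides_disjoint[OF l(1), of l'] that l Xl by blast
    then have "side l \<inter> (facet D x \<union> \<Union> (region D ` nodes G) \<union> \<Union> (side ` X)) = {}"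
      using facet_side[OF x(1) l(1)] side_region[OF l(1)] by auto
    then show ?thesis using g(3) by auto
  qed
  \<comment> \<open>The winding number around a facet, read off at a sample point; connectedness of
    the facet makes the choice immaterial.\<close>
  define N where "N = (\<lambda>y. turns (SOME z. z \<in> facet D y) g)"
  have N: "turns z g = N y" if "y \<in> darts G" "y \<noteq> x" "z \<in> facet D y" for y z
    unfolding N_def using that fac facet_connected
    by (intro turns_constant[OF g(1,2), of "facet D y"] someI[of "\<lambda>z. z \<in> facet D y" z]) auto
  have touch: "turns z g = N y"
    if "y \<in> darts G" "y \<noteq> x" "l \<in> links G" "l \<notin> X" "side l \<subseteq> closure (facet D y)" "z \<in> side l" for y l z
    using that lin[of l] N by (intro turns_closure[OF g(1,2), of z "facet D y"]) auto
  have across: "N y = N y'"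
    if y: "y \<in> darts G" "y \<noteq> x" "y' \<in> darts G" "y' \<noteq> x" and l: "l \<in> links G" "l \<notin> X"
      "side l \<subseteq> closure (facet D y)" "side l \<subseteq> closure (facet D y')" for y y' l
  proof -
    have "midpoint (tip D l) (base D l) \<in> side l" using tip_neq_base[OF l(1)] by (simp add: side_def)
    then show ?thesis using touch[OF y(1,2) l(1,2,3)] touch[OF y(3,4) l(1,2,4)] by metis
  qed
  \<comment> \<open>The step from \<open>y\<close> to \<open>rot G y\<close> crosses
    \<open>VLink (rot G y)\<close>, the step to \<open>face_next G y\<close> crosses
    \<open>FLink y\<close>. If such a link belongs to \<open>X\<close>, it is a side of facet
    \<open>x\<close>, and the step starts or ends at \<open>x\<close>.\<close>
  have const: "N y = N (face_next G x)" if "y \<in> darts G" "y \<noteq> x" for y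
  proof (rule invariant_without_dart[OF x(1,2) _ _ that])
    fix y assume y: "y \<in> darts G" "y \<noteq> x"
    show "N (rot G y) = N y" if r: "rot G y \<noteq> x"
    proof (rule across)
      show "VLink (rot G y) \<notin> X" using X y r rot_eq_iff[of y x] by auto
    qed (use y r side_closure_facet[of "rot G y"] side_closure_facet[of y] in \<open>auto simp: links_iff rot_in\<close>)
    show "N (face_next G y) = N y" if r: "face_next G y \<noteq> x"
    proof (rule across)
      have "face_next G (opp G (rot G x)) = x"
        using x rot_permutes by (simp add: face_next_def opp_opp rot_in permutes_inverses)
      then show "FLink y \<notin> X" using X y r by auto
    qed (use y r side_closure_facet[of y] in \<open>auto simp: links_iff face_next_in\<close>)
  qed
  have link: "turns z g = N (face_next G x)" if l: "l \<in> links G" "l \<notin> X" and z: "z \<in> side l" for l z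
  proof -
    \<comment> \<open>Only links of \<open>x\<close> itself are delicate. \<open>FLink x\<close>
      also borders \<open>face_next G x\<close>, and \<open>VLink x\<close> the facet before
      \<open>x\<close> in the rotation, unless \<open>rot G x = x\<close>; then facet
      \<open>x\<close> is on both sides of it, and the assumption puts it into
      \<open>X\<close>.\<close>
    have "\<exists>y\<in>darts G. y \<noteq> x \<and> side l \<subseteq> closure (facet D y)"
    proof (cases l)
      case (VLink h)
      then have h: "h \<in> darts G" using l by (simp add: links_iff)
      show ?thesis
      proof (cases "h = x")
        case True
        then have "rot G x \<noteq> x" using x(3) l VLink by auto
        moreover obtain y where y: "rot G y = x" "y \<in> darts G"
          using rot_permutes x(1) by (metis permutes_inverses(1) rot_in)
        ultimately have "y \<noteq> x" by metis
        then show ?thesis using side_closure_facet(3)[OF y(2)] y VLink True by auto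
      next
        case False
        then show ?thesis using side_closure_facet(1)[OF h] VLink h by auto
      qed
    next
      case (FLink h)
      then have h: "h \<in> darts G" using l by (simp add: links_iff)
      then show ?thesis
        using side_closure_facet(2,4)[OF h] FLink x(2) face_next_in[of h] by (cases "h = x") auto
    qed
    then show ?thesis using touch[OF _ _ l _ z] const by metis
  qed
  show thesis
    using that[of "N (face_next G x)"] N const link fac lin by (metis disjoint_iff)
qed

end

section \<open>The additional cut\<close>

lemma ray_props:
  assumes "ray K U g"
  shows "closed (g ` {0..})" "connected (g ` {0..})" "\<not> bounded (g ` {0..})"
    "connected (g ` {0<..})" "\<not> bounded (g ` {0<..})" "g ` {0..} \<subseteq> closure (g ` {0<..})"
    "g ` {0..} \<subseteq> K \<union> U" "g ` {0<..} \<subseteq> U" "g 0 \<in> K"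
proof -
  have cont: "continuous_on {0..} g" and g0: "g 0 \<in> K" and gU: "g ` {0<..} \<subseteq> U"
    and lim: "filterlim g at_infinity at_top"
    using assms by (auto simp: ray_def)
  show "g 0 \<in> K" "g ` {0<..} \<subseteq> U" using g0 gU by auto
  show "g ` {0..} \<subseteq> K \<union> U"
  proof
    fix z assume "z \<in> g ` {0..}"
    then obtain t where t: "t \<ge> 0" "z = g t" by auto
    then have "t = 0 \<or> g t \<in> g ` {0<..}" by auto
    then show "z \<in> K \<union> U" using g0 gU t by auto
  qed
  have ev: "\<exists>T>0. \<forall>t\<ge>T. B < cmod (g t)" for B
  proof -
    have "eventually (\<lambda>t. \<bar>B\<bar> + 1 \<le> cmod (g t)) at_top"
      using lim unfolding filterlim_at_infinity[OF order_refl] by simp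
    then obtain T where "\<And>t. t \<ge> T \<Longrightarrow> \<bar>B\<bar> + 1 \<le> cmod (g t)" by (auto simp: eventually_at_top_linorder)
    then show ?thesis by (intro exI[of _ "max T 1"]) force
  qed
  show "\<not> bounded (g ` {0<..})"
  proof
    assume "bounded (g ` {0<..})"
    then obtain B where B: "\<And>t. t > 0 \<Longrightarrow> cmod (g t) \<le> B" by (auto simp: bounded_iff)
    obtain T where "T > 0" "\<And>t. t \<ge> T \<Longrightarrow> B < cmod (g t)" using ev by blast
    then show False using B[of T] by force
  qed
  then show "\<not> bounded (g ` {0..})"
    by (rule contrapos_nn) (erule bounded_subset, auto)
  show "connected (g ` {0..})" by (intro connected_continuous_image cont) auto
  show "connected (g ` {0<..})"
    by (intro connected_continuous_image continuous_on_subset[OF cont]) auto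
  show "closed (g ` {0..})"
    unfolding closure_subset_eq[symmetric]
  proof
    fix z assume z: "z \<in> closure (g ` {0..})"
    obtain T where T: "T > 0" "\<And>t. t \<ge> T \<Longrightarrow> cmod z + 1 < cmod (g t)" using ev by blast
    \<comment> \<open>Near a limit point only a compact initial part of the ray is visible, since
      the ray tends to infinity.\<close>
    have sub: "ball z 1 \<inter> g ` {0..} \<subseteq> g ` {0..T}"
    proof
      fix y assume "y \<in> ball z 1 \<inter> g ` {0..}"
      then obtain t where t: "t \<ge> 0" "y = g t" "dist z (g t) < 1" by auto
      have "cmod (g t) \<le> cmod z + dist z (g t)"
        using norm_triangle_sub[of "g t" z] by (simp add: dist_norm norm_minus_commute)
      then have "t \<le> T" using T(2)[of t] t by force
      then show "y \<in> g ` {0..T}" using t by auto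
    qed
    have "z \<in> closure (ball z 1 \<inter> g ` {0..})"
      using open_Int_closure_subset[of "ball z 1" "g ` {0..}"] z by auto
    then have "z \<in> closure (g ` {0..T})" using closure_mono[OF sub] by blast
    moreover have "compact (g ` {0..T})"
      by (intro compact_continuous_image continuous_on_subset[OF cont]) auto
    ultimately show "z \<in> g ` {0..}" by (auto simp: compact_imp_closed)
  qed
  have "closure {0<..} = {0::real..}" by simp
  then have "g ` {0..} \<subseteq> closure (g ` {0<..})"
    using continuous_image_closure_subset[of "{0..}" g "{0<..}"] cont by auto
  then show "g ` {0..} \<subseteq> closure (g ` {0<..})" .
qed

lemma arc_interior:
  fixes g :: "real \<Rightarrow> complex"
  assumes "arc g"
  shows "path_image g \<subseteq> closure (g ` {0<..<1})" "connected (g ` {0<..<1})" "connected (g ` {0..<1})"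
    "path_image g = {pathstart g, pathfinish g} \<union> g ` {0<..<1}"
    "g ` {0..<1} = insert (pathstart g) (g ` {0<..<1})"
proof -
  have cont: "continuous_on {0..1} g" using assms by (auto simp: arc_def path_def)
  have "closure {0<..<1} = {0..1::real}" by simp
  then show "path_image g \<subseteq> closure (g ` {0<..<1})"
    using continuous_image_closure_subset[of "{0..1}" g "{0<..<1}"] cont by (auto simp: path_image_def)
  show "connected (g ` {0<..<1})" "connected (g ` {0..<1})"
    by (intro connected_continuous_image continuous_on_subset[OF cont]; auto)+
  have "{0..1} = {0, 1} \<union> {0<..<1::real}" by auto
  then show "path_image g = {pathstart g, pathfinish g} \<union> g ` {0<..<1}"
    unfolding path_image_def pathstart_def pathfinish_def by (simp only: image_Un) auto
  have "{0..<1} = insert 0 {0<..<1::real}" by auto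
  then show "g ` {0..<1} = insert (pathstart g) (g ` {0<..<1})"
    unfolding pathstart_def by (simp only: image_insert)
qed

lemma outer_node_and_cut_cases:
  assumes "outer_node_and_cut G D vs fs k C"
  obtains (arc) x g where "x \<in> {VNode vs, FNode fs}" "outer_region (region D x)"
      "\<And>y. y \<in> nodes G \<Longrightarrow> y \<noteq> x \<Longrightarrow> bounded_region (region D y)"
      "Path_Connected.arc g" "pathstart g \<in> region D (VNode vs)" "pathfinish g \<in> region D (FNode fs)"
      "g ` {0<..<1} \<subseteq> facet D k" "C = path_image g"
  | (rays) g g' where "\<And>y. y \<in> nodes G \<Longrightarrow> bounded_region (region D y)" "\<not> bounded (facet D k)"
      "ray (region D (VNode vs)) (facet D k) g" "ray (region D (FNode fs)) (facet D k) g'"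
      "C = g ` {0..} \<union> g' ` {0..}"
proof -
  consider x where "x \<in> {VNode vs, FNode fs}" "outer_region (region D x)" "\<forall>y\<in>nodes G - {x}. bounded_region (region D y)"
      "\<exists>g. Path_Connected.arc g \<and> pathstart g \<in> region D (VNode vs) \<and> pathfinish g \<in> region D (FNode fs) \<and>
              g ` {0<..<1} \<subseteq> facet D k \<and> C = path_image g"
    | "\<forall>y\<in>nodes G. bounded_region (region D y)" "\<not> bounded (facet D k)"
      "\<exists>g g'. ray (region D (VNode vs)) (facet D k) g \<and> ray (region D (FNode fs)) (facet D k) g' \<and>
                 g ` {0..} \<inter> g' ` {0..} = {} \<and> C = g ` {0..} \<union> g' ` {0..}"
    using assms unfolding outer_node_and_cut_def by blast
  then show thesis
  proof cases
    case (1 x)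
    from 1(4) obtain g where "Path_Connected.arc g" "pathstart g \<in> region D (VNode vs)" "pathfinish g \<in> region D (FNode fs)"
      "g ` {0<..<1} \<subseteq> facet D k" "C = path_image g" by (elim exE conjE)
    then show thesis using 1(1-3) by (intro arc[of x g]) simp_all
  next
    case 2
    from 2(3) obtain g g' where "ray (region D (VNode vs)) (facet D k) g" "ray (region D (FNode fs)) (facet D k) g'"
      "C = g ` {0..} \<union> g' ` {0..}" by (elim exE conjE)
    then show thesis using 2(1,2) by (intro rays[of g g']) simp_all
  qed
qed

lemma outer_node_and_cut_region:
  assumes "outer_node_and_cut G D vs fs k C" "x \<in> nodes G"
  shows "bounded_region (region D x) \<or> outer_region (region D x)"
  using assms(1)
proof (cases rule: outer_node_and_cut_cases)
  case (arc y g)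
  then show ?thesis using assms(2) by (cases "x = y") auto
next
  case (rays g g')
  then show ?thesis using assms(2) by auto
qed

locale cut_drawing = plane_drawing G D for G :: "'d plane_graph" and D :: "'d drawing" +
  fixes vs fs :: "'d set" and k :: 'd and C :: "complex set"
  assumes cut: "outer_node_and_cut G D vs fs k C"
begin

section \<open>Nodes, the additional cut and diagonals\<close>

lemma k_in: "k \<in> darts G" and vertex_k: "vertex G k = vs" and face_k: "face G k = fs"
  using cut by (auto simp: outer_node_and_cut_def)

lemma root_nodes: "VNode vs \<in> nodes G" "FNode fs \<in> nodes G"
  using nodes_intros[OF k_in] by (simp_all add: vertex_k face_k)

lemma connected_region: "x \<in> nodes G \<Longrightarrow> connected (region D x)"
  and connected_region_compl: "x \<in> nodes G \<Longrightarrow> connected (- region D x)"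
  using outer_node_and_cut_region[OF cut, of x] bounded_region_props(3,4)[of "region D x"]
    outer_region_props(4,5)[of "region D x"] by auto

lemma region_path:
  "x \<in> nodes G \<Longrightarrow> y \<in> region D x \<inter> closure (- region D x) \<Longrightarrow> z \<in> region D x \<inter> closure (- region D x) \<Longrightarrow>
    \<exists>p. path p \<and> path_image p \<subseteq> region D x \<and> pathstart p = y \<and> pathfinish p = z"
  using outer_node_and_cut_region[OF cut, of x] bounded_region_props(5)[of "region D x" y z]
    outer_region_props(7)[of "region D x" y z] by blast

lemma bounded_region_if: "x \<in> nodes G \<Longrightarrow> x \<noteq> VNode vs \<Longrightarrow> x \<noteq> FNode fs \<Longrightarrow> bounded_region (region D x)"
  using cut
proof (cases rule: outer_node_and_cut_cases)
  case (arc y g)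
  moreover assume "x \<in> nodes G" "x \<noteq> VNode vs" "x \<noteq> FNode fs"
  ultimately show ?thesis by auto
qed auto

lemma cut_subset: "C \<subseteq> region D (VNode vs) \<union> region D (FNode fs) \<union> facet D k"
  using cut
proof (cases rule: outer_node_and_cut_cases)
  case (arc x g)
  then show ?thesis using arc_interior(4)[OF arc(4)] by auto
next
  case (rays g g')
  then show ?thesis using ray_props(7)[OF rays(3)] ray_props(7)[OF rays(4)] by auto
qed

lemma closed_cut: "closed C"
  using cut
proof (cases rule: outer_node_and_cut_cases)
  case (arc x g)
  then show ?thesis using closed_path_image[of g] arc_imp_path by blast
next
  case (rays g g')
  then show ?thesis using ray_props(1)[OF rays(3)] ray_props(1)[OF rays(4)] by auto
qed

text \<open>Thus a winding number around points of the cut can be determined at points inside the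
  facet, away from the nodes in which the cut ends.\<close>

lemma cut_closure: "C \<subseteq> closure (C \<inter> facet D k)"
  using cut
proof (cases rule: outer_node_and_cut_cases)
  case (arc x g)
  have "g ` {0<..<1} \<subseteq> C \<inter> facet D k" using arc arc_interior(4)[OF arc(4)] by auto
  then show ?thesis using arc arc_interior(1)[OF arc(4)] closure_mono by blast
next
  case (rays g g')
  have "g ` {0<..} \<subseteq> C \<inter> facet D k" "g' ` {0<..} \<subseteq> C \<inter> facet D k"
    using rays(5) ray_props(8)[OF rays(3)] ray_props(8)[OF rays(4)] by (force simp: subset_iff)+
  then show ?thesis
    using rays(5) ray_props(6)[OF rays(3)] ray_props(6)[OF rays(4)] closure_mono by blast
qed

lemma cut_disjoint:
  "x \<in> nodes G \<Longrightarrow> x \<noteq> VNode vs \<Longrightarrow> x \<noteq> FNode fs \<Longrightarrow> C \<inter> region D x = {}"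
  "l \<in> links G \<Longrightarrow> C \<inter> side l = {}"
  "h \<in> darts G \<Longrightarrow> h \<noteq> k \<Longrightarrow> C \<inter> facet D h = {}"
proof -
  show "C \<inter> region D x = {}" if "x \<in> nodes G" "x \<noteq> VNode vs" "x \<noteq> FNode fs"
    using cut_subset regions_disjoint[OF that(1) root_nodes(1) that(2)] regions_disjoint[OF that(1) root_nodes(2) that(3)]
      facet_region[OF k_in that(1)] by blast
  show "C \<inter> side l = {}" if "l \<in> links G"
    using cut_subset side_region[OF that root_nodes(1)] side_region[OF that root_nodes(2)] facet_side[OF k_in that] by blast
  show "C \<inter> facet D h = {}" if "h \<in> darts G" "h \<noteq> k"
    using cut_subset facet_region[OF that(1) root_nodes(1)] facet_region[OF that(1) root_nodes(2)]
      facets_disjoint[OF that(1) k_in that(2)] by blast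
qed

lemma diagonal_props:
  assumes "d \<in> diagonals G D C"
  shows "corner d \<in> darts G" "src d \<in> region D (VNode (vertex G (corner d)))"
    "dst d \<in> region D (FNode (face G (corner d)))" "open_segment (src d) (dst d) \<subseteq> facet D (corner d) - C"
    "src d \<noteq> dst d"
proof -
  show 1: "corner d \<in> darts G" "src d \<in> region D (VNode (vertex G (corner d)))"
    "dst d \<in> region D (FNode (face G (corner d)))" "open_segment (src d) (dst d) \<subseteq> facet D (corner d) - C"
    using assms by (auto simp: diagonals_def)
  then show "src d \<noteq> dst d"
    using regions_disjoint[OF nodes_intros(1)[OF 1(1)] nodes_intros(3)[OF 1(1)]] by auto
qed

lemma endpoint_closure:
  fixes x y :: complex
  assumes "x \<noteq> y" "open_segment x y \<inter> K = {}"
  shows "x \<in> closure (- K)" "y \<in> closure (- K)"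
proof -
  have "closed_segment x y \<subseteq> closure (- K)"
    using closure_mono[of "open_segment x y" "- K"] assms by (auto simp: closure_open_segment)
  then show "x \<in> closure (- K)" "y \<in> closure (- K)" by auto
qed

lemma link_ends_frontier:
  assumes "l \<in> links G"
  shows "tip D l \<in> region D (outer_end G l) \<inter> closure (- region D (outer_end G l))"
    "base D l \<in> region D (edge_end G l) \<inter> closure (- region D (edge_end G l))"
  using tip_in[OF assms] base_in[OF assms] endpoint_closure[OF tip_neq_base[OF assms]]
    side_region[OF assms ends_nodes(1)[OF assms]] side_region[OF assms ends_nodes(2)[OF assms]]
  by (auto simp: side_def)

lemma diagonal_ends_frontier:
  assumes d: "d \<in> diagonals G D C"
  shows "src d \<in> region D (VNode (vertex G (corner d))) \<inter> closure (- region D (VNode (vertex G (corner d))))"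
    "dst d \<in> region D (FNode (face G (corner d))) \<inter> closure (- region D (FNode (face G (corner d))))"
proof -
  note p = diagonal_props[OF d]
  have "open_segment (src d) (dst d) \<inter> region D (VNode (vertex G (corner d))) = {}"
    "open_segment (src d) (dst d) \<inter> region D (FNode (face G (corner d))) = {}"
    using p(4) facet_region[OF p(1) nodes_intros(1)[OF p(1)]] facet_region[OF p(1) nodes_intros(3)[OF p(1)]] by blast+
  then show "src d \<in> region D (VNode (vertex G (corner d))) \<inter> closure (- region D (VNode (vertex G (corner d))))"
    "dst d \<in> region D (FNode (face G (corner d))) \<inter> closure (- region D (FNode (face G (corner d))))"
    using p endpoint_closure[OF p(5)] by auto
qed

text \<open>The node is connected and the link ends in it, so both see a curve that misses the node
  in the same way.\<close>

lemma turns_on_region: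
  assumes l: "l \<in> links G" and g: "path g" "pathfinish g = pathstart g"
    and disj: "region D (outer_end G l) \<inter> path_image g = {}"
    and m: "\<And>z. z \<in> side l \<Longrightarrow> turns z g = m" and z: "z \<in> region D (outer_end G l)"
  shows "turns z g = m"
proof -
  have t: "tip D l \<in> region D (outer_end G l)" using tip_in[OF l] .
  have cl: "tip D l \<in> closure (side l)"
    using tip_neq_base[OF l] by (simp add: side_def closure_open_segment)
  have "tip D l \<notin> path_image g" using disj t by blast
  then have "turns (tip D l) g = m"
    by (rule turns_closure[OF g _ cl]) (rule m)
  moreover have "turns z g = turns (tip D l) g"
    by (rule turns_constant[OF g connected_region[OF ends_nodes(1)[OF l]] disj z t])
  ultimately show ?thesis by simp
qed

end

section \<open>The quadrilateral to the left of an edge\<close>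

text \<open>
  The corners of the quadrilateral are the nodes \<open>Kv\<close> (tail), \<open>Ke\<close> (edge), \<open>Kw\<close> (head) and \<open>Kf\<close>
  (face).  Its sides, from \<open>x0\<close> to \<open>y0\<close> and so on, are the links \<open>VLink e\<close> and \<open>VLink (opp G e)\<close>, the
  diagonal \<open>db\<close> in the facet \<open>Ah\<close>, and the diagonal \<open>da\<close>, reversed, in the facet \<open>Aa\<close>.  The facets are
  separated by the link \<open>FLink e\<close>.  The path continues at \<open>Kw\<close> with the link \<open>VLink L\<close>, and corner
  turns at \<open>Kw\<close> are compared via \<open>VLink L\<close>.
\<close>

locale path_step = cut_drawing G D vs fs k C
  for G :: "'d plane_graph" and D :: "'d drawing" and vs fs :: "'d set" and k :: 'd and C :: "complex set" +
  fixes e L :: 'd and da db :: "'d diagonal" and P0 Pe1 Pe2 p1 p2 :: "real \<Rightarrow> complex"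
  assumes e: "e \<in> darts G" and not_root: "vertex G e \<noteq> vs"
    and no_loop: "vertex G (opp G e) \<noteq> vertex G e"
    and L: "L \<in> darts G" "vertex G L = vertex G (opp G e)" "L \<noteq> opp G e"
    and da: "da \<in> diagonals G D C" "corner da = e"
    and db: "db \<in> diagonals G D C" "corner db = face_next G e"
    and P0: "path P0" "pathstart P0 = src da" "pathfinish P0 = tip D (VLink e)"
      "path_image P0 \<subseteq> region D (VNode (vertex G e))"
    and Pe1: "path Pe1" "pathstart Pe1 = base D (VLink e)" "pathfinish Pe1 = base D (FLink e)"
      "path_image Pe1 \<subseteq> region D (ENode (edge G e))"
    and Pe2: "path Pe2" "pathstart Pe2 = base D (FLink e)" "pathfinish Pe2 = base D (VLink (opp G e))"
      "path_image Pe2 \<subseteq> region D (ENode (edge G e))"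
    and p1: "path p1" "pathstart p1 = tip D (VLink L)" "pathfinish p1 = tip D (VLink (opp G e))"
      "path_image p1 \<subseteq> region D (VNode (vertex G (opp G e)))"
    and p2: "path p2" "pathstart p2 = tip D (VLink L)" "pathfinish p2 = src db"
      "path_image p2 \<subseteq> region D (VNode (vertex G (opp G e)))"
begin

definition "h = face_next G e"
definition "Kv = region D (VNode (vertex G e))"
definition "Ke = region D (ENode (edge G e))"
definition "Kw = region D (VNode (vertex G (opp G e)))"
definition "Kf = region D (FNode (face G e))"
definition "S0 = side (VLink e)"
definition "S1 = side (VLink (opp G e))"
definition "SF = side (FLink e)"
definition "SL = side (VLink L)"
definition "Aa = facet D e"
definition "Ah = facet D h"
definition "x0 = tip D (VLink e)"
definition "y0 = base D (VLink e)"
definition "x1 = base D (VLink (opp G e))"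
definition "y1 = tip D (VLink (opp G e))"
definition "x2 = src db"
definition "y2 = dst db"
definition "x3 = dst da"
definition "y3 = src da"
definition "tF = tip D (FLink e)"
definition "bF = base D (FLink e)"
definition "c = tip D (VLink L)"
definition "m0 = midpoint x0 y0"
definition "m1 = midpoint x1 y1"
definition "m2 = midpoint x2 y2"
definition "m3 = midpoint x3 y3"
definition "mL = midpoint c (base D (VLink L))"
definition "E2 = open_segment x2 y2"
definition "E3 = open_segment x3 y3"

section \<open>Incidences and disjointness of the pieces around an edge\<close>

lemmas set_defs = Kv_def Ke_def Kw_def Kf_def S0_def S1_def SF_def SL_def Aa_def Ah_def
lemmas point_defs = x0_def y0_def x1_def y1_def x2_def y2_def x3_def y3_def tF_def bF_def c_def

lemma h_neq: "h \<noteq> e" "face_next G h \<noteq> h" "rot G e \<noteq> opp G e"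
  using face_next_neq[OF no_loop] by (simp_all add: h_def)

lemma rot_h: "rot G h = opp G e" by (simp add: h_def rot_face_next)

lemma vertex_h: "vertex G h = vertex G (opp G e)" and face_h: "face G h = face G e"
  by (simp_all add: h_def vertex_face_next face_face_next)

text \<open>The link \<open>VLink L\<close> with which the path continues is a second link at the
  head. Without it, facet \<open>h\<close> could lie on both sides of a link.\<close>

lemma rot_h_neq: "rot G h \<noteq> h"
proof
  assume r: "rot G h = h"
  then have "L = h" by (rule only_dart_at_vertex) (simp add: vertex_h L)
  then show False using r L(3) rot_h by simp
qed

lemma local_darts: "e \<in> darts G" "h \<in> darts G" "opp G e \<in> darts G"
  using e by (simp_all add: h_def face_next_in opp_in)

lemma h_neq_opp: "h \<noteq> opp G e"
  using rot_h_neq rot_h by metis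

text \<open>Of the two facets of the quadrilateral, only \<open>h\<close> can contain the additional
  cut.\<close>

lemma e_neq_k: "e \<noteq> k"
  using not_root vertex_k by auto

lemma local_nodes: "VNode (vertex G e) \<in> nodes G" "ENode (edge G e) \<in> nodes G"
  "VNode (vertex G (opp G e)) \<in> nodes G" "FNode (face G e) \<in> nodes G"
  using nodes_intros[OF local_darts(1)] nodes_intros(1)[OF local_darts(3)] by simp_all

lemma local_links: "VLink e \<in> links G" "VLink (opp G e) \<in> links G" "FLink e \<in> links G" "VLink L \<in> links G"
  using local_darts L by (simp_all add: links_iff)

lemma L_neq: "L \<noteq> e" "opp G e \<noteq> e"
  using L(2) no_loop opp_neq[OF e] by metis+

lemma links_neq: "VLink e \<noteq> VLink (opp G e)" "VLink e \<noteq> FLink e" "VLink e \<noteq> VLink L"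
  "VLink (opp G e) \<noteq> FLink e" "VLink (opp G e) \<noteq> VLink L" "FLink e \<noteq> VLink L"
  using L_neq L(3) by simp_all

lemma pieces_disjoint:
  "Kv \<inter> Ke = {}" "Kv \<inter> Kw = {}" "Kv \<inter> Kf = {}" "Kv \<inter> S0 = {}" "Kv \<inter> S1 = {}"
    "Kv \<inter> SF = {}" "Kv \<inter> SL = {}" "Kv \<inter> Aa = {}" "Kv \<inter> Ah = {}" "Ke \<inter> Kw = {}"
    "Ke \<inter> Kf = {}" "Ke \<inter> S0 = {}" "Ke \<inter> S1 = {}" "Ke \<inter> SF = {}" "Ke \<inter> SL = {}"
    "Ke \<inter> Aa = {}" "Ke \<inter> Ah = {}" "Kw \<inter> Kf = {}" "Kw \<inter> S0 = {}" "Kw \<inter> S1 = {}"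
    "Kw \<inter> SF = {}" "Kw \<inter> SL = {}" "Kw \<inter> Aa = {}" "Kw \<inter> Ah = {}" "Kf \<inter> S0 = {}"
    "Kf \<inter> S1 = {}" "Kf \<inter> SF = {}" "Kf \<inter> SL = {}" "Kf \<inter> Aa = {}" "Kf \<inter> Ah = {}"
    "S0 \<inter> S1 = {}" "S0 \<inter> SF = {}" "S0 \<inter> SL = {}" "S0 \<inter> Aa = {}" "S0 \<inter> Ah = {}"
    "S1 \<inter> SF = {}" "S1 \<inter> SL = {}" "S1 \<inter> Aa = {}" "S1 \<inter> Ah = {}" "SF \<inter> SL = {}"
    "SF \<inter> Aa = {}" "SF \<inter> Ah = {}" "SL \<inter> Aa = {}" "SL \<inter> Ah = {}" "Aa \<inter> Ah = {}"
proof -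
  show "Kv \<inter> Ke = {}" "Kv \<inter> Kw = {}" "Kv \<inter> Kf = {}" "Ke \<inter> Kw = {}" "Ke \<inter> Kf = {}"
    "Kw \<inter> Kf = {}"
    unfolding set_defs by (rule regions_disjoint, rule local_nodes, rule local_nodes, use no_loop no_loop[symmetric] in simp)+
  show "Kv \<inter> S0 = {}" "Kv \<inter> S1 = {}" "Kv \<inter> SF = {}" "Kv \<inter> SL = {}" "Ke \<inter> S0 = {}"
    "Ke \<inter> S1 = {}" "Ke \<inter> SF = {}" "Ke \<inter> SL = {}" "Kw \<inter> S0 = {}" "Kw \<inter> S1 = {}"
    "Kw \<inter> SF = {}" "Kw \<inter> SL = {}" "Kf \<inter> S0 = {}" "Kf \<inter> S1 = {}" "Kf \<inter> SF = {}"
    "Kf \<inter> SL = {}"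
    unfolding set_defs by (subst Int_commute, rule local_links[THEN side_region], rule local_nodes)+
  show "Kv \<inter> Aa = {}" "Kv \<inter> Ah = {}" "Ke \<inter> Aa = {}" "Ke \<inter> Ah = {}" "Kw \<inter> Aa = {}"
    "Kw \<inter> Ah = {}" "Kf \<inter> Aa = {}" "Kf \<inter> Ah = {}"
    unfolding set_defs by (subst Int_commute, rule local_darts[THEN facet_region], rule local_nodes)+
  show "S0 \<inter> S1 = {}" "S0 \<inter> SF = {}" "S0 \<inter> SL = {}" "S1 \<inter> SF = {}" "S1 \<inter> SL = {}"
    "SF \<inter> SL = {}"
    unfolding set_defs by (rule sides_disjoint, rule local_links, rule local_links, use links_neq in simp)+
  show "S0 \<inter> Aa = {}" "S0 \<inter> Ah = {}" "S1 \<inter> Aa = {}" "S1 \<inter> Ah = {}" "SF \<inter> Aa = {}"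
    "SF \<inter> Ah = {}" "SL \<inter> Aa = {}" "SL \<inter> Ah = {}"
    unfolding set_defs by (subst Int_commute, rule local_darts[THEN facet_side], rule local_links)+
  show "Aa \<inter> Ah = {}"
    unfolding set_defs by (rule facets_disjoint[OF local_darts(1,2)]) (use h_neq in simp)
qed

lemmas pieces_disjoint' = pieces_disjoint[THEN trans[OF Int_commute]]

lemma points: "x0 \<in> Kv" "y3 \<in> Kv" "y0 \<in> Ke" "bF \<in> Ke" "x1 \<in> Ke" "y1 \<in> Kw" "c \<in> Kw" "x2 \<in> Kw"
  "y2 \<in> Kf" "tF \<in> Kf" "x3 \<in> Kf"
proof -
  show "x0 \<in> Kv" "y0 \<in> Ke" using tip_in[OF local_links(1)] base_in[OF local_links(1)] by (simp_all add: Kv_def Ke_def x0_def y0_def)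
  show "tF \<in> Kf" "bF \<in> Ke" using tip_in[OF local_links(3)] base_in[OF local_links(3)] by (simp_all add: Kf_def Ke_def tF_def bF_def)
  show "y1 \<in> Kw" "x1 \<in> Ke" using tip_in[OF local_links(2)] base_in[OF local_links(2)] by (simp_all add: Kw_def Ke_def x1_def y1_def edge_opp)
  show "c \<in> Kw" using tip_in[OF local_links(4)] by (simp add: Kw_def c_def L(2))
  show "y3 \<in> Kv" "x3 \<in> Kf" using diagonal_props(2,3)[OF da(1)] unfolding da(2) by (simp_all add: Kv_def Kf_def x3_def y3_def)
  show "x2 \<in> Kw" "y2 \<in> Kf" using diagonal_props(2,3)[OF db(1)] unfolding db(2) h_def[symmetric] vertex_h face_h
    by (simp_all add: Kw_def Kf_def x2_def y2_def)
qed

lemma neq: "x0 \<noteq> y0" "x1 \<noteq> y1" "x2 \<noteq> y2" "x3 \<noteq> y3" "c \<noteq> base D (VLink L)" "tF \<noteq> bF"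
proof -
  show "x0 \<noteq> y0" using tip_neq_base[OF local_links(1)] by (simp add: x0_def y0_def)
  show "x1 \<noteq> y1" using tip_neq_base[OF local_links(2)] unfolding x1_def y1_def by metis
  show "c \<noteq> base D (VLink L)" using tip_neq_base[OF local_links(4)] by (simp add: c_def)
  show "tF \<noteq> bF" using tip_neq_base[OF local_links(3)] by (simp add: tF_def bF_def)
  show "x2 \<noteq> y2" using diagonal_props(5)[OF db(1)] by (simp add: x2_def y2_def)
  show "x3 \<noteq> y3" using diagonal_props(5)[OF da(1)] unfolding x3_def y3_def by metis
qed

lemma open_segs: "open_segment x0 y0 = S0" "open_segment x1 y1 = S1" "open_segment tF bF = SF"
  "open_segment c (base D (VLink L)) = SL" "E2 \<subseteq> Ah - C" "E3 \<subseteq> Aa - C"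
proof -
  show "open_segment x0 y0 = S0" "open_segment tF bF = SF" "open_segment c (base D (VLink L)) = SL"
    by (simp_all add: point_defs S0_def SF_def SL_def side_def)
  show "open_segment x1 y1 = S1" unfolding x1_def y1_def S1_def side_def by (rule open_segment_commute)
  show "E2 \<subseteq> Ah - C" using diagonal_props(4)[OF db(1)] unfolding E2_def Ah_def x2_def y2_def db(2) h_def .
  show "E3 \<subseteq> Aa - C" using diagonal_props(4)[OF da(1)]
    unfolding E3_def Aa_def x3_def y3_def da(2) open_segment_commute[of "dst da"] .
qed

lemma midpoints_in: "m0 \<in> S0" "m1 \<in> S1" "m2 \<in> E2" "m3 \<in> E3" "mL \<in> SL"
  using neq unfolding m0_def m1_def m2_def m3_def mL_def E2_def E3_def open_segs(1,2,4)[symmetric] by simp_all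

lemma halves: "closed_segment x0 y0 \<subseteq> S0 \<union> Kv \<union> Ke" "closed_segment x1 y1 \<subseteq> S1 \<union> Ke \<union> Kw"
  "closed_segment x2 y2 \<subseteq> E2 \<union> Kw \<union> Kf" "closed_segment x3 y3 \<subseteq> E3 \<union> Kf \<union> Kv"
  "closed_segment tF bF \<subseteq> SF \<union> Kf \<union> Ke"
  "closed_segment x1 m1 \<subseteq> S1 \<union> Ke" "closed_segment m1 y1 \<subseteq> S1 \<union> Kw"
  "closed_segment x2 m2 \<subseteq> E2 \<union> Kw" "closed_segment m2 y2 \<subseteq> E2 \<union> Kf"
  "closed_segment x3 m3 \<subseteq> E3 \<union> Kf" "closed_segment m3 y3 \<subseteq> E3 \<union> Kv"
  "closed_segment c mL \<subseteq> SL \<union> Kw"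
proof -
  show "closed_segment x0 y0 \<subseteq> S0 \<union> Kv \<union> Ke" "closed_segment x1 y1 \<subseteq> S1 \<union> Ke \<union> Kw"
    "closed_segment x2 y2 \<subseteq> E2 \<union> Kw \<union> Kf" "closed_segment x3 y3 \<subseteq> E3 \<union> Kf \<union> Kv"
    "closed_segment tF bF \<subseteq> SF \<union> Kf \<union> Ke"
    unfolding closed_segment_eq_open open_segs E2_def E3_def using points by blast+
  show "closed_segment x1 m1 \<subseteq> S1 \<union> Ke" "closed_segment m1 y1 \<subseteq> S1 \<union> Kw"
    using half_segments(1,2)[OF neq(2)] points(5,6) unfolding m1_def open_segs by blast+
  show "closed_segment x2 m2 \<subseteq> E2 \<union> Kw" "closed_segment m2 y2 \<subseteq> E2 \<union> Kf"
    using half_segments(1,2)[OF neq(3)] points(8,9) unfolding m2_def E2_def by blast+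
  show "closed_segment x3 m3 \<subseteq> E3 \<union> Kf" "closed_segment m3 y3 \<subseteq> E3 \<union> Kv"
    using half_segments(1,2)[OF neq(4)] points(2,11) unfolding m3_def E3_def by blast+
  show "closed_segment c mL \<subseteq> SL \<union> Kw"
    using half_segments(1)[OF neq(5)] points(7) unfolding mL_def open_segs by blast
qed

lemmas paths = P0[folded x0_def y3_def Kv_def] Pe1[folded y0_def bF_def Ke_def] Pe2[folded bF_def x1_def Ke_def]
  p1[folded c_def y1_def Kw_def] p2[folded c_def x2_def Kw_def]

lemma regions_sub: "Kv \<subseteq> \<Union> (region D ` nodes G)" "Ke \<subseteq> \<Union> (region D ` nodes G)"
  "Kw \<subseteq> \<Union> (region D ` nodes G)" "Kf \<subseteq> \<Union> (region D ` nodes G)"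
  using local_nodes unfolding set_defs by blast+

end

text \<open>
  The boundary of the quadrilateral is cut into three closed curves: \<open>tau\<close> runs around the part in
  \<open>Aa\<close>, and \<open>Z\<close>, which avoids the additional cut, separates the parts \<open>tau2\<close> and \<open>lam\<close> in \<open>Ah\<close>.
  Each of them lies in one facet, some of its sides, and nodes.
\<close>

locale path_step_curves = path_step G D vs fs k C e L da db P0 Pe1 Pe2 p1 p2
  for G :: "'d plane_graph" and D :: "'d drawing" and vs fs :: "'d set" and k :: 'd and C :: "complex set"
    and e L :: 'd and da db :: "'d diagonal" and P0 Pe1 Pe2 p1 p2 :: "real \<Rightarrow> complex" +
  fixes Pf1 Pf2 Z :: "real \<Rightarrow> complex"
  assumes Pf1: "path Pf1" "pathstart Pf1 = y2" "pathfinish Pf1 = tF" "path_image Pf1 \<subseteq> Kf"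
    and Pf2: "path Pf2" "pathstart Pf2 = tF" "pathfinish Pf2 = x3" "path_image Pf2 \<subseteq> Kf"
    and Z: "path Z" "pathstart Z = m1" "pathfinish Z = m2" "path_image Z \<subseteq> insert m1 (Ah - C)"
begin

definition "tau_pieces = [P0, linepath x0 y0, Pe1, linepath bF tF, Pf2, linepath x3 y3]"
definition "tau2_pieces = [linepath tF bF, Pe2, linepath x1 m1, Z, linepath m2 y2, Pf1]"
definition "lam_pieces = [linepath m1 y1, reversepath p1, p2, linepath x2 m2, reversepath Z]"
definition "tau = join_all tau_pieces"
definition "tau2 = join_all tau2_pieces"
definition "lam = join_all lam_pieces"

lemma linked_pieces: "linked tau_pieces" "linked tau2_pieces" "linked lam_pieces"
  using paths Pf1 Pf2 Z by (simp_all add: tau_pieces_def tau2_pieces_def lam_pieces_def)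

lemma tau: "path tau" "pathfinish tau = pathstart tau" "path_image tau \<subseteq> Kv \<union> S0 \<union> Ke \<union> SF \<union> Kf \<union> E3"
proof -
  show "path tau" "pathfinish tau = pathstart tau"
    using join_all_linked[OF linked_pieces(1)] paths by (simp_all add: tau_def tau_pieces_def)
  have "path_image tau = path_image P0 \<union> closed_segment x0 y0 \<union> path_image Pe1 \<union> closed_segment tF bF \<union> path_image Pf2 \<union> closed_segment x3 y3"
    unfolding tau_def path_image_join_all[OF linked_pieces(1)]
    by (simp add: tau_pieces_def closed_segment_commute[of bF] Un_assoc)
  then show "path_image tau \<subseteq> Kv \<union> S0 \<union> Ke \<union> SF \<union> Kf \<union> E3"
    using paths(4,8) Pf2(4) halves(1,4,5) by blast
qed

lemma tau2: "path tau2" "pathfinish tau2 = pathstart tau2" "path_image tau2 \<subseteq> SF \<union> Ke \<union> Kf \<union> S1 \<union> (Ah - C)"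
proof -
  show "path tau2" "pathfinish tau2 = pathstart tau2"
    using join_all_linked[OF linked_pieces(2)] Pf1 by (simp_all add: tau2_def tau2_pieces_def)
  have "path_image tau2 = closed_segment tF bF \<union> path_image Pe2 \<union> closed_segment x1 m1 \<union> path_image Z \<union> closed_segment m2 y2 \<union> path_image Pf1"
    unfolding tau2_def path_image_join_all[OF linked_pieces(2)]
    by (simp add: tau2_pieces_def Un_assoc)
  then show "path_image tau2 \<subseteq> SF \<union> Ke \<union> Kf \<union> S1 \<union> (Ah - C)"
    using paths(12) Pf1(4) Z(4) halves(5,6,9) open_segs(5) midpoints_in(2) by blast
qed

lemma lam: "path lam" "pathfinish lam = pathstart lam" "path_image lam \<subseteq> S1 \<union> Kw \<union> (Ah - C)"
proof -
  show "path lam" "pathfinish lam = pathstart lam"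
    using join_all_linked[OF linked_pieces(3)] Z by (simp_all add: lam_def lam_pieces_def)
  have "path_image lam = closed_segment m1 y1 \<union> path_image p1 \<union> path_image p2 \<union> closed_segment x2 m2 \<union> path_image Z"
    unfolding lam_def path_image_join_all[OF linked_pieces(3)]
    by (simp add: lam_pieces_def Un_assoc)
  then show "path_image lam \<subseteq> S1 \<union> Kw \<union> (Ah - C)"
    using paths(16,20) Z(4) halves(7,8) open_segs(5) midpoints_in(2) by blast
qed

text \<open>The midpoint \<open>mL\<close> serves as a common reference point for all three curves,
  since \<open>VLink L\<close> is a side of none of them.\<close>

lemma tau_const:
  shows tau_const_facet: "\<And>y z. y \<in> darts G \<Longrightarrow> y \<noteq> e \<Longrightarrow> z \<in> facet D y \<Longrightarrow> z \<notin> path_image tau \<and> turns z tau = turns mL tau"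
    and tau_const_link: "\<And>l z. l \<in> links G \<Longrightarrow> l \<noteq> VLink e \<Longrightarrow> l \<noteq> FLink e \<Longrightarrow> z \<in> side l \<Longrightarrow> z \<notin> path_image tau \<and> turns z tau = turns mL tau"
proof -
  have X: "{VLink e, FLink e} \<subseteq> {VLink e, FLink e, VLink (rot G e), FLink (opp G (rot G e))}" by blast
  define R where "R = \<Union> (region D ` nodes G)"
  have un: "\<Union> (side ` {VLink e, FLink e}) = S0 \<union> SF" by (simp add: S0_def S1_def SF_def)
  have "path_image tau \<subseteq> facet D e \<union> R \<union> (S0 \<union> SF)"
    using tau(3) regions_sub[folded R_def] open_segs(6) unfolding Aa_def by blast
  then have img: "path_image tau \<subseteq> facet D e \<union> \<Union> (region D ` nodes G) \<union> \<Union> (side ` {VLink e, FLink e})"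
    unfolding un R_def .
  obtain m where m:
    "\<And>y z. y \<in> darts G \<Longrightarrow> y \<noteq> e \<Longrightarrow> z \<in> facet D y \<Longrightarrow> z \<notin> path_image tau \<and> turns z tau = m"
    "\<And>l z. l \<in> links G \<Longrightarrow> l \<notin> {VLink e, FLink e} \<Longrightarrow> z \<in> side l \<Longrightarrow> z \<notin> path_image tau \<and> turns z tau = m"
  \<comment> \<open>The tail may have \<open>e\<close> as its only dart, so the alternative
    \<open>VLink e \<in> X\<close> is used here; for facet \<open>h\<close> it will be
    \<open>rot_h_neq\<close>.\<close>
  proof (rule turns_constant_outside_facet[OF e h_neq(1)[unfolded h_def] disjI2[OF insertI1] X tau(1,2) img])
    fix m
    assume 1: "\<And>y z. y \<in> darts G \<Longrightarrow> y \<noteq> e \<Longrightarrow> z \<in> facet D y \<Longrightarrow> z \<notin> path_image tau \<and> turns z tau = m"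
      and 2: "\<And>l z. l \<in> links G \<Longrightarrow> l \<notin> {VLink e, FLink e} \<Longrightarrow> z \<in> side l \<Longrightarrow> z \<notin> path_image tau \<and> turns z tau = m"
    show thesis by (rule that[OF 1 2])
  qed
  have "VLink L \<notin> {VLink e, FLink e}" using L_neq by simp
  then have "turns mL tau = m" using m(2)[OF local_links(4), of mL] midpoints_in(5) by (simp add: SL_def)
  then show "\<And>y z. y \<in> darts G \<Longrightarrow> y \<noteq> e \<Longrightarrow> z \<in> facet D y \<Longrightarrow> z \<notin> path_image tau \<and> turns z tau = turns mL tau"
    and "\<And>l z. l \<in> links G \<Longrightarrow> l \<noteq> VLink e \<Longrightarrow> l \<noteq> FLink e \<Longrightarrow> z \<in> side l \<Longrightarrow> z \<notin> path_image tau \<and> turns z tau = turns mL tau"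
    using m by simp_all
qed

lemma tau2_const:
  shows tau2_const_facet: "\<And>y z. y \<in> darts G \<Longrightarrow> y \<noteq> h \<Longrightarrow> z \<in> facet D y \<Longrightarrow> z \<notin> path_image tau2 \<and> turns z tau2 = turns mL tau2"
    and tau2_const_link: "\<And>l z. l \<in> links G \<Longrightarrow> l \<noteq> FLink e \<Longrightarrow> l \<noteq> VLink (opp G e) \<Longrightarrow> z \<in> side l \<Longrightarrow> z \<notin> path_image tau2 \<and> turns z tau2 = turns mL tau2"
proof -
  have X: "{FLink e, VLink (opp G e)} \<subseteq> {VLink h, FLink h, VLink (rot G h), FLink (opp G (rot G h))}"
    using e by (simp add: rot_h opp_opp)
  define R where "R = \<Union> (region D ` nodes G)"
  have un: "\<Union> (side ` {FLink e, VLink (opp G e)}) = SF \<union> S1" by (simp add: S0_def S1_def SF_def)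
  have "path_image tau2 \<subseteq> facet D h \<union> R \<union> (SF \<union> S1)"
    using tau2(3) regions_sub[folded R_def] unfolding Ah_def by blast
  then have img: "path_image tau2 \<subseteq> facet D h \<union> \<Union> (region D ` nodes G) \<union> \<Union> (side ` {FLink e, VLink (opp G e)})"
    unfolding un R_def .
  obtain m where m:
    "\<And>y z. y \<in> darts G \<Longrightarrow> y \<noteq> h \<Longrightarrow> z \<in> facet D y \<Longrightarrow> z \<notin> path_image tau2 \<and> turns z tau2 = m"
    "\<And>l z. l \<in> links G \<Longrightarrow> l \<notin> {FLink e, VLink (opp G e)} \<Longrightarrow> z \<in> side l \<Longrightarrow> z \<notin> path_image tau2 \<and> turns z tau2 = m"
  proof (rule turns_constant_outside_facet[OF local_darts(2) h_neq(2) disjI1[OF rot_h_neq] X tau2(1,2) img])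
    fix m
    assume 1: "\<And>y z. y \<in> darts G \<Longrightarrow> y \<noteq> h \<Longrightarrow> z \<in> facet D y \<Longrightarrow> z \<notin> path_image tau2 \<and> turns z tau2 = m"
      and 2: "\<And>l z. l \<in> links G \<Longrightarrow> l \<notin> {FLink e, VLink (opp G e)} \<Longrightarrow> z \<in> side l \<Longrightarrow> z \<notin> path_image tau2 \<and> turns z tau2 = m"
    show thesis by (rule that[OF 1 2])
  qed
  have "VLink L \<notin> {FLink e, VLink (opp G e)}" using L(3) by simp
  then have "turns mL tau2 = m" using m(2)[OF local_links(4), of mL] midpoints_in(5) by (simp add: SL_def)
  then show "\<And>y z. y \<in> darts G \<Longrightarrow> y \<noteq> h \<Longrightarrow> z \<in> facet D y \<Longrightarrow> z \<notin> path_image tau2 \<and> turns z tau2 = turns mL tau2"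
    and "\<And>l z. l \<in> links G \<Longrightarrow> l \<noteq> FLink e \<Longrightarrow> l \<noteq> VLink (opp G e) \<Longrightarrow> z \<in> side l \<Longrightarrow> z \<notin> path_image tau2 \<and> turns z tau2 = turns mL tau2"
    using m by simp_all
qed

lemma lam_const:
  shows lam_const_facet: "\<And>y z. y \<in> darts G \<Longrightarrow> y \<noteq> h \<Longrightarrow> z \<in> facet D y \<Longrightarrow> z \<notin> path_image lam \<and> turns z lam = turns mL lam"
    and lam_const_link: "\<And>l z. l \<in> links G \<Longrightarrow> l \<noteq> VLink (opp G e) \<Longrightarrow> z \<in> side l \<Longrightarrow> z \<notin> path_image lam \<and> turns z lam = turns mL lam"
proof -
  have X: "{VLink (opp G e)} \<subseteq> {VLink h, FLink h, VLink (rot G h), FLink (opp G (rot G h))}"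
    by (simp add: rot_h)
  define R where "R = \<Union> (region D ` nodes G)"
  have un: "\<Union> (side ` {VLink (opp G e)}) = S1" by (simp add: S0_def S1_def SF_def)
  have "path_image lam \<subseteq> facet D h \<union> R \<union> (S1)"
    using lam(3) regions_sub[folded R_def] unfolding Ah_def by blast
  then have img: "path_image lam \<subseteq> facet D h \<union> \<Union> (region D ` nodes G) \<union> \<Union> (side ` {VLink (opp G e)})"
    unfolding un R_def .
  obtain m where m:
    "\<And>y z. y \<in> darts G \<Longrightarrow> y \<noteq> h \<Longrightarrow> z \<in> facet D y \<Longrightarrow> z \<notin> path_image lam \<and> turns z lam = m"
    "\<And>l z. l \<in> links G \<Longrightarrow> l \<notin> {VLink (opp G e)} \<Longrightarrow> z \<in> side l \<Longrightarrow> z \<notin> path_image lam \<and> turns z lam = m"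
  proof (rule turns_constant_outside_facet[OF local_darts(2) h_neq(2) disjI1[OF rot_h_neq] X lam(1,2) img])
    fix m
    assume 1: "\<And>y z. y \<in> darts G \<Longrightarrow> y \<noteq> h \<Longrightarrow> z \<in> facet D y \<Longrightarrow> z \<notin> path_image lam \<and> turns z lam = m"
      and 2: "\<And>l z. l \<in> links G \<Longrightarrow> l \<notin> {VLink (opp G e)} \<Longrightarrow> z \<in> side l \<Longrightarrow> z \<notin> path_image lam \<and> turns z lam = m"
    show thesis by (rule that[OF 1 2])
  qed
  have "VLink L \<notin> {VLink (opp G e)}" using L(3) by simp
  then have "turns mL lam = m" using m(2)[OF local_links(4), of mL] midpoints_in(5) by (simp add: SL_def)
  then show "\<And>y z. y \<in> darts G \<Longrightarrow> y \<noteq> h \<Longrightarrow> z \<in> facet D y \<Longrightarrow> z \<notin> path_image lam \<and> turns z lam = turns mL lam"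
    and "\<And>l z. l \<in> links G \<Longrightarrow> l \<noteq> VLink (opp G e) \<Longrightarrow> z \<in> side l \<Longrightarrow> z \<notin> path_image lam \<and> turns z lam = turns mL lam"
    using m by simp_all
qed

lemma turns_tau:
  assumes "z \<notin> path_image tau"
  shows "turns z tau = turns z P0 + turns z (linepath x0 y0) + turns z Pe1 + turns z (linepath bF tF)
    + turns z Pf2 + turns z (linepath x3 y3)"
proof -
  have "z \<notin> path_image g" if "g \<in> set tau_pieces" for g
    using assms that unfolding tau_def path_image_join_all[OF linked_pieces(1)] by blast
  then show ?thesis using turns_join_all[OF linked_pieces(1), of z] by (simp add: tau_def tau_pieces_def)
qed

lemma turns_tau2:
  assumes "z \<notin> path_image tau2"
  shows "turns z tau2 = turns z (linepath tF bF) + turns z Pe2 + turns z (linepath x1 m1) + turns z Z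
    + turns z (linepath m2 y2) + turns z Pf1"
proof -
  have "z \<notin> path_image g" if "g \<in> set tau2_pieces" for g
    using assms that unfolding tau2_def path_image_join_all[OF linked_pieces(2)] by blast
  then show ?thesis using turns_join_all[OF linked_pieces(2), of z] by (simp add: tau2_def tau2_pieces_def)
qed

lemma turns_lam:
  assumes "z \<notin> path_image lam"
  shows "turns z lam = turns z (linepath m1 y1) - turns z p1 + turns z p2 + turns z (linepath x2 m2) - turns z Z"
proof -
  have n: "z \<notin> path_image g" if "g \<in> set lam_pieces" for g
    using assms that unfolding lam_def path_image_join_all[OF linked_pieces(3)] by blast
  have "z \<notin> path_image (reversepath p1)" "z \<notin> path_image (reversepath Z)"
    by (rule n, simp add: lam_pieces_def)+
  then show ?thesis using turns_join_all[OF linked_pieces(3) n] paths(13) Z(1)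
    by (simp add: lam_def lam_pieces_def turns_reversepath)
qed

section \<open>The view of the curves from infinity and from the additional cut\<close>

lemma nodes_off_curves:
  assumes x: "x \<in> nodes G"
  shows "x \<noteq> VNode (vertex G e) \<Longrightarrow> x \<noteq> ENode (edge G e) \<Longrightarrow> x \<noteq> FNode (face G e) \<Longrightarrow>
      region D x \<inter> path_image tau = {} \<and> region D x \<inter> path_image tau2 = {}"
    and "x \<noteq> VNode (vertex G (opp G e)) \<Longrightarrow> region D x \<inter> path_image lam = {}"
proof -
  have s: "side l \<inter> region D x = {}" if "l \<in> links G" for l using side_region[OF that x] .
  have f': "region D x \<inter> Aa = {}" "region D x \<inter> Ah = {}"
    using facet_region[OF local_darts(1) x] facet_region[OF local_darts(2) x] by (simp_all add: Aa_def Ah_def Int_commute)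
  show "region D x \<inter> path_image tau = {} \<and> region D x \<inter> path_image tau2 = {}"
    if "x \<noteq> VNode (vertex G e)" "x \<noteq> ENode (edge G e)" "x \<noteq> FNode (face G e)"
  proof -
    have r: "region D x \<inter> Kv = {}" "region D x \<inter> Ke = {}" "region D x \<inter> Kf = {}"
      unfolding Kv_def Ke_def Kf_def
      by (rule regions_disjoint[OF x local_nodes(1) that(1)] regions_disjoint[OF x local_nodes(2) that(2)] regions_disjoint[OF x local_nodes(4) that(3)])+
    have q: "region D x \<inter> S0 = {}" "region D x \<inter> S1 = {}" "region D x \<inter> SF = {}"
      using s[OF local_links(1)] s[OF local_links(2)] s[OF local_links(3)] unfolding S0_def S1_def SF_def by (simp_all add: Int_commute)
    have "region D x \<inter> (Kv \<union> S0 \<union> Ke \<union> SF \<union> Kf \<union> Aa) = {}" "region D x \<inter> (SF \<union> Ke \<union> Kf \<union> S1 \<union> Ah) = {}"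
      by (simp_all only: Int_Un_distrib r q f' Un_empty_left)
    moreover have "path_image tau \<subseteq> Kv \<union> S0 \<union> Ke \<union> SF \<union> Kf \<union> Aa" using tau(3) open_segs(6) by blast
    moreover have "path_image tau2 \<subseteq> SF \<union> Ke \<union> Kf \<union> S1 \<union> Ah" using tau2(3) by blast
    ultimately show ?thesis by blast
  qed
  show "region D x \<inter> path_image lam = {}" if "x \<noteq> VNode (vertex G (opp G e))"
  proof -
    have r: "region D x \<inter> Kw = {}"
      unfolding Kw_def by (rule regions_disjoint[OF x local_nodes(3) that])
    have "region D x \<inter> S1 = {}" using s[OF local_links(2)] unfolding S1_def by (simp add: Int_commute)
    then have "region D x \<inter> (S1 \<union> Kw \<union> Ah) = {}" by (simp only: Int_Un_distrib r f' Un_empty_left)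
    moreover have "path_image lam \<subseteq> S1 \<union> Kw \<union> Ah" using lam(3) by blast
    ultimately show ?thesis by blast
  qed
qed

lemma facet_unbounded_zero:
  assumes "path g" "pathfinish g = pathstart g" "y \<in> darts G" "\<not> bounded (facet D y)"
    and "\<And>z. z \<in> facet D y \<Longrightarrow> z \<notin> path_image g \<and> turns z g = m"
  shows "m = 0"
proof -
  obtain z where z: "z \<in> facet D y" using facet_nonempty[OF assms(3)] by blast
  have "turns z g = 0"
    by (rule turns_unbounded_eq_0[OF assms(1,2) facet_connected[OF assms(3)] _ z assms(4)]) (use assms(5) in blast)
  then show ?thesis using assms(5)[OF z] by simp
qed

text \<open>The node together with a ray starting in it is connected, unbounded and off the
  curve.\<close>

lemma region_ray_zero:
  assumes g: "path g" "pathfinish g = pathstart g" and x: "x \<in> nodes G" and r: "ray (region D x) U r"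
    and disj: "region D x \<inter> path_image g = {}" "r ` {0..} \<inter> U \<inter> path_image g = {}" and z: "z \<in> region D x"
  shows "turns z g = 0"
proof (rule turns_unbounded_eq_0[OF g, of "region D x \<union> r ` {0..}"])
  note p = ray_props[OF r]
  show "connected (region D x \<union> r ` {0..})"
    by (rule connected_Un[OF connected_region[OF x] p(2)]) (use p(9) in auto)
  show "(region D x \<union> r ` {0..}) \<inter> path_image g = {}" using disj p(7) by blast
  show "z \<in> region D x \<union> r ` {0..}" using z by blast
  show "\<not> bounded (region D x \<union> r ` {0..})" using p(3) by simp
qed

lemma cut_off_curves: "C \<inter> Ah \<inter> path_image tau2 = {}" "C \<inter> Ah \<inter> path_image lam = {}"
proof -
  have "Ah \<inter> (SF \<union> Ke \<union> Kf \<union> S1) = {}" "Ah \<inter> (S1 \<union> Kw) = {}"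
    by (simp_all only: Int_Un_distrib pieces_disjoint' Un_empty_left)
  then show "C \<inter> Ah \<inter> path_image tau2 = {}" "C \<inter> Ah \<inter> path_image lam = {}"
    using tau2(3) lam(3) by blast+
qed

text \<open>As all links outside the curve see \<open>lam\<close> alike, it is enough to see one of
  them from infinity: through the outer node, which is not the head if the head is bounded, or
  through the unbounded facet.\<close>

lemma lam_zero:
  assumes hyp: "bounded Kw \<or> turns mL lam = 0"
  shows "turns mL lam = 0"
proof (cases "bounded Kw")
  case True
  from cut show ?thesis
  proof (cases rule: outer_node_and_cut_cases)
    case (arc x g)
    have x: "x \<in> nodes G" using arc(1) root_nodes by auto
    have xw: "x \<noteq> VNode (vertex G (opp G e))"
      using True outer_region_props(3)[OF arc(2)] by (auto simp: Kw_def)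
    have disj: "region D x \<inter> path_image lam = {}" using nodes_off_curves(2)[OF x xw] .
    obtain l where l: "l \<in> links G" "outer_end G l = x" "l \<noteq> VLink (opp G e)"
    proof (cases "x = VNode vs")
      case True
      then have "VLink k \<noteq> VLink (opp G e)" using xw vertex_k by auto
      then show thesis using that[of "VLink k"] True k_in vertex_k by (simp add: links_iff)
    next
      case False
      then show thesis using that[of "FLink k"] arc(1) k_in face_k by (simp add: links_iff)
    qed
    have t: "tip D l \<in> region D x" using tip_in[OF l(1)] l(2) by simp
    have "turns (tip D l) lam = turns mL lam"
      by (rule turns_on_region[OF l(1) lam(1,2)]) (use l disj t lam_const_link[OF l(1,3)] in simp_all)
    moreover have "turns (tip D l) lam = 0"
      by (rule turns_unbounded_eq_0[OF lam(1,2) connected_region[OF x] disj t outer_region_props(3)[OF arc(2)]])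
    ultimately show ?thesis by simp
  next
    case (rays g g')
    show ?thesis
    proof (cases "k = h")
      case False
      then show ?thesis
        using facet_unbounded_zero[OF lam(1,2) k_in rays(2)] lam_const_facet[OF k_in] by blast
    next
      case True
      \<comment> \<open>Here the unbounded facet is the one in which \<open>lam\<close> runs.
        Infinity is connected to the face-node by a ray of the cut, which \<open>lam\<close>
        avoids.\<close>
      have fe: "fs = face G e" using True face_k face_h by simp
      have "FNode (face G e) \<noteq> VNode (vertex G (opp G e))" by simp
      then have d: "region D (FNode fs) \<inter> path_image lam = {}"
        using nodes_off_curves(2)[OF root_nodes(2)] by simp
      have t: "tF \<in> region D (FNode fs)" using points(10) fe by (simp add: Kf_def)
      have "g' ` {0..} \<subseteq> C" using rays(5) by simp
      then have "turns tF lam = 0"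
        using cut_off_curves(2) True
        by (intro region_ray_zero[OF lam(1,2) root_nodes(2) rays(4) d _ t]) (auto simp: Ah_def)
      moreover have "turns tF lam = turns mL lam"
        by (rule turns_on_region[OF local_links(3) lam(1,2)]) (use d t fe lam_const_link[OF local_links(3)] in simp_all)
      ultimately show ?thesis by simp
    qed
  qed
qed (use hyp in simp)

text \<open>If the unbounded facet is \<open>h\<close>, then the root is the head, a node that
  \<open>tau2\<close> does not touch, and the ray from the root leads to infinity.\<close>

lemma curves_zero_rays:
  assumes "\<not> bounded (facet D k)" and g: "ray (region D (VNode vs)) (facet D k) g" "g ` {0..} \<subseteq> C"
  shows "turns mL tau = 0" "turns mL tau2 = 0"
proof -
  show "turns mL tau = 0"
    using facet_unbounded_zero[OF tau(1,2) k_in assms(1)] tau_const_facet[OF k_in] e_neq_k by metis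
  show "turns mL tau2 = 0"
  proof (cases "k = h")
    case False
    then show ?thesis
      using facet_unbounded_zero[OF tau2(1,2) k_in assms(1)] tau2_const_facet[OF k_in] by blast
  next
    case True
    have vw: "vs = vertex G (opp G e)" using True vertex_k vertex_h by simp
    have d: "region D (VNode vs) \<inter> path_image tau2 = {}"
      using nodes_off_curves(1)[OF root_nodes(1)] not_root by auto
    have t: "c \<in> region D (VNode vs)" using points(7) vw by (simp add: Kw_def)
    have "turns c tau2 = 0"
      using cut_off_curves(1) True g(2)
      by (intro region_ray_zero[OF tau2(1,2) root_nodes(1) g(1) d _ t]) (auto simp: Ah_def)
    moreover have "turns c tau2 = turns mL tau2"
      by (rule turns_on_region[OF local_links(4) tau2(1,2)]) (use d t vw L tau2_const_link[OF local_links(4)] in simp_all)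
    ultimately show ?thesis by simp
  qed
qed

text \<open>Both curves pass through the face-node. If it is the outer node, it cannot serve as a
  view from infinity; this case is left to \<open>height_step\<close>.\<close>

lemma curves_zero: "outer_region Kf \<or> turns mL tau + turns mL tau2 = 0"
  using cut
proof (cases rule: outer_node_and_cut_cases)
  case (arc x g)
  show ?thesis
  proof (cases "x = FNode (face G e)")
    case True
    then show ?thesis using arc(2) by (simp add: Kf_def)
  next
    case False
    have x: "x \<in> nodes G" using arc(1) root_nodes by auto
    have "x \<noteq> VNode (vertex G e)" "x \<noteq> ENode (edge G e)" using arc(1) not_root by auto
    then have d: "region D x \<inter> path_image tau = {}" "region D x \<inter> path_image tau2 = {}"
      using nodes_off_curves(1)[OF x] False by blast+
    \<comment> \<open>A link is needed that ends in the outer node but is not a side of either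
      curve: \<open>VLink L\<close> if the root is the head, and otherwise a link at the corner
      \<open>k\<close>.\<close>
    obtain l where l: "l \<in> links G" "outer_end G l = x" "l \<noteq> VLink (opp G e)" "l \<noteq> VLink e" "l \<noteq> FLink e"
    proof (cases "x = VNode vs")
      case True
      show thesis
      proof (cases "vertex G (opp G e) = vs")
        case w: True
        then show thesis using that[of "VLink L"] True local_links(4) L L_neq by simp
      next
        case w: False
        then have "k \<noteq> e" "k \<noteq> opp G e" using vertex_k not_root by auto
        then show thesis using that[of "VLink k"] True k_in vertex_k by (simp add: links_iff)
      qed
    next
      case x': False
      then have "k \<noteq> e" using arc(1) False face_k by auto
      then show thesis using that[of "FLink k"] arc(1) x' k_in face_k by (simp add: links_iff)
    qed
    have t: "tip D l \<in> region D x" using tip_in[OF l(1)] l(2) by simp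
    have "turns (tip D l) tau = turns mL tau"
      by (rule turns_on_region[OF l(1) tau(1,2)]) (use l d t tau_const_link[OF l(1,4,5)] in simp_all)
    moreover have "turns (tip D l) tau2 = turns mL tau2"
      by (rule turns_on_region[OF l(1) tau2(1,2)]) (use l d t tau2_const_link[OF l(1,5,3)] in simp_all)
    moreover have "turns (tip D l) tau = 0"
      by (rule turns_unbounded_eq_0[OF tau(1,2) connected_region[OF x] d(1) t outer_region_props(3)[OF arc(2)]])
    moreover have "turns (tip D l) tau2 = 0"
      by (rule turns_unbounded_eq_0[OF tau2(1,2) connected_region[OF x] d(2) t outer_region_props(3)[OF arc(2)]])
    ultimately show ?thesis by simp
  qed
next
  case (rays g g')
  then have "g ` {0..} \<subseteq> C" by simp
  then show ?thesis using curves_zero_rays[OF rays(2,3)] by simp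
qed

text \<open>If the cut lies in facet \<open>h\<close>, it shares this facet with
  \<open>tau2\<close>, so constancy on facets gives nothing. Its points are then reached along the
  cut itself, from the root or from infinity.\<close>

lemma curves_zero_cut:
  assumes zero: "turns mL tau + turns mL tau2 = 0" and z: "z \<in> C \<inter> facet D k"
  shows "z \<notin> path_image tau \<and> z \<notin> path_image tau2 \<and> turns z tau + turns z tau2 = 0"
proof -
  have 1: "z \<notin> path_image tau \<and> turns z tau = turns mL tau"
    using tau_const_facet[OF k_in] e_neq_k z by blast
  have 2: "z \<notin> path_image tau2 \<and> turns z tau2 = turns mL tau2"
  proof (cases "k = h")
    case False
    then show ?thesis using tau2_const_facet[OF k_in False] z by blast
  next
    case True
    have vw: "vs = vertex G (opp G e)" using True vertex_k vertex_h by simp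
    have d: "region D (VNode vs) \<inter> path_image tau2 = {}"
      using nodes_off_curves(1)[OF root_nodes(1)] not_root by auto
    have t: "c \<in> region D (VNode vs)" using points(7) vw by (simp add: Kw_def)
    have ct: "turns c tau2 = turns mL tau2"
      by (rule turns_on_region[OF local_links(4) tau2(1,2)]) (use d t vw L tau2_const_link[OF local_links(4)] in simp_all)
    have off: "C \<inter> facet D k \<inter> path_image tau2 = {}" using cut_off_curves(1) True by (simp add: Ah_def)
    have "turns z tau2 = turns mL tau2"
      using cut
    proof (cases rule: outer_node_and_cut_cases)
      case (arc x g)
      note a = arc_interior[OF arc(4)]
      have fr: "region D (VNode vs) \<inter> facet D k = {}" "region D (FNode fs) \<inter> facet D k = {}"
        using facet_region[OF k_in root_nodes(1)] facet_region[OF k_in root_nodes(2)] by blast+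
      have "z \<noteq> pathstart g" "z \<noteq> pathfinish g" using z arc(5,6) fr by blast+
      then have zg: "z \<in> g ` {0<..<1}" using z unfolding arc(8) a(4) by simp
      have gC: "g ` {0<..<1} \<subseteq> C \<inter> facet D k" using arc(7) unfolding arc(8) a(4) by blast
      have "turns z tau2 = turns c tau2"
      \<comment> \<open>The end of the cut in the face-node is left out, because \<open>tau2\<close>
        runs through that node.\<close>
      proof (rule turns_constant[OF tau2(1,2), of "region D (VNode vs) \<union> g ` {0..<1}"])
        show "connected (region D (VNode vs) \<union> g ` {0..<1})"
        proof (rule connected_Un[OF connected_region[OF root_nodes(1)] a(3)])
          have "pathstart g \<in> region D (VNode vs) \<inter> g ` {0..<1}" using arc(5) unfolding a(5) by simp
          then show "region D (VNode vs) \<inter> g ` {0..<1} \<noteq> {}" by blast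
        qed
        show "(region D (VNode vs) \<union> g ` {0..<1}) \<inter> path_image tau2 = {}"
          unfolding a(5) using d off gC arc(5) by blast
        show "z \<in> region D (VNode vs) \<union> g ` {0..<1}" using zg unfolding a(5) by simp
        show "c \<in> region D (VNode vs) \<union> g ` {0..<1}" using t by simp
      qed
      then show ?thesis using ct by simp
    next
      case (rays g g')
      have "g ` {0..} \<subseteq> C" "g' ` {0..} \<subseteq> C" using rays(5) by auto
      then have sub: "g ` {0<..} \<subseteq> C \<inter> facet D k" "g' ` {0<..} \<subseteq> C \<inter> facet D k"
        using ray_props(8)[OF rays(3)] ray_props(8)[OF rays(4)] by (auto simp: subset_iff image_subset_iff)
      have fr: "region D (VNode vs) \<inter> facet D k = {}" "region D (FNode fs) \<inter> facet D k = {}"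
        using facet_region[OF k_in root_nodes(1)] facet_region[OF k_in root_nodes(2)] by blast+
      have "z \<in> g ` {0..} \<or> z \<in> g' ` {0..}" using z rays(5) by blast
      then have "z \<in> g ` {0<..} \<or> z \<in> g' ` {0<..}"
      proof
        assume "z \<in> g ` {0..}"
        then obtain s where "z = g s" "s \<ge> 0" by auto
        moreover have "s \<noteq> 0" using calculation z fr ray_props(9)[OF rays(3)] by auto
        ultimately show ?thesis by auto
      next
        assume "z \<in> g' ` {0..}"
        then obtain s where "z = g' s" "s \<ge> 0" by auto
        moreover have "s \<noteq> 0" using calculation z fr ray_props(9)[OF rays(4)] by auto
        ultimately show ?thesis by auto
      qed
      moreover have "turns z tau2 = 0" if "z \<in> g ` {0<..}"
        by (rule turns_unbounded_eq_0[OF tau2(1,2) ray_props(4)[OF rays(3)] _ that ray_props(5)[OF rays(3)]])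
          (use sub off in blast)
      moreover have "turns z tau2 = 0" if "z \<in> g' ` {0<..}"
        by (rule turns_unbounded_eq_0[OF tau2(1,2) ray_props(4)[OF rays(4)] _ that ray_props(5)[OF rays(4)]])
          (use sub off in blast)
      ultimately show ?thesis using curves_zero_rays(2)[OF rays(2,3) \<open>g ` {0..} \<subseteq> C\<close>] by auto
    qed
    moreover have "z \<notin> path_image tau2" using z off by blast
    ultimately show ?thesis by blast
  qed
  show ?thesis using 1 2 zero by simp
qed

end

lemma disjoint_list_mono: "list_all2 (\<subseteq>) As Bs \<Longrightarrow> disjoint_list Bs \<Longrightarrow> disjoint_list As"
proof (induction rule: list_all2_induct)
  case (Cons A As B Bs)
  have "A \<inter> A' = {}" if A': "A' \<in> set As" for A'
  proof -
    obtain i where i: "i < length As" "A' = As ! i" using A' by (metis in_set_conv_nth)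
    then have "A' \<subseteq> Bs ! i" "Bs ! i \<in> set Bs"
      using Cons(2) list_all2_lengthD[OF Cons(2)] by (auto dest: list_all2_nthD)
    then show ?thesis using Cons(1) Cons.prems by fastforce
  qed
  then show ?case using Cons by simp
qed simp

lemma winding_number_eq_turns:
  assumes "path g" "pathfinish g = pathstart g" "z \<notin> path_image g"
  shows "winding_number g z = of_real (turns z g)"
  using integer_winding_number[OF assms] by (auto simp: turns_def elim!: Ints_cases)

context path_step_curves
begin

section \<open>The boundary of the quadrilateral and the height difference\<close>

definition "Pe = Pe1 +++ Pe2"
definition "P2 = reversepath p1 +++ p2"
definition "P3 = Pf1 +++ Pf2"

lemma corner_paths:
  "path Pe" "pathstart Pe = y0" "pathfinish Pe = x1" "path_image Pe \<subseteq> Ke"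
  "path P2" "pathstart P2 = y1" "pathfinish P2 = x2" "path_image P2 \<subseteq> Kw"
  "path P3" "pathstart P3 = y2" "pathfinish P3 = x3" "path_image P3 \<subseteq> Kf"
proof -
  have "path_image Pe = path_image Pe1 \<union> path_image Pe2" "path_image P2 = path_image p1 \<union> path_image p2"
    "path_image P3 = path_image Pf1 \<union> path_image Pf2"
    using paths Pf1 Pf2 by (simp_all add: Pe_def P2_def P3_def path_image_join)
  then show "path_image Pe \<subseteq> Ke" "path_image P2 \<subseteq> Kw" "path_image P3 \<subseteq> Kf"
    using paths(8,12,16,20) Pf1(4) Pf2(4) by simp_all
  show "path Pe" "pathstart Pe = y0" "pathfinish Pe = x1" "path P2" "pathstart P2 = y1" "pathfinish P2 = x2"
    "path P3" "pathstart P3 = y2" "pathfinish P3 = x3"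
    using paths Pf1 Pf2 by (simp_all add: Pe_def P2_def P3_def)
qed

lemma turns_corner_paths:
  "z \<notin> Ke \<Longrightarrow> turns z Pe = turns z Pe1 + turns z Pe2"
  "z \<notin> Kw \<Longrightarrow> turns z P2 = turns z p2 - turns z p1"
  "z \<notin> Kf \<Longrightarrow> turns z P3 = turns z Pf1 + turns z Pf2"
proof -
  show "turns z Pe = turns z Pe1 + turns z Pe2" if "z \<notin> Ke"
  proof -
    have "z \<notin> path_image Pe1" "z \<notin> path_image Pe2" using that paths(8,12) by blast+
    then show ?thesis using paths by (simp add: Pe_def turns_join)
  qed
  show "turns z P2 = turns z p2 - turns z p1" if "z \<notin> Kw"
  proof -
    have "z \<notin> path_image p1" "z \<notin> path_image p2" using that paths(16,20) by blast+
    then show ?thesis using paths by (simp add: P2_def turns_join turns_reversepath)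
  qed
  show "turns z P3 = turns z Pf1 + turns z Pf2" if "z \<notin> Kf"
  proof -
    have "z \<notin> path_image Pf1" "z \<notin> path_image Pf2" using that Pf1(4) Pf2(4) by blast+
    then show ?thesis using Pf1 Pf2 by (simp add: P3_def turns_join)
  qed
qed

lemma quadrilateral_disjoint:
  "disjoint_list [open_segment x0 y0, path_image Pe, open_segment x1 y1, path_image P2,
    open_segment x2 y2, path_image P3, open_segment x3 y3, path_image P0]"
proof (rule disjoint_list_mono)
  show "disjoint_list [S0, Ke, S1, Kw, Ah, Kf, Aa, Kv]" by (simp add: pieces_disjoint pieces_disjoint')
  show "list_all2 (\<subseteq>) [open_segment x0 y0, path_image Pe, open_segment x1 y1, path_image P2,
    open_segment x2 y2, path_image P3, open_segment x3 y3, path_image P0] [S0, Ke, S1, Kw, Ah, Kf, Aa, Kv]"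
    using open_segs corner_paths(4,8,12) paths(4) by (auto simp: E2_def E3_def)
qed

lemma facet_opp_off: "z \<in> facet D (opp G e) \<Longrightarrow> z \<notin> S1 \<union> Ke \<union> Kw \<union> Kf \<union> Kv \<union> S0 \<union> SF \<union> Aa \<union> Ah"
proof -
  assume z: "z \<in> facet D (opp G e)"
  have "facet D (opp G e) \<inter> S0 = {}" "facet D (opp G e) \<inter> S1 = {}" "facet D (opp G e) \<inter> SF = {}"
    using facet_side[OF local_darts(3)] local_links by (simp_all add: S0_def S1_def SF_def)
  moreover have "facet D (opp G e) \<inter> Ke = {}" "facet D (opp G e) \<inter> Kw = {}" "facet D (opp G e) \<inter> Kf = {}" "facet D (opp G e) \<inter> Kv = {}"
    using facet_region[OF local_darts(3)] local_nodes by (simp_all add: Ke_def Kw_def Kf_def Kv_def)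
  moreover have "facet D (opp G e) \<inter> Aa = {}" "facet D (opp G e) \<inter> Ah = {}"
    unfolding Aa_def Ah_def using facets_disjoint[OF local_darts(3) local_darts(1)] facets_disjoint[OF local_darts(3) local_darts(2)] L_neq h_neq_opp
    by metis+
  ultimately have "facet D (opp G e) \<inter> (S1 \<union> Ke \<union> Kw \<union> Kf \<union> Kv \<union> S0 \<union> SF \<union> Aa \<union> Ah) = {}"
    by (simp only: Int_Un_distrib Un_empty_left)
  then show ?thesis using z by blast
qed

text \<open>The closed curve around the quadrilateral is homologous to \<open>tau + tau2 + lam\<close>.\<close>

lemma quadrilateral_winding:
  assumes z: "z \<notin> Ke" "z \<notin> Kw" "z \<notin> Kf" "z \<notin> Kv" "z \<notin> S0" "z \<notin> S1" "z \<notin> SF" "z \<notin> E2" "z \<notin> E3"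
    and off: "z \<notin> path_image tau" "z \<notin> path_image tau2" "z \<notin> path_image lam"
  shows "turns z P2 + turns z (linepath x2 y2) + turns z P3 + turns z (linepath x3 y3) + turns z P0
      + turns z (linepath x0 y0) + turns z Pe + turns z (linepath x1 y1) = turns z tau + turns z tau2 + turns z lam"
proof -
  have s: "z \<notin> closed_segment x2 y2" "z \<notin> closed_segment x1 y1" "z \<notin> closed_segment tF bF"
    using halves(2,3,5) z by blast+
  show ?thesis
    unfolding turns_tau[OF off(1)] turns_tau2[OF off(2)] turns_lam[OF off(3)] turns_corner_paths(1)[OF z(1)]
      turns_corner_paths(2)[OF z(2)] turns_corner_paths(3)[OF z(3)]
      turns_linepath_halves[OF s(1)] turns_linepath_halves[OF s(2)] turns_linepath_rev[OF s(3)]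
    by (simp add: m1_def m2_def)
qed

lemma turns_linked_quadrilateral:
  assumes z: "z \<notin> Ke" "z \<notin> Kw" "z \<notin> Kf" "z \<notin> Kv" "z \<notin> S0" "z \<notin> E2" "z \<notin> E3"
  shows "turns z (join_all [P2, linepath x2 y2, P3, linepath x3 y3, P0, linepath x0 y0, Pe]) =
    turns z P2 + turns z (linepath x2 y2) + turns z P3 + turns z (linepath x3 y3) + turns z P0
      + turns z (linepath x0 y0) + turns z Pe"
    "z \<notin> path_image (join_all [P2, linepath x2 y2, P3, linepath x3 y3, P0, linepath x0 y0, Pe])"
proof -
  have s: "z \<notin> closed_segment x2 y2" "z \<notin> closed_segment x3 y3" "z \<notin> closed_segment x0 y0"
    using halves(1,3,4) z by blast+
  have p: "z \<notin> path_image P2" "z \<notin> path_image P3" "z \<notin> path_image P0" "z \<notin> path_image Pe"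
    using z corner_paths(4,8,12) paths(4) by blast+
  have l: "linked [P2, linepath x2 y2, P3, linepath x3 y3, P0, linepath x0 y0, Pe]"
    using corner_paths paths by simp
  have n: "z \<notin> path_image g" if "g \<in> set [P2, linepath x2 y2, P3, linepath x3 y3, P0, linepath x0 y0, Pe]" for g
  proof -
    have "path_image g \<in> set [path_image P2, closed_segment x2 y2, path_image P3, closed_segment x3 y3, path_image P0, closed_segment x0 y0, path_image Pe]"
      using that by (metis (no_types, lifting) list.set_intros(1) list.set_intros(2) path_image_linepath set_ConsD empty_iff empty_set)
    then show ?thesis using s p by (simp only: list.set insert_iff empty_iff) metis
  qed
  show "turns z (join_all [P2, linepath x2 y2, P3, linepath x3 y3, P0, linepath x0 y0, Pe]) =
    turns z P2 + turns z (linepath x2 y2) + turns z P3 + turns z (linepath x3 y3) + turns z P0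
      + turns z (linepath x0 y0) + turns z Pe"
    using turns_join_all[OF l n] by simp
  show "z \<notin> path_image (join_all [P2, linepath x2 y2, P3, linepath x3 y3, P0, linepath x0 y0, Pe])"
    unfolding path_image_join_all[OF l] using n by blast
qed

context
  assumes zero: "turns mL tau + turns mL tau2 = 0" "turns mL lam = 0"
begin

text \<open>Right of the side from \<open>x1\<close> to \<open>y1\<close> is the facet of
  \<open>opp G e\<close>, which is outside: the three curves together do not wind around it. This
  supplies the orientation for the turning tangents.\<close>

lemma right_side:
  "turns m1 (join_all [P2, linepath x2 y2, P3, linepath x3 y3, P0, linepath x0 y0, Pe]) = 1 / 2"
proof -
  define W where "W = join_all [P2, linepath x2 y2, P3, linepath x3 y3, P0, linepath x0 y0, Pe]"
  have l: "linked [P2, linepath x2 y2, P3, linepath x3 y3, P0, linepath x0 y0, Pe]"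
    using corner_paths paths by simp
  have W: "path W" "pathstart W = y1" "pathfinish W = x1"
    using join_all_linked[OF l] corner_paths by (simp_all add: W_def)
  have "turns (midpoint x1 y1) W = 1 / 2"
  proof (rule turns_right_side[OF W neq(2)])
    show "path_image W \<inter> open_segment x1 y1 = {}"
    proof -
      have "z \<notin> path_image W" if z: "z \<in> S1" for z
      proof -
        have "z \<notin> Ke" "z \<notin> Kw" "z \<notin> Kf" "z \<notin> Kv" "z \<notin> S0" "z \<notin> Aa" "z \<notin> Ah"
          using z pieces_disjoint by (metis disjoint_notin_left disjoint_notin_right)+
        then show ?thesis unfolding W_def using open_segs(5,6) by (intro turns_linked_quadrilateral(2)) auto
      qed
      then show ?thesis unfolding open_segs by blast
    qed
    have ol: "on_left (facet D (opp G e)) y1 x1"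
      using left_of_links(1)[OF local_darts(3)] by (simp add: y1_def x1_def)
    have "\<forall>\<^sub>F t in at_right 0. linepath y1 x1 (1/2) + of_real t * (\<i> * (x1 - y1)) \<in> facet D (opp G e)"
      using ol[unfolded on_left_def, THEN bspec, of "1/2"] by simp
    then show "\<forall>\<^sub>F t in at_right 0. turns (midpoint x1 y1 - of_real t * (\<i> * (y1 - x1))) (W +++ linepath x1 y1) = 0"
    proof (rule eventually_mono)
      fix t assume t: "linepath y1 x1 (1/2) + of_real t * (\<i> * (x1 - y1)) \<in> facet D (opp G e)"
      define z where "z = midpoint x1 y1 - of_real t * (\<i> * (y1 - x1))"
      have "linepath y1 x1 (1/2) = midpoint x1 y1"
        by (simp add: linepath_def midpoint_def scaleR_right_distrib add.commute)
      then have z: "z \<in> facet D (opp G e)" using t by (simp add: z_def algebra_simps)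
      note off = facet_opp_off[OF z]
      have 1: "z \<notin> path_image tau \<and> turns z tau = turns mL tau"
        using tau_const_facet[OF local_darts(3) L_neq(2) z] .
      have 2: "z \<notin> path_image tau2 \<and> turns z tau2 = turns mL tau2"
        using tau2_const_facet[OF local_darts(3) h_neq_opp[symmetric] z] .
      have 3: "z \<notin> path_image lam \<and> turns z lam = turns mL lam"
        using lam_const_facet[OF local_darts(3) h_neq_opp[symmetric] z] .
      have o: "z \<notin> Ke" "z \<notin> Kw" "z \<notin> Kf" "z \<notin> Kv" "z \<notin> S0" "z \<notin> S1" "z \<notin> SF" "z \<notin> E2" "z \<notin> E3"
        using off open_segs(5,6) by blast+
      have s: "z \<notin> closed_segment x1 y1" using halves(2) o by blast
      have "turns z (W +++ linepath x1 y1) = turns z W + turns z (linepath x1 y1)"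
        using turns_linked_quadrilateral(2)[OF o(1-5) o(8,9)] s W by (simp add: turns_join W_def)
      also have "\<dots> = turns z tau + turns z tau2 + turns z lam"
        using quadrilateral_winding[OF o] 1 2 3 turns_linked_quadrilateral(1)[OF o(1-5) o(8,9)] by (simp add: W_def)
      also have "\<dots> = 0" using 1 2 3 zero by simp
      finally show "turns (midpoint x1 y1 - of_real t * (\<i> * (y1 - x1))) (W +++ linepath x1 y1) = 0" by (simp add: z_def)
    qed
  qed
  then show ?thesis by (simp add: W_def m1_def)
qed

lemmas quadrilateral_facts = quadrilateral_turns[OF paths(1-3) corner_paths(1-3) corner_paths(5-7) corner_paths(9-11)
    neq(1-4) quadrilateral_disjoint right_side[unfolded m1_def], folded m0_def m1_def m2_def m3_def]

text \<open>Both sides measure one rotation about the head, from \<open>db\<close> to the second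
  half of the edge, whose free end follows the rest of the boundary. The left-hand side comes from
  the quadrilateral, the right-hand side from comparison with \<open>VLink L\<close>, which this
  rotation does not encircle.\<close>

lemma vertex_angle:
  "1 / 2 - corner_turn m1 y1 P2 x2 m2 =
    corner_turn m2 x2 (reversepath p2) c mL - corner_turn m1 y1 (reversepath p1) c mL"
proof -
  define ps where "ps = [linepath m2 y2, P3, linepath x3 y3, P0, linepath x0 y0, Pe, linepath x1 m1]"
  define q where "q = join_all ps"
  have l: "linked ps" using corner_paths paths by (simp add: ps_def)
  have q: "path q" "pathstart q = m2" "pathfinish q = m1"
    using join_all_linked[OF l] by (simp_all add: q_def ps_def)
  have iq: "path_image q \<subseteq> Ah \<union> Kf \<union> Aa \<union> Kv \<union> S0 \<union> Ke \<union> S1"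
  proof -
    have "path_image q = closed_segment m2 y2 \<union> path_image P3 \<union> closed_segment x3 y3 \<union> path_image P0 \<union> closed_segment x0 y0 \<union> path_image Pe \<union> closed_segment x1 m1"
      unfolding q_def path_image_join_all[OF l] by (simp add: ps_def Un_assoc)
    then show ?thesis
      using halves(1,4,6,9) open_segs(5,6) corner_paths(4,12) paths(4) by blast
  qed
  have "Kw \<inter> (Ah \<union> Kf \<union> Aa \<union> Kv \<union> S0 \<union> Ke \<union> S1) = {}" "SL \<inter> (Ah \<union> Kf \<union> Aa \<union> Kv \<union> S0 \<union> Ke \<union> S1) = {}"
    by (simp_all only: Int_Un_distrib pieces_disjoint pieces_disjoint' Un_empty_left)
  then have off: "Kw \<inter> path_image q = {}" "SL \<inter> path_image q = {}" using iq by blast+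
  have mLo: "mL \<notin> Ke" "mL \<notin> Kw" "mL \<notin> Kf" "mL \<notin> Kv" "mL \<notin> S0" "mL \<notin> S1" "mL \<notin> SF" "mL \<notin> Aa" "mL \<notin> Ah"
    using midpoints_in(5) pieces_disjoint by (metis disjoint_notin_left disjoint_notin_right)+
  then have mLE: "mL \<notin> E2" "mL \<notin> E3" using open_segs(5,6) by blast+
  have mLc: "mL \<notin> path_image tau" "mL \<notin> path_image tau2" "mL \<notin> path_image lam"
    using tau_const_link[OF local_links(4), of mL] tau2_const_link[OF local_links(4), of mL] lam_const_link[OF local_links(4), of mL] midpoints_in(5) links_neq
    unfolding SL_def by metis+
  have mLs: "mL \<notin> closed_segment x2 m2" "mL \<notin> closed_segment m2 y2" "mL \<notin> closed_segment x1 m1" "mL \<notin> closed_segment m1 y1"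
    "mL \<notin> closed_segment x1 y1" "mL \<notin> closed_segment x2 y2"
    using halves(2,3,6-9) mLo mLE by blast+
  have n: "mL \<notin> path_image g" if "g \<in> set ps" for g
    using that off(2) midpoints_in(5) unfolding q_def path_image_join_all[OF l] by blast
  have "turns mL q = turns mL (linepath m2 y2) + turns mL P3 + turns mL (linepath x3 y3) + turns mL P0 + turns mL (linepath x0 y0)
      + turns mL Pe + turns mL (linepath x1 m1)"
    using turns_join_all[OF l n] unfolding q_def ps_def by simp
  moreover have "turns mL P2 + turns mL (linepath x2 y2) + turns mL P3 + turns mL (linepath x3 y3) + turns mL P0
      + turns mL (linepath x0 y0) + turns mL Pe + turns mL (linepath x1 y1) = 0"
    using quadrilateral_winding[OF mLo(1-7) mLE mLc] zero by simp
  moreover have "turns mL (linepath x1 y1) = turns mL (linepath x1 m1) + turns mL (linepath m1 y1)"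
    "turns mL (linepath x2 y2) = turns mL (linepath x2 m2) + turns mL (linepath m2 y2)"
    using turns_linepath_halves mLs by (simp_all add: m1_def m2_def)
  moreover have "turns mL P2 = turns mL p2 - turns mL p1" using turns_corner_paths(2)[OF mLo(2)] .
  ultimately have enc: "turns mL (linepath x2 m2) + turns mL q + turns mL (linepath m1 y1) - turns mL p1 + turns mL p2 = 0"
    by simp
  have "turns y1 q + turns m2 (reversepath p2 +++ p1) =
    corner_turn m2 x2 (reversepath p2) c mL - corner_turn m1 y1 (reversepath p1) c mL"
  proof (rule turns_rotation_between[OF paths(17-19) paths(13-15) q])
    show "path_image p2 \<inter> path_image q = {}" "path_image p1 \<inter> path_image q = {}"
      using off(1) paths(16,20) by blast+
    show "closed_segment c mL \<inter> path_image q = {}" using halves(12) off by blast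
    show "mL \<notin> path_image p2" "mL \<notin> path_image p1" using paths(16,20) mLo(2) by blast+
    show "mL \<notin> closed_segment x2 m2" "mL \<notin> closed_segment y1 m1"
      using mLs by (simp_all add: closed_segment_commute)
  qed (rule enc)
  moreover have "turns y1 q + turns m2 (reversepath P2) = 1 / 2 - corner_turn m1 y1 P2 x2 m2"
    using quadrilateral_facts(2) by (simp add: q_def ps_def)
  moreover have "reversepath P2 = reversepath p2 +++ p1"
    using paths by (simp add: P2_def reversepath_joinpaths)
  ultimately show ?thesis by simp
qed

end

text \<open>The route of the free end must miss the cut at the face-node, and the swept boundary
  must not encircle it. The second fact is stated with a closure because the cut ends inside the
  face-node, where the curves run too. At a face other than \<open>fs\<close> the cut consists of
  matched links, which belong to edges other than that of \<open>e\<close>.\<close>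

lemma face_cut:
  assumes zero: "turns mL tau + turns mL tau2 = 0"
    and M: "\<And>x. FLink x \<in> M \<Longrightarrow> x \<in> darts G \<and> x \<noteq> e \<and> x \<noteq> opp G e"
  defines "B \<equiv> cut_at G D vs fs C M (FNode (face G e))"
  shows "B \<inter> (E3 \<union> Kv \<union> S0 \<union> Ke \<union> S1 \<union> (Ah - C)) = {}"
    "B \<subseteq> closure {z. z \<notin> path_image tau \<and> z \<notin> path_image tau2 \<and> turns z tau + turns z tau2 = 0}"
proof -
  let ?Z = "{z. z \<notin> path_image tau \<and> z \<notin> path_image tau2 \<and> turns z tau + turns z tau2 = 0}"
  have "B \<inter> (E3 \<union> Kv \<union> S0 \<union> Ke \<union> S1 \<union> (Ah - C)) = {} \<and> B \<subseteq> closure ?Z"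
  proof (cases "face G e = fs")
    case True
    then have B: "B = C" by (simp add: B_def cut_at_def)
    have "C \<inter> Kv = {}" "C \<inter> Ke = {}"
      unfolding Kv_def Ke_def using cut_disjoint(1)[OF local_nodes(1)] cut_disjoint(1)[OF local_nodes(2)] not_root by simp_all
    moreover have "C \<inter> S0 = {}" "C \<inter> S1 = {}"
      unfolding S0_def S1_def using cut_disjoint(2)[OF local_links(1)] cut_disjoint(2)[OF local_links(2)] by simp_all
    moreover have "C \<inter> E3 = {}" using open_segs(6) by blast
    moreover have "C \<inter> (Ah - C) = {}" by blast
    ultimately have "C \<inter> (E3 \<union> Kv \<union> S0 \<union> Ke \<union> S1 \<union> (Ah - C)) = {}"
      by (simp only: Int_Un_distrib Un_empty_left)
    moreover have "C \<inter> facet D k \<subseteq> ?Z"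
    proof
      fix z assume "z \<in> C \<inter> facet D k"
      from curves_zero_cut[OF zero this] show "z \<in> ?Z" by simp
    qed
    then have "closure (C \<inter> facet D k) \<subseteq> closure ?Z" by (rule closure_mono)
    then have "C \<subseteq> closure ?Z" by (rule order_trans[OF cut_closure])
    ultimately show ?thesis unfolding B by (rule conjI)
  next
    case False
    have seg: "seg D l \<inter> (E3 \<union> Kv \<union> S0 \<union> Ke \<union> S1 \<union> (Ah - C)) = {} \<and> seg D l \<subseteq> closure ?Z"
      if l: "l \<in> M" "FNode (face G e) \<in> ends G l" for l
    proof -
      obtain x where x: "l = FLink x" "face G x = face G e" using l(2) by (cases l) (auto simp: ends_def)
      have xd: "x \<in> darts G" "x \<noteq> e" "x \<noteq> opp G e" using M l(1) x(1) by auto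
      have lG: "l \<in> links G" using xd x by (simp add: links_iff)
      have ex: "edge G x \<noteq> edge G e" using edge_eqD[of e x] e xd by metis
      have tb: "tip D l \<in> Kf" "base D l \<in> region D (ENode (edge G x))"
        using tip_in[OF lG] base_in[OF lG] x by (simp_all add: Kf_def)
      have ed: "ENode (edge G x) \<in> nodes G" using nodes_intros(2)[OF xd(1)] .
      have "region D (ENode (edge G x)) \<inter> Kv = {}" "region D (ENode (edge G x)) \<inter> Ke = {}"
        unfolding Kv_def Ke_def using regions_disjoint[OF ed local_nodes(1)] regions_disjoint[OF ed local_nodes(2)] ex by simp_all
      moreover have "region D (ENode (edge G x)) \<inter> S0 = {}" "region D (ENode (edge G x)) \<inter> S1 = {}"
        unfolding S0_def S1_def using side_region[OF local_links(1) ed] side_region[OF local_links(2) ed] by (simp_all add: Int_commute)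
      moreover have "region D (ENode (edge G x)) \<inter> Aa = {}" "region D (ENode (edge G x)) \<inter> Ah = {}"
        unfolding Aa_def Ah_def using facet_region[OF local_darts(1) ed] facet_region[OF local_darts(2) ed] by (simp_all add: Int_commute)
      ultimately have b: "region D (ENode (edge G x)) \<inter> (Aa \<union> Kv \<union> S0 \<union> Ke \<union> S1 \<union> Ah) = {}"
        by (simp only: Int_Un_distrib Un_empty_left)
      have t: "Kf \<inter> (Aa \<union> Kv \<union> S0 \<union> Ke \<union> S1 \<union> Ah) = {}"
        by (simp only: Int_Un_distrib pieces_disjoint pieces_disjoint' Un_empty_left)
      have "side l \<inter> Kv = {}" "side l \<inter> Ke = {}"
        unfolding Kv_def Ke_def using side_region[OF lG local_nodes(1)] side_region[OF lG local_nodes(2)] by simp_all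
      moreover have "side l \<inter> S0 = {}" "side l \<inter> S1 = {}"
        unfolding S0_def S1_def using sides_disjoint[OF lG local_links(1)] sides_disjoint[OF lG local_links(2)] x by simp_all
      moreover have "side l \<inter> Aa = {}" "side l \<inter> Ah = {}"
        unfolding Aa_def Ah_def using facet_side[OF local_darts(1) lG] facet_side[OF local_darts(2) lG] by (simp_all add: Int_commute)
      ultimately have s: "side l \<inter> (Aa \<union> Kv \<union> S0 \<union> Ke \<union> S1 \<union> Ah) = {}"
        by (simp only: Int_Un_distrib Un_empty_left)
      have "seg D l \<inter> (Aa \<union> Kv \<union> S0 \<union> Ke \<union> S1 \<union> Ah) = {}"
        unfolding seg_eq using s t b tb by blast
      moreover have "E3 \<subseteq> Aa" using open_segs(6) by blast
      moreover have "side l \<subseteq> ?Z"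
        using tau_const_link[OF lG] tau2_const_link[OF lG] x xd zero by auto
      then have "closure (side l) \<subseteq> closure ?Z" by (rule closure_mono)
      then have "seg D l \<subseteq> closure ?Z"
        using tip_neq_base[OF lG] by (simp add: seg_def side_def closure_open_segment)
      ultimately show ?thesis by blast
    qed
    have B: "B = \<Union> (seg D ` {l \<in> M. FNode (face G e) \<in> ends G l})" using False by (simp add: B_def cut_at_def)
    show ?thesis unfolding B using seg by blast
  qed
  then show "B \<inter> (E3 \<union> Kv \<union> S0 \<union> Ke \<union> S1 \<union> (Ah - C)) = {}" "B \<subseteq> closure ?Z" by blast+
qed

text \<open>A rotation from \<open>da\<close> to \<open>db\<close> about the face-node is exhibited:
  the hinge moves back along \<open>P3\<close>, the free end passes the tail and the edge-node and
  then takes \<open>Z\<close>. The corner turn at the face-node is then eliminated by the sum of the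
  four corner turns, that at the head by \<open>vertex_angle\<close>.\<close>

lemma height_step_curves:
  assumes zero: "turns mL tau + turns mL tau2 = 0" "turns mL lam = 0"
    and ht: "height_function G D vs fs C M ht"
    and M: "\<And>x. FLink x \<in> M \<Longrightarrow> x \<in> darts G \<and> x \<noteq> e \<and> x \<noteq> opp G e"
  shows "ht db - ht da = 2 * pi * (corner_turn m0 y0 Pe x1 m1 + corner_turn m1 y1 (reversepath p1) c mL
    + corner_turn m3 y3 P0 x0 m0 - corner_turn m2 x2 (reversepath p2) c mL)"
proof -
  define B where "B = cut_at G D vs fs C M (FNode (face G e))"
  define ps where "ps = [linepath m3 y3, P0, linepath x0 y0, Pe, linepath x1 m1, Z]"
  define q where "q = join_all ps"
  note B = face_cut[OF zero(1), of M, folded B_def, OF M]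
  have l: "linked ps" using corner_paths paths Z by (simp add: ps_def)
  have q: "path q" "pathstart q = m3" "pathfinish q = m2"
    using join_all_linked[OF l] Z by (simp_all add: q_def ps_def)
  have iq: "path_image q \<subseteq> E3 \<union> Kv \<union> S0 \<union> Ke \<union> S1 \<union> (Ah - C)"
  proof -
    have "path_image q = closed_segment m3 y3 \<union> path_image P0 \<union> closed_segment x0 y0 \<union> path_image Pe \<union> closed_segment x1 m1 \<union> path_image Z"
      unfolding q_def path_image_join_all[OF l] by (simp add: ps_def Un_assoc)
    then show ?thesis
      using halves(1,6,11) corner_paths(4) paths(4) Z(4) midpoints_in(2) by blast
  qed
  have qB: "path_image q \<inter> B = {}" using iq B(1) by blast
  have "Kf \<inter> (Aa \<union> Kv \<union> S0 \<union> Ke \<union> S1 \<union> Ah) = {}"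
    by (simp only: Int_Un_distrib pieces_disjoint pieces_disjoint' Un_empty_left)
  then have qK: "path_image q \<inter> Kf = {}" using iq open_segs(6) by blast
  define p where "p = reversepath P3"
  have p: "path p" "pathstart p = x3" "pathfinish p = y2" "path_image p \<subseteq> Kf" "reversepath p = P3"
    using corner_paths by (simp_all add: p_def)
  have pq: "path_image p \<inter> path_image q = {}" using p(4) qK by blast
  define cs where "cs = [linepath x3 m3, q, linepath m2 y2, P3]"
  define c' where "c' = join_all cs"
  have lc: "linked cs" using q corner_paths by (simp add: cs_def)
  have c': "path c'" "pathfinish c' = pathstart c'"
    using join_all_linked[OF lc] corner_paths by (simp_all add: c'_def cs_def)
  \<comment> \<open>The swept boundary is \<open>tau\<close> plus \<open>tau2\<close>; the two
    passages along \<open>FLink e\<close> cancel.\<close>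
  have c'_turns: "turns z c' = turns z tau + turns z tau2"
    if z: "z \<notin> path_image c'" "z \<notin> path_image tau" "z \<notin> path_image tau2" for z
  proof -
    have n: "z \<notin> path_image g" if "g \<in> set cs" for g
      using that z(1) unfolding c'_def path_image_join_all[OF lc] by blast
    have "q \<in> set cs" "P3 \<in> set cs" by (simp_all add: cs_def)
    then have zq: "z \<notin> path_image q" and zP3: "z \<notin> path_image P3" using n by blast+
    have n': "z \<notin> path_image g" if "g \<in> set ps" for g
      using that zq unfolding q_def path_image_join_all[OF l] by blast
    have zPe: "z \<notin> path_image Pe" using n'[of Pe] by (simp add: ps_def)
    have e1: "turns z c' = turns z (linepath x3 m3) + turns z q + turns z (linepath m2 y2) + turns z P3"
      using turns_join_all[OF lc n] unfolding c'_def cs_def by simp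
    have e2: "turns z q = turns z (linepath m3 y3) + turns z P0 + turns z (linepath x0 y0) + turns z Pe + turns z (linepath x1 m1) + turns z Z"
      using turns_join_all[OF l n'] unfolding q_def ps_def by simp
    have e3: "turns z Pe = turns z Pe1 + turns z Pe2" "turns z P3 = turns z Pf1 + turns z Pf2"
      using zPe zP3 paths Pf1 Pf2 by (simp_all add: Pe_def P3_def turns_join path_image_join)
    have s1: "z \<notin> closed_segment x3 y3"
    proof -
      have "linepath x3 y3 \<in> set tau_pieces" by (simp add: tau_pieces_def)
      then have "z \<notin> path_image (linepath x3 y3)"
        using z(2) unfolding tau_def path_image_join_all[OF linked_pieces(1)] by blast
      then show ?thesis by simp
    qed
    have s2: "z \<notin> closed_segment tF bF"
    proof -
      have "linepath tF bF \<in> set tau2_pieces" by (simp add: tau2_pieces_def)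
      then have "z \<notin> path_image (linepath tF bF)"
        using z(3) unfolding tau2_def path_image_join_all[OF linked_pieces(2)] by blast
      then show ?thesis by simp
    qed
    show ?thesis
      unfolding turns_tau[OF z(2)] turns_tau2[OF z(3)] e1 e2 e3 turns_linepath_halves[OF s1] turns_linepath_rev[OF s2]
      by (simp add: m3_def)
  qed
  define th where "th = 2 * pi * turns 0 (\<lambda>t. q t - p t)"
  have arms: "dst_arm da = (x3, m3)" "dst_arm db = (y2, m2)"
    by (simp_all add: dst_arm_def diag_mid_def x3_def m3_def y3_def y2_def m2_def x2_def midpoint_sym)
  have rot: "rotation (region D (FNode (face G e))) B (dst_arm da) (dst_arm db) th"
    unfolding rotation_def rotation_along_def arms fst_conv snd_conv Kf_def[symmetric]
  proof (rule exI[of _ q], rule exI[of _ p], intro conjI)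
    show "q ` {0<..<1} \<subseteq> - (Kf \<union> B)"
    proof -
      have "q ` {0<..<1} \<subseteq> path_image q" by (auto simp: path_image_def)
      then show ?thesis using qB qK by blast
    qed
    show "let c = linepath x3 m3 +++ q +++ linepath m2 y2 +++ reversepath p in \<forall>z\<in>B - path_image c. winding_number c z = 0"
    proof -
      have cc: "linepath x3 m3 +++ q +++ linepath m2 y2 +++ reversepath p = c'" by (simp add: c'_def cs_def p(5))
      have "winding_number c' z = 0" if z: "z \<in> B" "z \<notin> path_image c'" for z
      proof -
        have "turns z c' = 0"
        proof (rule turns_closure[OF c' z(2)])
          show "z \<in> closure {z. z \<notin> path_image tau \<and> z \<notin> path_image tau2 \<and> turns z tau + turns z tau2 = 0}"
            using B(2) z(1) by blast
        qed (use c'_turns in auto)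
        then show ?thesis using winding_number_eq_turns[OF c' z(2)] by simp
      qed
      then show ?thesis unfolding cc Let_def by blast
    qed
    show "th = 2 * pi * Re (winding_number (\<lambda>t. q t - p t) 0)" by (simp add: th_def turns_def)
  qed (use p q in simp_all)
  have fc: "face G (corner da) = face G (corner db)" "face G (corner da) = face G e"
    using face_h by (simp_all add: da(2) db(2) h_def)
  have "ht db = ht da + th"
    using ht[unfolded height_function_def, THEN bspec, OF da(1), THEN bspec, OF db(1), THEN conjunct2, THEN mp, OF fc(1)] rot
    unfolding Let_def fc(2) B_def by blast
  moreover have "th / (2 * pi) = turns m3 p + turns y2 q"
    using turns_diff'[OF p(1) q(1) pq] q p by (simp add: th_def)
  moreover have "turns m3 p = turns m3 (reversepath P3)" by (simp add: p_def)
  \<comment> \<open>The free end takes the shortcut \<open>Z\<close>, whereas the quadrilateral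
    identity goes around the head. The difference is \<open>lam\<close>, which does not wind around
    the face-node.\<close>
  moreover have "turns y2 q + turns y2 lam = turns y2 (join_all [linepath m3 y3, P0, linepath x0 y0, Pe, linepath x1 y1, P2, linepath x2 m2])"
  proof -
    define rs where "rs = [linepath m3 y3, P0, linepath x0 y0, Pe, linepath x1 y1, P2, linepath x2 m2]"
    have lr: "linked rs" using corner_paths paths by (simp add: rs_def)
    have y2o: "y2 \<notin> Ke" "y2 \<notin> Kw" "y2 \<notin> Kv" "y2 \<notin> S0" "y2 \<notin> S1" "y2 \<notin> Aa" "y2 \<notin> Ah"
      using points(9) pieces_disjoint by (metis disjoint_notin_left disjoint_notin_right)+
    have y2E: "y2 \<notin> E2" "y2 \<notin> E3" using y2o open_segs(5,6) by blast+
    have lam_off: "y2 \<notin> path_image lam" using lam(3) y2o by blast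
    have q_off: "y2 \<notin> path_image q" using qK points(9) by blast
    have nq: "y2 \<notin> path_image g" if "g \<in> set ps" for g
      using that q_off unfolding q_def path_image_join_all[OF l] by blast
    have ns: "y2 \<notin> closed_segment x1 y1" "y2 \<notin> path_image P2" "y2 \<notin> closed_segment x2 m2"
      using halves(2,8) y2o y2E corner_paths(8) by blast+
    have nr: "y2 \<notin> path_image g" if "g \<in> set rs" for g
    proof -
      have "g \<in> set ps \<or> g = linepath x1 y1 \<or> g = P2 \<or> g = linepath x2 m2"
        using that unfolding rs_def ps_def by (simp only: list.set insert_iff empty_iff) blast
      then show ?thesis using nq ns by (metis path_image_linepath)
    qed
    have eq: "turns y2 q = turns y2 (linepath m3 y3) + turns y2 P0 + turns y2 (linepath x0 y0) + turns y2 Pe + turns y2 (linepath x1 m1) + turns y2 Z"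
      using turns_join_all[OF l nq] unfolding q_def ps_def by simp
    have er: "turns y2 (join_all rs) = turns y2 (linepath m3 y3) + turns y2 P0 + turns y2 (linepath x0 y0) + turns y2 Pe + turns y2 (linepath x1 y1) + turns y2 P2 + turns y2 (linepath x2 m2)"
      using turns_join_all[OF lr nr] unfolding rs_def by simp
    show ?thesis
      unfolding rs_def[symmetric] eq er turns_lam[OF lam_off] turns_corner_paths(2)[OF y2o(2)] turns_linepath_halves[OF ns(1)]
      by (simp add: m1_def)
  qed
  moreover have "turns y2 lam = 0"
  proof -
    have d: "region D (outer_end G (FLink e)) \<inter> path_image lam = {}"
      using nodes_off_curves(2)[OF local_nodes(4)] by simp
    have "turns y2 lam = turns mL lam"
      by (rule turns_on_region[OF local_links(3) lam(1,2) d])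
        (use lam_const_link[OF local_links(3)] points(9) in \<open>simp_all add: Kf_def\<close>)
    then show ?thesis using zero(2) by simp
  qed
  ultimately have "(ht db - ht da) / (2 * pi) = 1 / 2 - corner_turn m2 y2 P3 x3 m3"
    using quadrilateral_facts(3)[OF zero] by simp
  then have "(ht db - ht da) / (2 * pi) = corner_turn m0 y0 Pe x1 m1 + corner_turn m1 y1 (reversepath p1) c mL
    + corner_turn m3 y3 P0 x0 m0 - corner_turn m2 x2 (reversepath p2) c mL"
    using quadrilateral_facts(1)[OF zero] vertex_angle[OF zero] by simp
  then show ?thesis by (simp add: field_simps)
qed

end

context path_step
begin

text \<open>Removing the cut may split the facet; \<open>diagonal_on_left\<close> says that the
  points just left of the link are in the same component as the diagonal, so they can be joined to
  it without crossing the cut.\<close>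

lemma left_path:
  assumes left: "diagonal_on_left D C db x1 y1"
  obtains Z where "path Z" "pathstart Z = m1" "pathfinish Z = m2" "path_image Z \<subseteq> insert m1 (Ah - C)"
proof -
  define W where "W = connected_component_set (Ah - C) m2"
  have dm: "diag_mid db = m2" by (simp add: diag_mid_def m2_def x2_def y2_def)
  have W: "on_left W x1 y1"
    using left unfolding diagonal_on_left_def db(2) h_def[symmetric] dm Ah_def[symmetric] W_def .
  have m2: "m2 \<in> Ah - C" using midpoints_in(3) open_segs(5) by blast
  have op: "open (Ah - C)" unfolding Ah_def using facet_open[OF local_darts(2)] closed_cut by (rule open_Diff)
  have pc: "path_connected W"
    unfolding W_def by (rule connected_open_path_connected[OF open_connected_component[OF op]]) simp
  have WA: "W \<subseteq> Ah - C" unfolding W_def by (rule connected_component_subset)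
  have m2W: "m2 \<in> W" using m2 by (simp add: W_def connected_component_refl)
  have "linepath x1 y1 (1/2) = m1"
    by (simp add: linepath_def m1_def midpoint_def scaleR_right_distrib)
  then have "\<forall>\<^sub>F t in at_right 0. m1 + of_real t * (\<i> * (y1 - x1)) \<in> W"
    using W[unfolded on_left_def, THEN bspec, of "1/2"] by simp
  then obtain d where d: "d > 0" "\<And>t. 0 < t \<Longrightarrow> t < d \<Longrightarrow> m1 + of_real t * (\<i> * (y1 - x1)) \<in> W"
    unfolding eventually_at_right_field by auto
  define n where "n = m1 + of_real (d / 2) * (\<i> * (y1 - x1))"
  have nW: "n \<in> W" unfolding n_def by (rule d(2)) (use d(1) in simp_all)
  have seg: "closed_segment m1 n \<subseteq> insert m1 W"
  proof
    fix z assume "z \<in> closed_segment m1 n"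
    then obtain u where u: "0 \<le> u" "u \<le> 1" "z = (1 - u) *\<^sub>R m1 + u *\<^sub>R n" by (auto simp: in_segment)
    have z: "z = m1 + of_real (u * (d / 2)) * (\<i> * (y1 - x1))"
      unfolding u(3) n_def by (simp add: scaleR_conv_of_real algebra_simps)
    show "z \<in> insert m1 W"
    proof (cases "u = 0")
      case False
      then have "0 < u * (d / 2)" "u * (d / 2) < d" using u d(1) by (auto simp: mult_le_one intro: le_less_trans[of _ "d / 2"])
      then show ?thesis unfolding z using d(2) by blast
    qed (simp add: z)
  qed
  obtain g where g: "path g" "path_image g \<subseteq> W" "pathstart g = n" "pathfinish g = m2"
    using pc nW m2W unfolding path_connected_def by blast
  show thesis
  proof (rule that[of "linepath m1 n +++ g"])
    have "path_image (linepath m1 n +++ g) = closed_segment m1 n \<union> path_image g"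
      using g by (simp add: path_image_join)
    then show "path_image (linepath m1 n +++ g) \<subseteq> insert m1 (Ah - C)" using seg g(2) WA by blast
  qed (use g in simp_all)
qed

lemma face_paths:
  obtains Pf1 Pf2 where "path Pf1" "pathstart Pf1 = y2" "pathfinish Pf1 = tF" "path_image Pf1 \<subseteq> Kf"
    "path Pf2" "pathstart Pf2 = tF" "pathfinish Pf2 = x3" "path_image Pf2 \<subseteq> Kf" "x3 \<in> Kf \<inter> closure (- Kf)"
proof -
  have f: "y2 \<in> Kf \<inter> closure (- Kf)" "x3 \<in> Kf \<inter> closure (- Kf)" "tF \<in> Kf \<inter> closure (- Kf)"
    using diagonal_ends_frontier(2)[OF db(1)] diagonal_ends_frontier(2)[OF da(1)] link_ends_frontier(1)[OF local_links(3)]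
    unfolding db(2) da(2) h_def[symmetric] face_h by (simp_all add: Kf_def y2_def x3_def tF_def)
  note rp = region_path[OF local_nodes(4), folded Kf_def]
  show thesis using rp[OF f(1,3)] rp[OF f(3,2)] f(2) that by blast
qed

text \<open>The premise \<open>hyp\<close> covers a head that is the outer node: \<open>p1\<close>
  and \<open>p2\<close> are then tied to given rotations and cannot be adjusted. The paths in the
  face-node do not occur in the conclusion and can be chosen freely.\<close>

lemma height_step:
  assumes left: "diagonal_on_left D C db x1 y1"
    and hyp: "bounded Kw \<or> (\<forall>Z. path Z \<longrightarrow> pathstart Z = m1 \<longrightarrow> pathfinish Z = m2 \<longrightarrow> path_image Z \<subseteq> insert m1 (Ah - C) \<longrightarrow>
      turns mL (join_all [linepath m1 y1, reversepath p1, p2, linepath x2 m2, reversepath Z]) = 0)"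
    and ht: "height_function G D vs fs C M ht"
    and M: "\<And>x. FLink x \<in> M \<Longrightarrow> x \<in> darts G \<and> x \<noteq> e \<and> x \<noteq> opp G e"
  shows "ht db - ht da = 2 * pi * (corner_turn m0 y0 (Pe1 +++ Pe2) x1 m1 + corner_turn m1 y1 (reversepath p1) c mL
    + corner_turn m3 y3 P0 x0 m0 - corner_turn m2 x2 (reversepath p2) c mL)"
proof -
  obtain Z where Z: "path Z" "pathstart Z = m1" "pathfinish Z = m2" "path_image Z \<subseteq> insert m1 (Ah - C)"
    using left_path[OF left] .
  obtain Pf1 Pf2 where Pf1: "path Pf1" "pathstart Pf1 = y2" "pathfinish Pf1 = tF" "path_image Pf1 \<subseteq> Kf"
    and Pf2: "path Pf2" "pathstart Pf2 = tF" "pathfinish Pf2 = x3" "path_image Pf2 \<subseteq> Kf" and x3: "x3 \<in> Kf \<inter> closure (- Kf)"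
    using face_paths .
  interpret c1: path_step_curves G D vs fs k C e L da db P0 Pe1 Pe2 p1 p2 Pf1 Pf2 Z
    by unfold_locales (fact Pf1 Pf2 Z)+
  have lam_zero: "turns mL c1.lam = 0"
    by (rule c1.lam_zero) (use hyp Z in \<open>auto simp: c1.lam_def c1.lam_pieces_def\<close>)
  show ?thesis
  proof (cases "outer_region Kf")
    case False
    then have "turns mL c1.tau + turns mL c1.tau2 = 0" using c1.curves_zero by blast
    from c1.height_step_curves[OF this lam_zero ht M] show ?thesis unfolding c1.Pe_def .
  next
    case True
    have off: "mL \<notin> path_image c1.tau" "mL \<notin> path_image c1.tau2"
      using c1.tau_const_link[OF local_links(4), of mL] c1.tau2_const_link[OF local_links(4), of mL] midpoints_in(5) links_neq
      unfolding SL_def by metis+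
    have "turns mL c1.tau + turns mL c1.tau2 \<in> \<int>"
      using turns_closed_Ints[OF c1.tau(1,2) off(1)] turns_closed_Ints[OF c1.tau2(1,2) off(2)] by (rule Ints_add)
    then obtain n :: int where n: "turns mL c1.tau + turns mL c1.tau2 = of_int n" by (auto elim: Ints_cases)
    \<comment> \<open>In an outer face-node, a loop with winding number \<open>- n\<close> around
      everything outside it cancels the excess \<open>n\<close>. It is appended to
      \<open>Pf2\<close> and thus affects \<open>tau\<close> alone.\<close>
    obtain g where g: "path g" "path_image g \<subseteq> Kf" "pathstart g = x3" "pathfinish g = x3" "\<forall>z\<in>- Kf. turns z g = of_int (- n)"
      using outer_region_props(8)[OF True x3, of "- n"] by blast
    define Pf2' where "Pf2' = Pf2 +++ g"
    have Pf2': "path Pf2'" "pathstart Pf2' = tF" "pathfinish Pf2' = x3" "path_image Pf2' \<subseteq> Kf"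
      using Pf2 g by (simp_all add: Pf2'_def path_image_join)
    interpret c2: path_step_curves G D vs fs k C e L da db P0 Pe1 Pe2 p1 p2 Pf1 Pf2' Z
      by unfold_locales (fact Pf1 Pf2' Z)+
    have off2: "mL \<notin> path_image c2.tau"
      using c2.tau_const_link[OF local_links(4), of mL] midpoints_in(5) links_neq unfolding SL_def by metis
    have mK: "mL \<notin> Kf" using midpoints_in(5) pieces_disjoint by (metis disjoint_notin_left disjoint_notin_right)
    then have "turns mL Pf2' = turns mL Pf2 - of_int n"
      using g Pf2 by (subst Pf2'_def, subst turns_join) auto
    then have "turns mL c2.tau = turns mL c1.tau - of_int n"
      unfolding c1.turns_tau[OF off(1)] c2.turns_tau[OF off2] by simp
    moreover have "c2.tau2 = c1.tau2" "c2.lam = c1.lam"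
      by (simp_all add: c1.tau2_def c2.tau2_def c1.tau2_pieces_def c2.tau2_pieces_def
        c1.lam_def c2.lam_def c1.lam_pieces_def c2.lam_pieces_def)
    ultimately have "turns mL c2.tau + turns mL c2.tau2 = 0" "turns mL c2.lam = 0" using n lam_zero by simp_all
    from c2.height_step_curves[OF this ht M] show ?thesis unfolding c2.Pe_def .
  qed
qed

end

section \<open>Rotations about a node\<close>

text \<open>
  The arm from \<open>x\<close> to the midpoint of \<open>x\<close> and \<open>y\<close> rotates counterclockwise into the arm from \<open>x'\<close> to
  \<open>m'\<close>, while its hinge moves along \<open>p\<close>.  At a node drawn as a point nothing is required.
\<close>

definition swings ::
    "complex set \<Rightarrow> complex \<Rightarrow> complex \<Rightarrow> complex \<Rightarrow> complex \<Rightarrow> (real \<Rightarrow> complex) \<Rightarrow> bool" where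
  "swings K x y x' m' p \<longleftrightarrow>
     path p \<and> pathstart p = x \<and> pathfinish p = x' \<and> path_image p \<subseteq> K \<and>
     (is_singleton K \<or>
      (\<exists>q. path q \<and> pathstart q = midpoint x y \<and> pathfinish q = m' \<and> path_image q \<inter> K = {} \<and>
         q ` {0<..1} \<inter> closed_segment x y = {} \<and>
         (\<forall>\<^sub>F t in at_right 0. Im ((q t - midpoint x y) / (midpoint x y - x)) > 0) \<and>
         turns y (join_all [linepath x (midpoint x y), q, linepath m' x', reversepath p]) = 0))"

text \<open>The outer end \<open>y\<close> of the link belongs to the obstacle and is certain to lie
  off the closed curve of the rotation, so it is not encircled; this is what
  \<open>turns_left_rotation\<close> requires.\<close>

lemma left_rotation_swings:
  assumes rot: "left_rotation K B (x, midpoint x y) (x', m') \<theta>"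
    and B: "closed_segment x y \<subseteq> B" and xy: "x \<noteq> y"
    and K: "K \<inter> closed_segment x y \<subseteq> {x}"
    and arm: "closed_segment m' x' \<inter> closed_segment x y \<subseteq> {x}"
    and m': "m' \<notin> K" "m' \<notin> closed_segment x y"
  obtains p where "swings K x y x' m' p"
    "\<theta> = 2 * pi * (1 / 2 - corner_turn m' x' (reversepath p) x (midpoint x y))"
proof -
  define m where "m = midpoint x y"
  obtain p q where p: "path p" "path_image p \<subseteq> K" "pathstart p = x" "pathfinish p = x'"
    and q: "path q" "pathstart q = m" "pathfinish q = m'" "q ` {0<..<1} \<subseteq> - (K \<union> B)"
    and enc: "\<forall>z\<in>B - path_image (linepath x m +++ q +++ linepath m' x' +++ reversepath p).
        winding_number (linepath x m +++ q +++ linepath m' x' +++ reversepath p) z = 0"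
    and \<theta>: "\<theta> = 2 * pi * turns 0 (\<lambda>t. q t - p t)"
    and left: "\<forall>\<^sub>F t in at_right 0. Im ((q t - m) / (m - x)) > 0"
    using rot unfolding left_rotation_def rotation_along_def m_def turns_def by (auto simp: Let_def)
  have mseg: "m \<in> closed_segment x y" by (simp add: m_def)
  have mK: "m \<notin> K" using K mseg xy by (auto simp: m_def midpoint_eq_endpoint)
  have q01: "q t \<in> insert m (insert m' (- (K \<union> B)))" if "t \<in> {0..1}" for t
  proof (cases "t = 0 \<or> t = 1")
    case True
    then show ?thesis using q(2,3) by (auto simp: pathstart_def pathfinish_def)
  next
    case False
    then have "q t \<in> q ` {0<..<1}" using that by auto
    then show ?thesis using q(4) by blast
  qed
  have qK: "path_image q \<inter> K = {}"
    using q01 mK m'(1) unfolding path_image_def by blast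
  have avoid: "q ` {0<..1} \<inter> closed_segment x y = {}"
  proof -
    have "q t \<notin> closed_segment x y" if "t \<in> {0<..1}" for t
    proof (cases "t = 1")
      case True
      then show ?thesis using q(3) m'(2) by (simp add: pathfinish_def)
    next
      case False
      then have "q t \<in> q ` {0<..<1}" using that by auto
      then show ?thesis using q(4) B by blast
    qed
    then show ?thesis by blast
  qed
  have yq: "y \<notin> path_image q"
  proof
    assume "y \<in> path_image q"
    then obtain t where t: "t \<in> {0..1}" "y = q t" unfolding path_image_def by blast
    have "y \<in> closed_segment x y" by simp
    then have "y \<notin> - (K \<union> B)" "y \<noteq> m'" using B m'(2) by blast+
    moreover have "y \<noteq> m" using xy midpoint_eq_endpoint(2)[of x y] unfolding m_def by metis
    ultimately show False using q01[OF t(1)] t(2) by blast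
  qed
  have yp: "y \<notin> path_image p" using K p(2) xy by auto
  have ya: "y \<notin> closed_segment m' x'" using arm xy by auto
  have yh: "y \<notin> closed_segment x m" using half_segments(3)[OF xy] by (simp add: m_def)
  have lk: "linked [linepath x m, q, linepath m' x', reversepath p]" using p q by simp
  have "y \<notin> path_image (join_all [linepath x m, q, linepath m' x', reversepath p])"
    unfolding path_image_join_all[OF lk] using yq yp ya yh by simp
  moreover have "y \<in> B" using B by auto
  ultimately have "winding_number (join_all [linepath x m, q, linepath m' x', reversepath p]) y = 0"
    using enc by simp
  then have enc': "turns y (join_all [linepath x m, q, linepath m' x', reversepath p]) = 0"
    unfolding turns_def by simp
  have "turns 0 (\<lambda>t. q t - p t) = 1 / 2 - corner_turn m' x' (reversepath p) x (midpoint x y)"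
  proof (rule turns_left_rotation[OF p(1,3,4) q(1) q(2)[unfolded m_def] q(3) xy _ avoid left[unfolded m_def] _ arm])
    show "path_image p \<inter> path_image q = {}" using qK p(2) by blast
    show "path_image p \<inter> closed_segment x y \<subseteq> {x}" using K p(2) by blast
  qed (use enc' in \<open>simp add: m_def\<close>)
  moreover have "swings K x y x' m' p"
    unfolding swings_def using p q qK avoid left enc' unfolding m_def by blast
  ultimately show thesis using that \<theta> by simp
qed

text \<open>At a point the witness is the constant path, and the value in
  \<open>{0..<2 * pi}\<close> has to be matched with a corner turn; at an extended node the path is
  the one along which the hinge moves.\<close>

lemma ccw_angle_swings:
  assumes ccw: "ccw_angle K B (x, midpoint x y) (x', m') \<theta>"
    and B: "closed_segment x y \<subseteq> B" and xy: "x \<noteq> y"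
    and K: "x \<in> K" "x' \<in> K" "K \<inter> closed_segment x y \<subseteq> {x}"
    and arm: "closed_segment m' x' \<inter> closed_segment x y \<subseteq> {x}"
    and m': "m' \<notin> K" "m' \<notin> closed_segment x y"
  obtains p where "swings K x y x' m' p"
    "\<theta> = 2 * pi * (1 / 2 - corner_turn m' x' (reversepath p) x (midpoint x y))"
proof (cases "is_singleton K")
  case False
  then have "left_rotation K B (x, midpoint x y) (x', m') \<theta>" using ccw by (simp add: ccw_angle_def)
  from left_rotation_swings[OF this B xy K(3) arm m'] show thesis using that by blast
next
  case True
  then have x': "x' = x" using K by (auto simp: is_singleton_def)
  define m where "m = midpoint x y"
  have ne: "m' \<noteq> x" "m \<noteq> x" using m' K xy by (auto simp: m_def midpoint_eq_endpoint)
  have "closed_segment x m' \<inter> closed_segment x m \<subseteq> {x}"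
    using arm half_segments(1)[OF xy] open_closed_segment[of _ x y] ends_in_segment(1)[of x y]
    unfolding x' m_def closed_segment_commute[of m'] by blast
  from corner_turn_point[OF ne(1) this ne(2)]
  have ct: "corner_turn m' x (linepath x x) x m = Arg ((m - x) / (x - m')) / (2 * pi)" .
  have "\<theta> = Arg2pi ((m' - x) / (m - x))" using True ccw by (simp add: ccw_angle_def x' m_def)
  also have "\<dots> = pi - Arg (- 1 / ((m' - x) / (m - x)))"
    using ne by (intro Arg2pi_eq_pi_minus_Arg) simp
  also have "- 1 / ((m' - x) / (m - x)) = (m - x) / (x - m')"
    using ne by (simp add: field_simps)
  finally have "\<theta> = 2 * pi * (1 / 2 - corner_turn m' x' (reversepath (linepath x x)) x m)"
    unfolding reversepath_linepath x' ct by (simp add: right_diff_distrib)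
  moreover have "swings K x y x' m' (linepath x x)"
    using True K(1) by (simp add: swings_def x')
  ultimately show thesis using that unfolding m_def by blast
qed

lemma left_turn_swings:
  assumes lt: "left_turn K B (x', m') (x, midpoint x y) \<tau>"
    and B: "closed_segment x y \<subseteq> B" and xy: "x \<noteq> y"
    and K: "x \<in> K" "x' \<in> K" "K \<inter> closed_segment x y \<subseteq> {x}"
    and arm: "closed_segment m' x' \<inter> closed_segment x y \<subseteq> {x}"
    and m': "m' \<notin> K" "m' \<notin> closed_segment x y"
  obtains p where "swings K x y x' m' p" "\<tau> = 2 * pi * corner_turn m' x' (reversepath p) x (midpoint x y)"
proof (cases "is_singleton K")
  case False
  then obtain \<omega> where \<omega>: "left_rotation K B (x, midpoint x y) (x', m') \<omega>" "\<tau> = pi - \<omega>"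
    using lt by (auto simp: left_turn_def)
  from left_rotation_swings[OF \<omega>(1) B xy K(3) arm m'] obtain p where
    "swings K x y x' m' p" "\<omega> = 2 * pi * (1 / 2 - corner_turn m' x' (reversepath p) x (midpoint x y))" .
  then show thesis using that \<omega>(2) by (simp add: field_simps)
next
  case True
  then have x': "x' = x" using K by (auto simp: is_singleton_def)
  define m where "m = midpoint x y"
  have ne: "m' \<noteq> x" "m \<noteq> x" using m' K xy by (auto simp: m_def midpoint_eq_endpoint)
  have "closed_segment x m' \<inter> closed_segment x m \<subseteq> {x}"
    using arm half_segments(1)[OF xy] open_closed_segment[of _ x y] ends_in_segment(1)[of x y]
    unfolding x' m_def closed_segment_commute[of m'] by blast
  from corner_turn_point[OF ne(1) this ne(2)]
  have ct: "corner_turn m' x (linepath x x) x m = Arg ((m - x) / (x - m')) / (2 * pi)" .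
  have "\<tau> = Arg ((m - x) / (x - m'))" using True lt by (simp add: left_turn_def x' m_def)
  then have "\<tau> = 2 * pi * corner_turn m' x' (reversepath (linepath x x)) x m"
    unfolding reversepath_linepath x' ct by simp
  moreover have "swings K x y x' m' (linepath x x)"
    using True K(1) by (simp add: swings_def x')
  ultimately show thesis using that unfolding m_def by blast
qed

text \<open>
  At an unbounded node corner turns depend on the path in the node, but two left rotations from the
  same link determine compatible paths.
\<close>

lemma swings_unbounded:
  assumes sw: "swings K x y x1 m1 p1" "swings K x y x2 m2 p2"
    and K: "connected K" "\<not> bounded K" "\<not> is_singleton K" "K \<inter> closed_segment x y = {x}" and xy: "x \<noteq> y"
    and arm: "closed_segment m1 x1 \<inter> closed_segment x y \<subseteq> {x}" "closed_segment m2 x2 \<inter> closed_segment x y \<subseteq> {x}"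
    and Z: "path Z" "pathstart Z = m1" "pathfinish Z = m2" "path_image Z \<inter> K = {}"
      "path_image Z \<inter> closed_segment x y = {}"
  shows "turns (midpoint x y) (join_all [linepath m1 x1, reversepath p1, p2, linepath x2 m2, reversepath Z]) = 0"
proof -
  define m where "m = midpoint x y"
  obtain q1 where p1: "path p1" "pathstart p1 = x" "pathfinish p1 = x1" "path_image p1 \<subseteq> K"
    and q1: "path q1" "pathstart q1 = m" "pathfinish q1 = m1" "path_image q1 \<inter> K = {}"
      "q1 ` {0<..1} \<inter> closed_segment x y = {}" "\<forall>\<^sub>F t in at_right 0. Im ((q1 t - m) / (m - x)) > 0"
    and e1: "turns y (join_all [linepath x m, q1, linepath m1 x1, reversepath p1]) = 0"
    using sw(1) K(3) unfolding swings_def m_def by blast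
  obtain q2 where p2: "path p2" "pathstart p2 = x" "pathfinish p2 = x2" "path_image p2 \<subseteq> K"
    and q2: "path q2" "pathstart q2 = m" "pathfinish q2 = m2" "path_image q2 \<inter> K = {}"
      "q2 ` {0<..1} \<inter> closed_segment x y = {}" "\<forall>\<^sub>F t in at_right 0. Im ((q2 t - m) / (m - x)) > 0"
    and e2: "turns y (join_all [linepath x m, q2, linepath m2 x2, reversepath p2]) = 0"
    using sw(2) K(3) unfolding swings_def m_def by blast
  have xK: "x \<in> K" using K(4) by blast
  have yK: "y \<notin> K" using K(4) xy by auto
  have mK: "m \<notin> K"
  proof
    assume "m \<in> K"
    then have "m \<in> {x}" using K(4) by (metis IntI m_def midpoint_in_closed_segment)
    then show False using xy by (simp add: m_def midpoint_eq_endpoint)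
  qed
  have ys: "y \<in> closed_segment x y" by simp
  have yq: "y \<notin> path_image q" if "pathstart q = m" "q ` {0<..1} \<inter> closed_segment x y = {}" for q
  proof
    assume "y \<in> path_image q"
    then obtain t where t: "t \<in> {0..1}" "q t = y" unfolding path_image_def by blast
    have "q 0 \<noteq> y" using that(1) xy by (simp add: pathstart_def m_def midpoint_eq_endpoint)
    then have "t \<in> {0<..1}" using t by (cases "t = 0") auto
    then show False using that(2) ys t(2) by blast
  qed
  have yoff: "y \<notin> path_image q1" "y \<notin> path_image q2" "y \<notin> path_image p1" "y \<notin> path_image p2"
    "y \<notin> closed_segment m1 x1" "y \<notin> closed_segment m2 x2" "y \<notin> path_image Z" "y \<notin> closed_segment x m"
    using yq[OF q1(2,5)] yq[OF q2(2,5)] yK p1(4) p2(4) arm Z(5) xy half_segments(3)[OF xy] by (auto simp: m_def)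
  have h0: "turns y (linepath x m) = 0" using turns_half_segments(1)[OF xy] by (simp add: m_def)
  have "turns y (join_all [linepath x m, q1, linepath m1 x1, reversepath p1])
      = sum_list (map (turns y) [linepath x m, q1, linepath m1 x1, reversepath p1])"
    by (rule turns_join_all) (use p1 q1 yoff in auto)
  then have f1: "turns y q1 + turns y (linepath m1 x1) - turns y p1 = 0"
    using e1 h0 p1 yoff by (simp add: turns_reversepath)
  have "turns y (join_all [linepath x m, q2, linepath m2 x2, reversepath p2])
      = sum_list (map (turns y) [linepath x m, q2, linepath m2 x2, reversepath p2])"
    by (rule turns_join_all) (use p2 q2 yoff in auto)
  then have f2: "turns y q2 + turns y (linepath m2 x2) - turns y p2 = 0"
    using e2 h0 p2 yoff by (simp add: turns_reversepath)
  have g1: "turns x q1 = turns y q1 + 1 / 2 + turns m1 (linepath y x)"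
    using turns_left_start[OF q1(1) q1(2)[unfolded m_def] xy q1(5) q1(6)[unfolded m_def]] q1(3) by simp
  have g2: "turns x q2 = turns y q2 + 1 / 2 + turns m2 (linepath y x)"
    using turns_left_start[OF q2(1) q2(2)[unfolded m_def] xy q2(5) q2(6)[unfolded m_def]] q2(3) by simp
  have g3: "turns y Z + turns m2 (linepath y x) = turns m1 (linepath y x) + turns x Z"
    using turns_exchange[of "linepath y x" Z] Z by (simp add: closed_segment_commute Int_commute)
  have lq: "linked [q1, Z, reversepath q2]" using q1 q2 Z by simp
  have xoff: "x \<notin> path_image q1" "x \<notin> path_image q2" "x \<notin> path_image Z" using xK q1(4) q2(4) Z(4) by blast+
  \<comment> \<open>The node is connected and unbounded, so a closed curve outside it does not wind
    around its point \<open>x\<close>. This is what makes \<open>p1\<close> and \<open>p2\<close>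
    compatible.\<close>
  have "turns x (join_all [q1, Z, reversepath q2]) = 0"
  proof (rule turns_unbounded_eq_0[OF _ _ K(1) _ xK K(2)])
    show "path (join_all [q1, Z, reversepath q2])" by (rule path_join_all[OF lq])
    show "pathfinish (join_all [q1, Z, reversepath q2]) = pathstart (join_all [q1, Z, reversepath q2])"
      unfolding pathfinish_join_all[OF lq] pathstart_join_all[OF lq] using q1 q2 by simp
    show "K \<inter> path_image (join_all [q1, Z, reversepath q2]) = {}"
      unfolding path_image_join_all[OF lq] using q1(4) q2(4) Z(4) by auto
  qed
  moreover have "turns x (join_all [q1, Z, reversepath q2]) = sum_list (map (turns x) [q1, Z, reversepath q2])"
    by (rule turns_join_all[OF lq]) (use xoff in auto)
  ultimately have g4: "turns x q1 + turns x Z - turns x q2 = 0"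
    using q2(1) xoff by (simp add: turns_reversepath)
  let ?gs = "[linepath m1 x1, reversepath p1, p2, linepath x2 m2, reversepath Z]"
  have lk: "linked ?gs" using p1 p2 Z by simp
  have arm': "closed_segment x2 m2 \<inter> closed_segment x y \<subseteq> {x}"
    by (subst closed_segment_commute) (rule arm(2))
  have im: "path_image (join_all ?gs) \<inter> closed_segment x y \<subseteq> {x}"
    unfolding path_image_join_all[OF lk] using arm(1) arm' p1 p2(4) Z(1,5) K(4) by auto
  have "turns y (join_all ?gs) = sum_list (map (turns y) ?gs)"
    by (rule turns_join_all[OF lk]) (use yoff in \<open>auto simp: closed_segment_commute\<close>)
  also have "\<dots> = turns y (linepath m1 x1) - turns y p1 + turns y p2 - turns y (linepath m2 x2) - turns y Z"
    using p1 p2 Z yoff turns_linepath_rev[of y m2 x2] by (simp add: turns_reversepath)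
  also have "\<dots> = 0" using f1 f2 g1 g2 g3 g4 by linarith
  finally have y0: "turns y (join_all ?gs) = 0" .
  \<comment> \<open>The closed curve meets the link at most in \<open>x\<close>, so its midpoint can
    be reached from the outer end.\<close>
  have "turns m (join_all ?gs) = turns y (join_all ?gs)"
  proof (rule turns_constant[of _ "closed_segment m y"])
    show "path (join_all ?gs)" by (rule path_join_all[OF lk])
    show "pathfinish (join_all ?gs) = pathstart (join_all ?gs)"
      unfolding pathfinish_join_all[OF lk] pathstart_join_all[OF lk] using Z by simp
    have "closed_segment m y \<subseteq> closed_segment x y" "x \<notin> closed_segment m y"
      using half_segments(4)[OF xy] by (auto simp: m_def closed_segment_halves[of x y])
    then show "closed_segment m y \<inter> path_image (join_all ?gs) = {}" using im by blast
  qed simp_all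
  then show ?thesis using y0 by (simp add: m_def)
qed

text \<open>By Janiszewski's theorem the node and the link together do not separate the plane, so
  the free end can travel outside both. A loop around both then corrects the winding around the link
  to zero, which determines the angle.\<close>

lemma rotation_exists:
  assumes K: "compact K" "connected K" "connected (- K)" "K \<inter> closed_segment x y = {x}" and xy: "x \<noteq> y"
    and arm: "closed_segment x1 m1 \<inter> closed_segment x y \<subseteq> {x}" "closed_segment x2 m2 \<inter> closed_segment x y \<subseteq> {x}"
    and off: "m1 \<notin> K" "m2 \<notin> K" "m1 \<notin> closed_segment x y" "m2 \<notin> closed_segment x y"
    and a: "path a" "pathstart a = x" "pathfinish a = x1" "path_image a \<subseteq> K"
    and b: "path b" "pathstart b = x" "pathfinish b = x2" "path_image b \<subseteq> K"
  shows "rotation K (closed_segment x y) (x1, m1) (x2, m2)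
    (2 * pi * (corner_turn m1 x1 (reversepath a) x (midpoint x y) - corner_turn m2 x2 (reversepath b) x (midpoint x y)))"
proof -
  define m S p where "m = midpoint x y" and "S = K \<union> closed_segment x y" and "p = reversepath a +++ b"
  have S: "compact S" "connected S" "connected (- S)"
  proof -
    show "compact S" unfolding S_def using K(1) compact_segment(1) by (rule compact_Un)
    show "connected S" unfolding S_def using K(2,4) by (intro connected_Un) auto
    have "connected (- closed_segment x y)"
      by (rule connected_complement_bounded_convex) (simp_all add: bounded_closed_segment)
    then show "connected (- S)"
      unfolding S_def using K Janiszewski_connected[of K "closed_segment x y"] by (auto simp: compact_imp_closed)
  qed
  have mS: "m1 \<in> - S" "m2 \<in> - S" using off by (simp_all add: S_def)
  have "path_connected (- S)" using S by (simp add: connected_open_path_connected compact_imp_closed open_Compl)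
  then obtain q0 where q0: "path q0" "path_image q0 \<subseteq> - S" "pathstart q0 = m1" "pathfinish q0 = m2"
    using mS unfolding path_connected_def by blast
  have p: "path p" "pathstart p = x1" "pathfinish p = x2" "path_image p \<subseteq> K" "x \<in> path_image p"
    using a b pathstart_in_path_image[of a] by (auto simp: p_def path_image_join)
  have mx: "m \<in> closed_segment x y" "m \<noteq> x" using xy by (simp_all add: m_def midpoint_eq_endpoint)
  have mK: "m \<notin> K" using K(4) mx by blast
  have moff: "m \<notin> closed_segment x1 m1" "m \<notin> closed_segment m2 x2" "m \<notin> path_image p"
    "m \<notin> path_image a" "m \<notin> path_image b"
    using arm mx mK p(4) a(4) b(4) closed_segment_commute[of m2 x2] by blast+
  define gs where "gs q = [linepath x1 m1, q, linepath m2 x2, reversepath p]" for q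
  have lk: "linked (gs q)" and cl: "pathfinish (join_all (gs q)) = pathstart (join_all (gs q))"
    if "path q" "pathstart q = m1" "pathfinish q = m2" for q
  proof -
    show lk: "linked (gs q)" using that p by (simp add: gs_def)
    show "pathfinish (join_all (gs q)) = pathstart (join_all (gs q))"
      unfolding pathfinish_join_all[OF lk] pathstart_join_all[OF lk] using p by (simp add: gs_def)
  qed
  have arm': "closed_segment m2 x2 \<inter> closed_segment x y \<subseteq> {x}"
    by (subst closed_segment_commute) (rule arm(2))
  have im: "path_image (join_all (gs q)) \<inter> closed_segment x y \<subseteq> {x}"
    if "path q" "pathstart q = m1" "pathfinish q = m2" "path_image q \<subseteq> - S" for q
    unfolding path_image_join_all[OF lk[OF that(1-3)]]
    using arm(1) arm' p(4) that(4) K(4) p(1) by (auto simp: gs_def S_def)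
  have turns: "turns m (join_all (gs q)) =
      turns m (linepath x1 m1) + turns m q + turns m (linepath m2 x2) - turns m b + turns m a"
    if "path q" "pathstart q = m1" "pathfinish q = m2" "path_image q \<subseteq> - S" for q
  proof -
    have "m \<notin> path_image q" using that(4) mx(1) by (auto simp: S_def)
    then have "turns m (join_all (gs q)) = sum_list (map (turns m) (gs q))"
      using moff p(1) by (intro turns_join_all[OF lk[OF that(1-3)]]) (auto simp: gs_def)
    moreover have "turns m p = turns m b - turns m a"
      using a b moff by (simp add: p_def turns_join turns_reversepath)
    ultimately show ?thesis using p(1) moff(3) by (simp add: gs_def turns_reversepath)
  qed
  have "turns m (join_all (gs q0)) \<in> \<int>"
    using im[OF q0(1,3,4,2)] mx
    by (intro turns_closed_Ints path_join_all[OF lk] cl) (use q0 in auto)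
  then obtain n :: int where n: "turns m (join_all (gs q0)) = of_int n" by (auto elim: Ints_cases)
  obtain h where h: "path h" "pathstart h = m2" "pathfinish h = m2" "path_image h \<subseteq> - S"
    "\<And>z. z \<in> S \<Longrightarrow> turns z h = of_int (- n)"
    using exists_loop_around[OF S, of m2 "- n"] mS(2) by blast
  define q where "q = q0 +++ h"
  have q: "path q" "pathstart q = m1" "pathfinish q = m2" "path_image q \<subseteq> - S"
    using q0 h by (auto simp: q_def path_image_join)
  have mS': "m \<in> S" using mx by (simp add: S_def)
  have "turns m q = turns m q0 - of_int n"
    unfolding q_def using q0 h mS' by (subst turns_join) auto
  then have m0: "turns m (join_all (gs q)) = 0" using turns[OF q] turns[OF q0(1,3,4,2)] n by simp
  have enc: "winding_number (join_all (gs q)) z = 0" if "z \<in> closed_segment x y - path_image (join_all (gs q))" for z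
  proof -
    have zx: "z \<noteq> x"
      using that p(5) p(1) unfolding path_image_join_all[OF lk[OF q(1-3)]] by (auto simp: gs_def)
    have cs: "closed_segment m z \<subseteq> closed_segment x y"
      using that mx by (intro closed_segment_subset) auto
    \<comment> \<open>As an end of the link, \<open>x\<close> is an extreme point. Hence the piece
      from \<open>m\<close> to \<open>z\<close> avoids \<open>x\<close>, the only point in which the
      closed curve can meet the link.\<close>
    have xn: "x \<notin> closed_segment m z"
    proof
      assume "x \<in> closed_segment m z"
      moreover have "x extreme_point_of closed_segment x y" by (simp add: extreme_point_of_segment)
      ultimately show False using mx zx that
        unfolding extreme_point_of_def by (metis DiffD1 open_segment_def insertE Diff_iff empty_iff)
    qed
    have "turns m (join_all (gs q)) = turns z (join_all (gs q))"
      by (rule turns_constant[of _ "closed_segment m z"])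
        (use path_join_all[OF lk[OF q(1-3)]] cl[OF q(1-3)] im[OF q] cs xn in auto)
    then show ?thesis
      using m0 that winding_number_eq_turns[OF path_join_all[OF lk[OF q(1-3)]] cl[OF q(1-3)]] by simp
  qed
  have pq: "path_image p \<inter> path_image q = {}" using p(4) q(4) by (auto simp: S_def)
  have "turns 0 (\<lambda>t. q t - p t) = turns m1 p + turns x2 q"
    using turns_diff'[OF p(1) q(1) pq] p q by simp
  also have "\<dots> = turns x2 q + turns m1 (reversepath a +++ b)" by (simp add: p_def)
  also have "\<dots> = corner_turn m1 x1 (reversepath a) x m - corner_turn m2 x2 (reversepath b) x m"
  proof (rule turns_rotation_between[OF a(1-3) b(1-3) q(1-3)])
    show "path_image a \<inter> path_image q = {}" "path_image b \<inter> path_image q = {}"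
      using a(4) b(4) q(4) by (auto simp: S_def)
    have "closed_segment x m \<subseteq> closed_segment x y" using mx by (intro closed_segment_subset) auto
    then show "closed_segment x m \<inter> path_image q = {}" using q(4) by (auto simp: S_def)
    show "turns m (linepath x1 m1) + turns m q + turns m (linepath m2 x2) - turns m b + turns m a = 0"
      using m0 turns[OF q] by simp
  qed (use moff in \<open>auto simp: closed_segment_commute\<close>)
  finally have \<theta>: "turns 0 (\<lambda>t. q t - p t) = corner_turn m1 x1 (reversepath a) x m - corner_turn m2 x2 (reversepath b) x m" .
  have "q ` {0<..<1} \<subseteq> path_image q" by (auto simp: path_image_def)
  then have "rotation_along K (closed_segment x y) (x1, m1) (x2, m2) q
    (2 * pi * turns 0 (\<lambda>t. q t - p t))"
    unfolding rotation_along_def turns_def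
    using p q enc by (intro exI[of _ p]) (auto simp: Let_def S_def gs_def)
  then show ?thesis unfolding rotation_def \<theta> m_def by blast
qed

section \<open>Heights and turns along one edge\<close>

context cut_drawing
begin

section \<open>Arms formed by links and diagonals\<close>

lemma side_seg: "l \<in> links G \<Longrightarrow> l' \<in> links G \<Longrightarrow> l \<noteq> l' \<Longrightarrow> side l' \<inter> seg D l = {}"
  using sides_disjoint[of l' l] side_region[of l' "outer_end G l"] side_region[of l' "edge_end G l"]
    tip_in[of l] base_in[of l] ends_nodes[of l] unfolding seg_eq by blast

lemma region_seg:
  assumes l: "l \<in> links G"
  shows "region D (outer_end G l) \<inter> seg D l = {tip D l}" "region D (edge_end G l) \<inter> seg D l = {base D l}"
proof -
  have ne: "outer_end G l \<noteq> edge_end G l" by (cases l) auto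
  have d: "region D (outer_end G l) \<inter> region D (edge_end G l) = {}"
    by (rule regions_disjoint[OF ends_nodes[OF l] ne])
  show "region D (outer_end G l) \<inter> seg D l = {tip D l}" "region D (edge_end G l) \<inter> seg D l = {base D l}"
    using d tip_in[OF l] base_in[OF l] side_region[OF l ends_nodes(1)[OF l]] side_region[OF l ends_nodes(2)[OF l]]
    unfolding seg_eq by blast+
qed

lemma tip_half:
  assumes "l \<in> links G"
  shows "closed_segment (tip D l) (midpoint (tip D l) (base D l)) \<subseteq> insert (tip D l) (side l)"
    "midpoint (tip D l) (base D l) \<in> side l"
  using half_segments(1)[OF tip_neq_base[OF assms]] tip_neq_base[OF assms]
  by (simp_all add: side_def)

lemma base_half:
  assumes "l \<in> links G"
  shows "closed_segment (base D l) (midpoint (tip D l) (base D l)) \<subseteq> insert (base D l) (side l)"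
  using half_segments(2)[OF tip_neq_base[OF assms]]
  by (simp add: side_def closed_segment_commute[of "base D l"])

lemma src_half:
  assumes "d \<in> diagonals G D C"
  shows "closed_segment (src d) (diag_mid d) \<subseteq> insert (src d) (facet D (corner d))"
    "diag_mid d \<in> facet D (corner d)"
proof -
  note d = diagonal_props[OF assms]
  show "closed_segment (src d) (diag_mid d) \<subseteq> insert (src d) (facet D (corner d))"
    using half_segments(1)[OF d(5)] d(4) unfolding diag_mid_def by blast
  have "diag_mid d \<in> open_segment (src d) (dst d)" using d(5) by (simp add: diag_mid_def)
  then show "diag_mid d \<in> facet D (corner d)" using d(4) by blast
qed

lemma arm_meets:
  assumes "closed_segment x' m' \<subseteq> insert x' W" "x' \<in> K" "K \<inter> S \<subseteq> {x}" "W \<inter> S = {}"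
  shows "closed_segment m' x' \<inter> S \<subseteq> {x}" "closed_segment x' m' \<inter> S \<subseteq> {x}"
proof -
  show "closed_segment x' m' \<inter> S \<subseteq> {x}" using assms by blast
  then show "closed_segment m' x' \<inter> S \<subseteq> {x}" by (subst closed_segment_commute)
qed

lemma src_arm_facts:
  assumes l: "l \<in> links G" and d: "d \<in> diagonals G D C" and v: "outer_end G l = VNode (vertex G (corner d))"
  shows "src d \<in> region D (outer_end G l)"
    "closed_segment (diag_mid d) (src d) \<inter> seg D l \<subseteq> {tip D l}" "closed_segment (src d) (diag_mid d) \<inter> seg D l \<subseteq> {tip D l}"
    "diag_mid d \<notin> region D (outer_end G l)" "diag_mid d \<notin> seg D l"
proof -
  note dp = diagonal_props[OF d]
  show s: "src d \<in> region D (outer_end G l)" using dp(2) v by simp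
  have f: "facet D (corner d) \<inter> seg D l = {}" by (rule facet_seg[OF dp(1) l])
  have K: "region D (outer_end G l) \<inter> seg D l \<subseteq> {tip D l}" using region_seg(1)[OF l] by simp
  show "closed_segment (diag_mid d) (src d) \<inter> seg D l \<subseteq> {tip D l}" "closed_segment (src d) (diag_mid d) \<inter> seg D l \<subseteq> {tip D l}"
    by (rule arm_meets[OF src_half(1)[OF d] s K f])+
  show "diag_mid d \<notin> region D (outer_end G l)" "diag_mid d \<notin> seg D l"
    using src_half(2)[OF d] f facet_region[OF dp(1) ends_nodes(1)[OF l]] by blast+
qed

lemma bounded_vertex:
  assumes "h \<in> darts G" "vertex G h \<noteq> vs"
  shows "bounded (region D (VNode (vertex G h)))"
  by (rule bounded_region_props(2)[OF bounded_region_if[OF nodes_intros(1)]]) (use assms in auto)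

text \<open>The tail is not the root and so is bounded; the path hidden in the counterclockwise
  angle may be replaced by any other path.\<close>

lemma first_angle:
  assumes e: "e \<in> darts G" "vertex G e \<noteq> vs" and d: "d \<in> diagonals G D C" "vertex G (corner d) = vertex G e"
    and ccw: "ccw_angle (region D (VNode (vertex G e))) B (tip_arm D (VLink e)) (src_arm d) \<theta>" "seg D (VLink e) \<subseteq> B"
    and P: "path P" "pathstart P = src d" "pathfinish P = tip D (VLink e)" "path_image P \<subseteq> region D (VNode (vertex G e))"
  shows "\<theta> = 2 * pi * (1 / 2 - corner_turn (diag_mid d) (src d) P (tip D (VLink e)) (midpoint (tip D (VLink e)) (base D (VLink e))))"
proof -
  have l: "VLink e \<in> links G" using e by (simp add: links_iff)
  have v: "outer_end G (VLink e) = VNode (vertex G (corner d))" using d by simp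
  note sf = src_arm_facts[OF l d(1) v, unfolded outer_end.simps]
  obtain p where p: "swings (region D (VNode (vertex G e))) (tip D (VLink e)) (base D (VLink e)) (src d) (diag_mid d) p"
    and \<theta>: "\<theta> = 2 * pi * (1 / 2 - corner_turn (diag_mid d) (src d) (reversepath p) (tip D (VLink e)) (midpoint (tip D (VLink e)) (base D (VLink e))))"
    by (rule ccw_angle_swings[OF ccw(1)[unfolded tip_arm_def src_arm_def] ccw(2)[unfolded seg_def] tip_neq_base[OF l]
        tip_in[OF l, unfolded outer_end.simps] sf(1) _ sf(2)[unfolded seg_def] sf(4) sf(5)[unfolded seg_def]])
      (use region_seg(1)[OF l] in \<open>simp add: seg_def\<close>)
  have p': "path p" "pathstart p = tip D (VLink e)" "pathfinish p = src d" "path_image p \<subseteq> region D (VNode (vertex G e))"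
    using p by (simp_all add: swings_def)
  have "midpoint (tip D (VLink e)) (base D (VLink e)) \<notin> region D (VNode (vertex G e))"
    using tip_half(2)[OF l] side_region[OF l nodes_intros(1)[OF e(1)]] by blast
  then have "corner_turn (diag_mid d) (src d) (reversepath p) (tip D (VLink e)) (midpoint (tip D (VLink e)) (base D (VLink e)))
      = corner_turn (diag_mid d) (src d) P (tip D (VLink e)) (midpoint (tip D (VLink e)) (base D (VLink e)))"
    using P p' sf(4) bounded_vertex[OF e] connected_region_compl[OF nodes_intros(1)[OF e(1)]]
    by (intro corner_turn_path_independent) simp_all
  then show ?thesis using \<theta> by simp
qed

text \<open>The last vertex may be the outer node. Its path is therefore returned together with its
  rotation, so that it can be matched with the path of the last left turn.\<close>

lemma last_angle:
  assumes e: "e \<in> darts G" and d: "d \<in> diagonals G D C" "vertex G (corner d) = vertex G e"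
    and ccw: "ccw_angle (region D (VNode (vertex G e))) B (tip_arm D (VLink e)) (src_arm d) \<theta>" "seg D (VLink e) \<subseteq> B"
  obtains p where "swings (region D (VNode (vertex G e))) (tip D (VLink e)) (base D (VLink e)) (src d) (diag_mid d) p"
    "\<theta> = 2 * pi * (1 / 2 - corner_turn (diag_mid d) (src d) (reversepath p) (tip D (VLink e)) (midpoint (tip D (VLink e)) (base D (VLink e))))"
proof -
  have l: "VLink e \<in> links G" using e by (simp add: links_iff)
  have v: "outer_end G (VLink e) = VNode (vertex G (corner d))" using d by simp
  note sf = src_arm_facts[OF l d(1) v, unfolded outer_end.simps]
  show thesis
    by (rule ccw_angle_swings[OF ccw(1)[unfolded tip_arm_def src_arm_def] ccw(2)[unfolded seg_def] tip_neq_base[OF l]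
        tip_in[OF l, unfolded outer_end.simps] sf(1) _ sf(2)[unfolded seg_def] sf(4) sf(5)[unfolded seg_def]])
      (use region_seg(1)[OF l] in \<open>simp add: seg_def\<close>, rule that)
qed

text \<open>The cut at the vertex is the link on which the path leaves it. The height condition
  applies once a rotation that avoids this link is known to exist, and
  \<open>rotation_exists\<close> also gives its angle.\<close>

lemma vertex_step:
  assumes e: "e \<in> darts G" "vertex G e \<noteq> vs" and cut_e: "cut_at G D vs fs C M (VNode (vertex G e)) = seg D (VLink e)"
    and da: "da \<in> diagonals G D C" "vertex G (corner da) = vertex G e"
    and db: "db \<in> diagonals G D C" "vertex G (corner db) = vertex G e"
    and P: "path P" "pathstart P = src da" "pathfinish P = tip D (VLink e)" "path_image P \<subseteq> region D (VNode (vertex G e))"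
    and p: "path p" "pathstart p = tip D (VLink e)" "pathfinish p = src db" "path_image p \<subseteq> region D (VNode (vertex G e))"
    and ht: "height_function G D vs fs C M ht"
  shows "ht da - ht db = 2 * pi *
    (corner_turn (diag_mid db) (src db) (reversepath p) (tip D (VLink e)) (midpoint (tip D (VLink e)) (base D (VLink e)))
    - corner_turn (diag_mid da) (src da) P (tip D (VLink e)) (midpoint (tip D (VLink e)) (base D (VLink e))))"
    (is "_ = ?\<theta>")
proof -
  have l: "VLink e \<in> links G" using e by (simp add: links_iff)
  note n = nodes_intros(1)[OF e(1)]
  have va: "outer_end G (VLink e) = VNode (vertex G (corner da))" and vb: "outer_end G (VLink e) = VNode (vertex G (corner db))"
    using da db by simp_all
  note sa = src_arm_facts[OF l da(1) va, unfolded outer_end.simps seg_def]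
  note sb = src_arm_facts[OF l db(1) vb, unfolded outer_end.simps seg_def]
  have "rotation (region D (VNode (vertex G e))) (closed_segment (tip D (VLink e)) (base D (VLink e)))
      (src db, diag_mid db) (src da, diag_mid da) (2 * pi *
    (corner_turn (diag_mid db) (src db) (reversepath p) (tip D (VLink e)) (midpoint (tip D (VLink e)) (base D (VLink e)))
    - corner_turn (diag_mid da) (src da) (reversepath (reversepath P)) (tip D (VLink e)) (midpoint (tip D (VLink e)) (base D (VLink e)))))"
  proof (rule rotation_exists[OF _ connected_region[OF n] connected_region_compl[OF n] _ tip_neq_base[OF l]
        sb(3) sa(3) sb(4) sa(4) sb(5) sa(5) p])
    show "compact (region D (VNode (vertex G e)))"
      using bounded_vertex[OF e] closed_region[OF n] by (simp add: compact_eq_bounded_closed)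
    show "region D (VNode (vertex G e)) \<inter> closed_segment (tip D (VLink e)) (base D (VLink e)) = {tip D (VLink e)}"
      using region_seg(1)[OF l] by (simp add: seg_def)
  qed (use P in simp_all)
  then have "rotation (region D (VNode (vertex G (corner db)))) (cut_at G D vs fs C M (VNode (vertex G (corner db)))) (src_arm db) (src_arm da) ?\<theta>"
    using db(2) cut_e by (simp add: src_arm_def seg_def)
  then have "ht da = ht db + ?\<theta>"
    using ht da db unfolding height_function_def Let_def by metis
  then show ?thesis by simp
qed

text \<open>The corner turns at the edge-node and from the edge into \<open>VLink L\<close> are the
  given left turns; what is left are the corner turns between links and diagonals at the two ends,
  which will telescope.\<close>

lemma edge_step:
  assumes e: "e \<in> darts G" and not_root: "vertex G e \<noteq> vs" and no_loop: "vertex G (opp G e) \<noteq> vertex G e"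
    and L: "L \<in> darts G" "vertex G L = vertex G (opp G e)" "L \<noteq> opp G e"
    and da: "da \<in> diagonals G D C" "corner da = e"
    and db: "db \<in> diagonals G D C" "corner db = face_next G e"
    and P0: "path P0" "pathstart P0 = src da" "pathfinish P0 = tip D (VLink e)"
      "path_image P0 \<subseteq> region D (VNode (vertex G e))"
    and p2: "path p2" "pathstart p2 = tip D (VLink L)" "pathfinish p2 = src db"
      "path_image p2 \<subseteq> region D (VNode (vertex G (opp G e)))"
    and \<alpha>: "left_turn (region D (ENode (edge G e))) (seg D (VLink e) \<union> seg D (VLink (opp G e)))
      (base_arm D (VLink e)) (base_arm D (VLink (opp G e))) \<alpha>"
    and \<beta>: "left_turn (region D (VNode (vertex G (opp G e)))) (seg D (VLink (opp G e)) \<union> seg D (VLink L))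
      (tip_arm D (VLink (opp G e))) (tip_arm D (VLink L)) \<beta>"
    and sw: "\<not> bounded (region D (VNode (vertex G (opp G e)))) \<Longrightarrow>
      swings (region D (VNode (vertex G (opp G e)))) (tip D (VLink L)) (base D (VLink L)) (src db) (diag_mid db) p2"
    and left: "diagonal_on_left D C db (base D (VLink (opp G e))) (tip D (VLink (opp G e)))"
    and ht: "height_function G D vs fs C M ht"
    and M: "\<And>x. FLink x \<in> M \<Longrightarrow> x \<in> darts G \<and> x \<noteq> e \<and> x \<noteq> opp G e"
  shows "ht db - ht da = \<alpha> + \<beta> + 2 * pi *
    (corner_turn (diag_mid da) (src da) P0 (tip D (VLink e)) (midpoint (tip D (VLink e)) (base D (VLink e)))
    - corner_turn (diag_mid db) (src db) (reversepath p2) (tip D (VLink L)) (midpoint (tip D (VLink L)) (base D (VLink L))))"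
proof -
  define l l' lL where "l = VLink e" and "l' = VLink (opp G e)" and "lL = VLink L"
  have oe: "opp G e \<in> darts G" using e by (simp add: opp_in)
  have lk: "l \<in> links G" "l' \<in> links G" "lL \<in> links G" "FLink e \<in> links G"
    using e oe L by (simp_all add: l_def l'_def lL_def links_iff)
  have ne: "l \<noteq> l'" "lL \<noteq> l'" using opp_neq[OF e] L(3) by (auto simp: l_def l'_def lL_def)
  define Kw Ke where "Kw = region D (VNode (vertex G (opp G e)))" and "Ke = region D (ENode (edge G e))"
  have oel: "outer_end G l' = VNode (vertex G (opp G e))" "outer_end G lL = VNode (vertex G (opp G e))"
    "edge_end G l = ENode (edge G e)" "edge_end G l' = ENode (edge G e)" "edge_end G (FLink e) = ENode (edge G e)"
    using L edge_opp by (simp_all add: l_def l'_def lL_def)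
  have nKw: "VNode (vertex G (opp G e)) \<in> nodes G" and nKe: "ENode (edge G e) \<in> nodes G"
    using nodes_intros[OF oe] nodes_intros[OF e] by simp_all
  have tw: "tip D l' \<in> Kw" "tip D lL \<in> Kw" using tip_in[OF lk(2)] tip_in[OF lk(3)] oel by (simp_all add: Kw_def)
  have be: "base D l \<in> Ke" "base D l' \<in> Ke"
    using base_in[OF lk(1)] base_in[OF lk(2)] oel by (simp_all add: Ke_def)
  have KL: "Kw \<inter> seg D lL = {tip D lL}" using region_seg(1)[OF lk(3)] oel by (simp add: Kw_def)
  have Kl': "Ke \<inter> seg D l' = {base D l'}" using region_seg(2)[OF lk(2)] oel by (simp add: Ke_def)
  have m': "midpoint (tip D l') (base D l') \<in> side l'" "midpoint (tip D l) (base D l) \<in> side l"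
    by (rule tip_half[OF lk(2)] tip_half[OF lk(1)])+
  have sK: "side l' \<inter> Kw = {}" "side l \<inter> Ke = {}" "side l' \<inter> Ke = {}"
    using side_region[OF lk(2) nKw] side_region[OF lk(1) nKe] side_region[OF lk(2) nKe] by (simp_all add: Kw_def Ke_def)
  have ss: "side l' \<inter> seg D lL = {}" "side l \<inter> seg D l' = {}"
    by (rule side_seg[OF lk(3,2) ne(2)] side_seg[OF lk(2,1) ne(1)[symmetric]])+
  have armw: "closed_segment (midpoint (tip D l') (base D l')) (tip D l') \<inter> closed_segment (tip D lL) (base D lL) \<subseteq> {tip D lL}"
    unfolding seg_def[symmetric] by (rule arm_meets(1)[OF tip_half(1)[OF lk(2)] tw(1) _ ss(1)]) (simp add: KL)
  have arme: "closed_segment (midpoint (tip D l) (base D l)) (base D l) \<inter> closed_segment (base D l') (tip D l') \<subseteq> {base D l'}"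
    unfolding seg_def[symmetric] closed_segment_commute[of "base D l'"]
    by (rule arm_meets(1)[OF base_half[OF lk(1)] be(1) _ ss(2)]) (simp add: Kl')
  obtain p1 where p1: "swings Kw (tip D lL) (base D lL) (tip D l') (midpoint (tip D l') (base D l')) p1"
    and \<beta>': "\<beta> = 2 * pi * corner_turn (midpoint (tip D l') (base D l')) (tip D l') (reversepath p1) (tip D lL) (midpoint (tip D lL) (base D lL))"
  proof (rule left_turn_swings)
    show "left_turn Kw (seg D l' \<union> seg D lL) (tip D l', midpoint (tip D l') (base D l')) (tip D lL, midpoint (tip D lL) (base D lL)) \<beta>"
      using \<beta> by (simp add: Kw_def l'_def lL_def tip_arm_def)
    show "Kw \<inter> closed_segment (tip D lL) (base D lL) \<subseteq> {tip D lL}" using KL by (simp add: seg_def)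
    show "midpoint (tip D l') (base D l') \<notin> Kw" "midpoint (tip D l') (base D l') \<notin> closed_segment (tip D lL) (base D lL)"
      using m' sK ss unfolding seg_def by blast+
  qed (use tw armw tip_neq_base[OF lk(3)] in \<open>auto simp: seg_def\<close>)
  obtain pe where pe: "swings Ke (base D l') (tip D l') (base D l) (midpoint (tip D l) (base D l)) pe"
    and \<alpha>': "\<alpha> = 2 * pi * corner_turn (midpoint (tip D l) (base D l)) (base D l) (reversepath pe) (base D l') (midpoint (base D l') (tip D l'))"
  proof (rule left_turn_swings)
    show "left_turn Ke (seg D l \<union> seg D l') (base D l, midpoint (tip D l) (base D l)) (base D l', midpoint (base D l') (tip D l')) \<alpha>"
      using \<alpha> by (simp add: Ke_def l'_def l_def base_arm_def midpoint_sym)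
    show "closed_segment (base D l') (tip D l') \<subseteq> seg D l \<union> seg D l'"
      by (subst closed_segment_commute) (simp add: seg_def)
    show "Ke \<inter> closed_segment (base D l') (tip D l') \<subseteq> {base D l'}"
      using Kl' unfolding seg_def closed_segment_commute[of "base D l'"] by simp
    show "midpoint (tip D l) (base D l) \<notin> Ke" "midpoint (tip D l) (base D l) \<notin> closed_segment (base D l') (tip D l')"
      using m' sK ss unfolding seg_def closed_segment_commute[of "base D l'"] by blast+
    show "base D l' \<noteq> tip D l'" using tip_neq_base[OF lk(2)] by simp
  qed (use be arme in auto)
  have p1': "path p1" "pathstart p1 = tip D lL" "pathfinish p1 = tip D l'" "path_image p1 \<subseteq> Kw"
    using p1 by (simp_all add: swings_def)
  have pe': "path pe" "pathstart pe = base D l'" "pathfinish pe = base D l" "path_image pe \<subseteq> Ke"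
    using pe by (simp_all add: swings_def)
  note lf = link_ends_frontier(2)
  obtain Pe1 where Pe1: "path Pe1" "path_image Pe1 \<subseteq> Ke" "pathstart Pe1 = base D l" "pathfinish Pe1 = base D (FLink e)"
    using region_path[OF nKe] lf[OF lk(1)] lf[OF lk(4)] unfolding oel Ke_def by blast
  obtain Pe2 where Pe2: "path Pe2" "path_image Pe2 \<subseteq> Ke" "pathstart Pe2 = base D (FLink e)" "pathfinish Pe2 = base D l'"
    using region_path[OF nKe] lf[OF lk(2)] lf[OF lk(4)] unfolding oel Ke_def by blast
  interpret s: path_step G D vs fs k C e L da db P0 Pe1 Pe2 p1 p2
    by unfold_locales (use e not_root no_loop L da db P0 p2 p1' Pe1 Pe2 in \<open>simp_all add: l_def l'_def lL_def Ke_def Kw_def\<close>)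
  have eqs: "s.m0 = midpoint (tip D l) (base D l)" "s.y0 = base D l" "s.x1 = base D l'" "s.y1 = tip D l'"
    "s.m1 = midpoint (base D l') (tip D l')" "s.c = tip D lL" "s.mL = midpoint (tip D lL) (base D lL)"
    "s.m3 = diag_mid da" "s.y3 = src da" "s.x0 = tip D l" "s.m2 = diag_mid db" "s.x2 = src db" "s.Kw = Kw"
    by (simp_all add: s.m0_def s.m1_def s.m2_def s.m3_def s.mL_def s.point_defs l_def l'_def lL_def diag_mid_def
      midpoint_sym s.Kw_def Kw_def)
  have bKe: "bounded Ke" unfolding Ke_def
    by (rule bounded_region_props(2)[OF bounded_region_if[OF nKe]]) auto
  have off: "midpoint (tip D l) (base D l) \<notin> Ke" "midpoint (base D l') (tip D l') \<notin> Ke"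
    using m' sK by (auto simp: midpoint_sym[of "base D l'"])
  \<comment> \<open>The edge-node is bounded, so the path from the left turn may be exchanged for
    one through the base of \<open>FLink e\<close>, where the boundary is split.\<close>
  have ct: "corner_turn (midpoint (tip D l) (base D l)) (base D l) (Pe1 +++ Pe2) (base D l') (midpoint (base D l') (tip D l')) =
      corner_turn (midpoint (tip D l) (base D l)) (base D l) (reversepath pe) (base D l') (midpoint (base D l') (tip D l'))"
    using Pe1 Pe2 pe' bKe off connected_region_compl[OF nKe, folded Ke_def]
    by (intro corner_turn_path_independent[where K = Ke]) (auto simp: path_image_join)
  \<comment> \<open>At an unbounded head both \<open>p1\<close> and \<open>p2\<close> come from left
    rotations starting at \<open>VLink L\<close>, which makes them compatible.\<close>
  have hyp: "bounded Kw \<or> (\<forall>Z. path Z \<longrightarrow> pathstart Z = s.m1 \<longrightarrow> pathfinish Z = s.m2 \<longrightarrow> path_image Z \<subseteq> insert s.m1 (s.Ah - C) \<longrightarrow>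
      turns s.mL (join_all [linepath s.m1 s.y1, reversepath p1, p2, linepath s.x2 s.m2, reversepath Z]) = 0)"
  proof (cases "bounded Kw")
    case False
    have fn: "face_next G e \<in> darts G" using e by (simp add: face_next_in)
    have Ah: "s.Ah = facet D (face_next G e)" by (simp add: s.Ah_def s.h_def)
    have m1e: "midpoint (tip D l') (base D l') = s.m1" unfolding eqs by (rule midpoint_sym)
    have vdb: "outer_end G lL = VNode (vertex G (corner db))" using db(2) L(2) by (simp add: lL_def vertex_face_next)
    note sf = src_arm_facts[OF lk(3) db(1) vdb]
    have "turns s.mL (join_all [linepath s.m1 s.y1, reversepath p1, p2, linepath s.x2 s.m2, reversepath Z]) = 0"
      if Z: "path Z" "pathstart Z = s.m1" "pathfinish Z = s.m2" "path_image Z \<subseteq> insert s.m1 (s.Ah - C)" for Z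
      unfolding eqs(7)
    proof (rule swings_unbounded)
      show "swings Kw (tip D lL) (base D lL) s.y1 s.m1 p1" using p1 unfolding m1e eqs(4) .
      show "swings Kw (tip D lL) (base D lL) s.x2 s.m2 p2" using sw False unfolding eqs Kw_def lL_def by blast
      show "connected Kw" unfolding Kw_def by (rule connected_region[OF nKw])
      show "\<not> bounded Kw" by fact
      show "\<not> is_singleton Kw" using False by (auto simp: is_singleton_def)
      show "Kw \<inter> closed_segment (tip D lL) (base D lL) = {tip D lL}" using KL by (simp add: seg_def)
      show "tip D lL \<noteq> base D lL" by (rule tip_neq_base[OF lk(3)])
      show "closed_segment s.m1 s.y1 \<inter> closed_segment (tip D lL) (base D lL) \<subseteq> {tip D lL}"
        using armw unfolding m1e eqs(4) .
      show "closed_segment s.m2 s.x2 \<inter> closed_segment (tip D lL) (base D lL) \<subseteq> {tip D lL}"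
        using sf(2) unfolding eqs seg_def .
      show "path_image Z \<inter> Kw = {}"
        using Z(4) m'(1) sK(1) facet_region[OF fn nKw] unfolding m1e Ah Kw_def by blast
      show "path_image Z \<inter> closed_segment (tip D lL) (base D lL) = {}"
        using Z(4) m'(1) ss(1) facet_seg[OF fn lk(3)] unfolding m1e Ah seg_def by blast
    qed (use Z in simp_all)
    then show ?thesis by blast
  qed simp
  have left': "diagonal_on_left D C db s.x1 s.y1" using left unfolding eqs l'_def .
  have "ht db - ht da = 2 * pi * (corner_turn s.m0 s.y0 (Pe1 +++ Pe2) s.x1 s.m1 + corner_turn s.m1 s.y1 (reversepath p1) s.c s.mL
    + corner_turn s.m3 s.y3 P0 s.x0 s.m0 - corner_turn s.m2 s.x2 (reversepath p2) s.c s.mL)"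
    by (rule s.height_step[OF left' hyp[folded eqs(13)] ht M])
  also have "\<dots> = \<alpha> + \<beta> + 2 * pi * (corner_turn s.m3 s.y3 P0 s.x0 s.m0 - corner_turn s.m2 s.x2 (reversepath p2) s.c s.mL)"
    unfolding \<alpha>' \<beta>' eqs ct unfolding midpoint_sym[of "base D l'" "tip D l'"] by (simp add: algebra_simps)
  finally show ?thesis unfolding eqs unfolding l_def lL_def .
qed

end

section \<open>The winding number of a path\<close>

lemma cas_nth:
  assumes "pre_digraph.cas H u p v"
  shows "i < length p \<Longrightarrow> tail H (p ! i) = pre_digraph.awalk_verts H u p ! i"
    and "i < length p \<Longrightarrow> head H (p ! i) = pre_digraph.awalk_verts H u p ! Suc i"
    and "length (pre_digraph.awalk_verts H u p) = Suc (length p)"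
    and "pre_digraph.awalk_verts H u p ! length p = v"
  using assms
proof (induction p arbitrary: u i)
  case Nil
  {
    case 1 then show ?case by simp
  next
    case 2 then show ?case by simp
  next
    case 3 then show ?case by (simp add: pre_digraph.awalk_verts.simps)
  next
    case 4 then show ?case by (simp add: pre_digraph.awalk_verts.simps pre_digraph.cas.simps)
  }
next
  case (Cons e p)
  note simps = pre_digraph.awalk_verts.simps pre_digraph.cas.simps
  have hd: "pre_digraph.awalk_verts H x p ! 0 = x" if "pre_digraph.cas H x p v" for x
    using that by (cases p) (auto simp: simps)
  {
    case 1 then show ?case using Cons.IH(1)[of "i - 1" "head H e"] by (cases i) (auto simp: simps)
  next
    case 2 then show ?case using Cons.IH(2)[of "i - 1" "head H e"] hd[of "head H e"] by (cases i) (auto simp: simps)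
  next
    case 3 then show ?case using Cons.IH(3)[of "head H e"] by (auto simp: simps)
  next
    case 4 then show ?case using Cons.IH(4)[of "head H e"] by (auto simp: simps)
  }
qed

lemma on_left_meet:
  assumes "on_left W a b" "on_left W' a b"
  shows "W \<inter> W' \<noteq> {}"
proof -
  have "\<forall>\<^sub>F t in at_right 0. linepath a b (1/2) + of_real t * (\<i> * (b - a)) \<in> W \<inter> W'"
    using assms[unfolded on_left_def, THEN bspec, of "1/2"] by (simp add: eventually_conj_iff)
  then obtain t where "linepath a b (1/2) + of_real t * (\<i> * (b - a)) \<in> W \<inter> W'"
    using eventually_happens[of _ "at_right (0::real)"] by (auto simp: trivial_limit_at_right_real)
  then show ?thesis by blast
qed

context cut_drawing
begin

text \<open>Points just to the left of the link belong to both facets, and distinct facets are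
  disjoint.\<close>

lemma diagonal_on_left_corner:
  assumes d: "d \<in> diagonals G D C" "diagonal_on_left D C d a b" and h: "h \<in> darts G" "on_left (facet D h) a b"
  shows "corner d = h"
proof -
  have "connected_component_set (facet D (corner d) - C) (diag_mid d) \<inter> facet D h \<noteq> {}"
    using on_left_meet d(2) h(2) unfolding diagonal_on_left_def by blast
  then have "facet D (corner d) \<inter> facet D h \<noteq> {}"
    using connected_component_subset[of "facet D (corner d) - C" "diag_mid d"] by blast
  then show ?thesis using facets_disjoint[OF diagonal_props(1)[OF d(1)] h(1)] by blast
qed

lemma diagonal_on_left_uncut:
  assumes d: "d \<in> diagonals G D C" "corner d \<noteq> k" and l: "on_left (facet D (corner d)) a b"
  shows "diagonal_on_left D C d a b"
proof -
  note h = diagonal_props(1)[OF d(1)]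
  have "facet D (corner d) - C = facet D (corner d)" using cut_disjoint(3)[OF h d(2)] by blast
  moreover have "connected_component_set (facet D (corner d)) (diag_mid d) = facet D (corner d)"
    by (rule connected_component_eq_self[OF facet_connected[OF h] src_half(2)[OF d(1)]])
  ultimately show ?thesis using l by (simp add: diagonal_on_left_def)
qed

lemma src_path:
  assumes e: "e \<in> darts G" and d: "d \<in> diagonals G D C" "vertex G (corner d) = vertex G e"
  shows "\<exists>p. path p \<and> pathstart p = tip D (VLink e) \<and> pathfinish p = src d \<and> path_image p \<subseteq> region D (VNode (vertex G e))"
proof -
  have l: "VLink e \<in> links G" using e by (simp add: links_iff)
  show ?thesis
    using region_path[OF nodes_intros(1)[OF e] link_ends_frontier(1)[OF l, unfolded outer_end.simps]
        diagonal_ends_frontier(1)[OF d(1), unfolded d(2)]] by blast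
qed

end

theorem theorem3:
  fixes G :: "'d plane_graph" and D :: "'d drawing"
    and vs fs v' v'' :: "'d set" and k er :: 'd and C :: "complex set"
    and M :: "'d link set" and T :: "'d set" and ht :: "'d diagonal \<Rightarrow> real"
    and \<gamma> :: "'d list" and d1 dk :: "'d diagonal" and c1 ck w :: real
  assumes "finite_connected_plane_graph G"
    and "straight_drawing G D"
    and "outer_node_and_cut G D vs fs k C"
    and "\<forall>h\<in>darts G - {k}. \<exists>d\<in>diagonals G D C. corner d = h"
    and "perfect_matching G vs fs M"
    and "directed_spanning_tree G vs T"
    and "associated_matching G fs T M"
    and "height_function G D vs fs C M ht"
    and "pre_digraph.apath (digraph_of G (vertex G) T) v' \<gamma> v''" and "\<gamma> \<noteq> []"
    and "er \<in> darts G" and "vertex G er = v''" and "er \<noteq> opp G (last \<gamma>)"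
    and "d1 \<in> diagonals G D C"
    and "diagonal_on_left D C d1 (tip D (VLink (hd \<gamma>))) (base D (VLink (hd \<gamma>)))"
    and "dk \<in> diagonals G D C"
    and "diagonal_on_left D C dk
           (base D (VLink (opp G (last \<gamma>)))) (tip D (VLink (opp G (last \<gamma>))))"
    and "ccw_angle (region D (VNode v')) (seg D (VLink (hd \<gamma>)))
           (tip_arm D (VLink (hd \<gamma>))) (src_arm d1) c1"
    and "ccw_angle (region D (VNode v'')) (seg D (VLink er) \<union> seg D (VLink (opp G (last \<gamma>))))
           (tip_arm D (VLink er)) (src_arm dk) ck"
    and "winding G D \<gamma> er w"
  shows "w = (ht dk - ck) - (ht d1 - c1)"
proof -
  interpret plane_map G by unfold_locales (rule assms(1))
  have cl: "closed (region D x)" if "x \<in> nodes G" for x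
    using outer_node_and_cut_region[OF assms(3) that] bounded_region_props(1) outer_region_props(1) by blast
  interpret cut_drawing G D vs fs k C by unfold_locales (rule assms(2) cl assms(3), assumption?)+
  define r where "r = length \<gamma>"
  define L where "L i = (\<gamma> @ [er]) ! Suc i" for i
  define H where "H = digraph_of G (vertex G) T"
  define V where "V = (!) (pre_digraph.awalk_verts H v' \<gamma>)"
  have r: "0 < r" using assms(10) by (simp add: r_def)
  have hd: "hd \<gamma> = \<gamma> ! 0" and la: "last \<gamma> = \<gamma> ! (r - 1)"
    using assms(10) by (simp_all add: hd_conv_nth last_conv_nth r_def)
  have ap: "set \<gamma> \<subseteq> T" "pre_digraph.cas H v' \<gamma> v''" "distinct (pre_digraph.awalk_verts H v' \<gamma>)"
    using assms(9) by (simp_all add: H_def pre_digraph.apath_def pre_digraph.awalk_def digraph_of_def)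
  note cas = cas_nth[OF ap(2)]
  have V: "vertex G (\<gamma> ! i) = V i" "vertex G (opp G (\<gamma> ! i)) = V (Suc i)" if "i < r" for i
    using cas(1,2)[of i] that by (simp_all add: V_def r_def H_def digraph_of_def)
  have Vr: "V r = v''" using cas(4) by (simp add: V_def r_def)
  have V0: "V 0 = v'" using V(1)[OF r] ap(2) assms(10) by (cases \<gamma>) (auto simp: pre_digraph.cas.simps H_def digraph_of_def)
  have Vinj: "V i \<noteq> V j" if "i \<le> r" "j \<le> r" "i \<noteq> j" for i j
    using ap(3) cas(3) that unfolding V_def r_def by (simp add: nth_eq_iff_index_eq)
  have tree: "T \<subseteq> dir G" "\<And>v. v \<in> vertex G ` darts G - {vs} \<Longrightarrow> \<exists>!h. h \<in> T \<and> vertex G h = v" "\<And>h. h \<in> T \<Longrightarrow> vertex G h \<noteq> vs"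
    using assms(6) unfolding directed_spanning_tree_def rooted_spanning_tree_def by simp_all
  have gT: "\<gamma> ! i \<in> T" if "i < r" for i using that ap(1) by (auto simp: r_def)
  have gd: "\<gamma> ! i \<in> darts G" if "i < r" for i using gT[OF that] tree(1) dir_subset by blast
  have groot: "vertex G (\<gamma> ! i) \<noteq> vs" if "i < r" for i using tree(3)[OF gT[OF that]] .
  obtain T' where T': "dual_tree G fs T T'" "M = VLink ` T \<union> FLink ` T'"
    using assms(7) unfolding associated_matching_def by blast
  have dual: "T' \<subseteq> darts G" "edge G ` T' = edge G ` darts G - edge G ` T"
    using T'(1) unfolding dual_tree_def rooted_spanning_tree_def by simp_all
  \<comment> \<open>The edges of \<gamma> belong to the tree, so the dual tree does not use them and
    none of them is matched with a face-node.\<close>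
  have M: "x \<in> darts G \<and> x \<noteq> \<gamma> ! i \<and> x \<noteq> opp G (\<gamma> ! i)" if "i < r" "FLink x \<in> M" for i x
  proof -
    have x: "x \<in> T'" using that(2) T'(2) by auto
    then have "edge G x \<noteq> edge G (\<gamma> ! i)" using dual(2) gT[OF that(1)] by blast
    then show ?thesis using x dual(1) edge_opp[of "\<gamma> ! i"] by auto
  qed
  \<comment> \<open>Exactly one dart of the tree leaves a vertex other than the root, so the vertex
    is matched along the next link of \<gamma>.\<close>
  have cut_v: "cut_at G D vs fs C M (VNode (vertex G (\<gamma> ! i))) = seg D (VLink (\<gamma> ! i))" if i: "i < r" for i
  proof -
    have "\<exists>!h. h \<in> T \<and> vertex G h = vertex G (\<gamma> ! i)" using tree(2) gd[OF i] groot[OF i] by blast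
    then have "{l \<in> M. VNode (vertex G (\<gamma> ! i)) \<in> ends G l} = {VLink (\<gamma> ! i)}"
      using gT[OF i] by (auto simp: T'(2) ends_def)
    then show ?thesis using groot[OF i] by (simp add: cut_at_def)
  qed
  have L_suc: "L i = \<gamma> ! Suc i" if "Suc i < r" for i using that by (simp add: L_def r_def nth_append)
  have L_last: "L (r - 1) = er" using r by (simp add: L_def r_def nth_append)
  have L: "L i \<in> darts G \<and> vertex G (L i) = V (Suc i) \<and> L i \<noteq> opp G (\<gamma> ! i)" if i: "i < r" for i
  proof (cases "Suc i < r")
    case True
    \<comment> \<open>Going straight back along an edge would revisit a vertex, which a simple path
      does not do.\<close>
    have "V (Suc (Suc i)) \<noteq> V i" by (rule Vinj) (use True in auto)
    then have "\<gamma> ! Suc i \<noteq> opp G (\<gamma> ! i)"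
      using V(2)[OF True] V(1)[OF i] opp_opp[OF gd[OF i]] by metis
    then show ?thesis using L_suc[OF True] gd[OF True] V(1)[OF True] by simp
  next
    case False
    then have "i = r - 1" "Suc i = r" using i by simp_all
    then show ?thesis using L_last assms(11-13) la Vr by simp
  qed
  have kne: "h \<noteq> k" if "vertex G h \<noteq> vs" for h using that vertex_k by blast
  have vfn: "vertex G (face_next G (\<gamma> ! i)) = V (Suc i)" if "i < r" for i
    using vertex_face_next V(2)[OF that] by simp
  have fnd: "face_next G (\<gamma> ! i) \<in> darts G" if "i < r" for i using gd[OF that] by (simp add: face_next_in)
  have side4: "on_left (facet D (face_next G (\<gamma> ! i))) (base D (VLink (opp G (\<gamma> ! i)))) (tip D (VLink (opp G (\<gamma> ! i))))"
    if "i < r" for i using left_of_links(4)[OF fnd[OF that]] by (simp add: rot_face_next)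
  have c1: "corner d1 = \<gamma> ! 0"
    by (rule diagonal_on_left_corner[OF assms(14,15)[unfolded hd] gd[OF r] left_of_links(1)[OF gd[OF r]]])
  have r1: "r - 1 < r" using r by simp
  have ck: "corner dk = face_next G (\<gamma> ! (r - 1))"
    by (rule diagonal_on_left_corner[OF assms(16,17)[unfolded la] fnd[OF r1] side4[OF r1]])
  \<comment> \<open>Only the facet \<open>k\<close> might lack a diagonal, and its vertex is the
    root. It can therefore occur only in the last position, where \<open>dk\<close> is
    given.\<close>
  have "\<exists>d. d \<in> diagonals G D C \<and> corner d = \<gamma> ! i \<and> (i = 0 \<longrightarrow> d = d1)" if i: "i < r" for i
    using assms(4,14) gd[OF i] kne[OF groot[OF i]] c1 by (cases "i = 0") blast+
  then obtain a where a: "\<And>i. i < r \<Longrightarrow> a i \<in> diagonals G D C" "\<And>i. i < r \<Longrightarrow> corner (a i) = \<gamma> ! i" "a 0 = d1"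
    using r by metis
  have Vroot: "V i \<noteq> vs" if "i < r" for i using groot[OF that] V(1)[OF that] by simp
  have "\<exists>d. d \<in> diagonals G D C \<and> corner d = face_next G (\<gamma> ! i) \<and> (i = r - 1 \<longrightarrow> d = dk)" if i: "i < r" for i
  proof (cases "i = r - 1")
    case False
    then have "vertex G (face_next G (\<gamma> ! i)) \<noteq> vs" using vfn[OF i] Vroot[of "Suc i"] i by simp
    then show ?thesis using assms(4) fnd[OF i] kne False by blast
  qed (use assms(16) ck in blast)
  then obtain b where b: "\<And>i. i < r \<Longrightarrow> b i \<in> diagonals G D C" "\<And>i. i < r \<Longrightarrow> corner (b i) = face_next G (\<gamma> ! i)" "b (r - 1) = dk"
    using r1 by metis
  have b_left: "diagonal_on_left D C (b i) (base D (VLink (opp G (\<gamma> ! i)))) (tip D (VLink (opp G (\<gamma> ! i))))"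
    if i: "i < r" for i
  proof (cases "i = r - 1")
    case True
    then show ?thesis using assms(17) b(3) la by simp
  next
    case False
    then have "corner (b i) \<noteq> k" using vfn[OF i] Vroot[of "Suc i"] i b(2)[OF i] kne by simp
    then show ?thesis using diagonal_on_left_uncut[OF b(1)[OF i]] side4[OF i] b(2)[OF i] by simp
  qed
  define m where "m x = midpoint (tip D (VLink x)) (base D (VLink x))" for x
  have "\<exists>P. path P \<and> pathstart P = src (a i) \<and> pathfinish P = tip D (VLink (\<gamma> ! i)) \<and>
      path_image P \<subseteq> region D (VNode (vertex G (\<gamma> ! i)))" if i: "i < r" for i
  proof -
    obtain p where "path p" "pathstart p = tip D (VLink (\<gamma> ! i))" "pathfinish p = src (a i)"
      "path_image p \<subseteq> region D (VNode (vertex G (\<gamma> ! i)))"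
      using src_path[OF gd[OF i] a(1)[OF i]] a(2)[OF i] by auto
    then show ?thesis by (intro exI[of _ "reversepath p"]) simp
  qed
  then obtain P where P: "\<And>i. i < r \<Longrightarrow> path (P i)" "\<And>i. i < r \<Longrightarrow> pathstart (P i) = src (a i)"
    "\<And>i. i < r \<Longrightarrow> pathfinish (P i) = tip D (VLink (\<gamma> ! i))"
    "\<And>i. i < r \<Longrightarrow> path_image (P i) \<subseteq> region D (VNode (vertex G (\<gamma> ! i)))" by metis
  have vdk: "vertex G (corner dk) = vertex G er"
    using ck vfn[OF r1] Vr r assms(12) by simp
  obtain pk where pk: "swings (region D (VNode (vertex G er))) (tip D (VLink er)) (base D (VLink er)) (src dk) (diag_mid dk) pk"
    and ck_eq: "ck = 2 * pi * (1 / 2 - corner_turn (diag_mid dk) (src dk) (reversepath pk) (tip D (VLink er)) (m er))"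
    using last_angle[OF assms(11,16) vdk assms(19)[folded assms(12)]] unfolding m_def by blast
  \<comment> \<open>In the last position the path must be the one from \<open>ck\<close>, since the
    last vertex may be unbounded.\<close>
  have "\<exists>p. path p \<and> pathstart p = tip D (VLink (L i)) \<and> pathfinish p = src (b i) \<and>
      path_image p \<subseteq> region D (VNode (vertex G (L i))) \<and> (i = r - 1 \<longrightarrow> p = pk)" if i: "i < r" for i
  proof (cases "i = r - 1")
    case True
    then show ?thesis using pk L_last b(3) by (auto simp: swings_def)
  next
    case False
    have "vertex G (corner (b i)) = vertex G (L i)" using b(2)[OF i] vfn[OF i] L[OF i] by simp
    then show ?thesis using src_path[of "L i" "b i"] L[OF i] b(1)[OF i] False by blast
  qed
  then obtain p where p: "\<And>i. i < r \<Longrightarrow> path (p i)" "\<And>i. i < r \<Longrightarrow> pathstart (p i) = tip D (VLink (L i))"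
    "\<And>i. i < r \<Longrightarrow> pathfinish (p i) = src (b i)"
    "\<And>i. i < r \<Longrightarrow> path_image (p i) \<subseteq> region D (VNode (vertex G (L i)))" "p (r - 1) = pk" using r1 by metis
  obtain \<alpha> \<beta> where \<alpha>: "\<And>i. i < r \<Longrightarrow> left_turn (region D (ENode (edge G (\<gamma> ! i)))) (seg D (VLink (\<gamma> ! i)) \<union> seg D (VLink (opp G (\<gamma> ! i))))
      (base_arm D (VLink (\<gamma> ! i))) (base_arm D (VLink (opp G (\<gamma> ! i)))) (\<alpha> i)"
    and \<beta>: "\<And>i. i < r \<Longrightarrow> left_turn (region D (VNode (vertex G (opp G (\<gamma> ! i))))) (seg D (VLink (opp G (\<gamma> ! i))) \<union> seg D (VLink (L i)))
      (tip_arm D (VLink (opp G (\<gamma> ! i)))) (tip_arm D (VLink (L i))) (\<beta> i)"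
    and w: "w = (\<Sum>i<r. \<alpha> i + \<beta> i)"
    using assms(20) unfolding winding_def Let_def L_def r_def by auto
  define A where "A i = corner_turn (diag_mid (a i)) (src (a i)) (P i) (tip D (VLink (\<gamma> ! i))) (m (\<gamma> ! i))" for i
  define B where "B i = corner_turn (diag_mid (b i)) (src (b i)) (reversepath (p i)) (tip D (VLink (L i))) (m (L i))" for i
  have estep: "ht (b i) - ht (a i) = \<alpha> i + \<beta> i + 2 * pi * (A i - B i)" if i: "i < r" for i
    unfolding A_def B_def m_def
  proof (rule edge_step[OF gd[OF i] groot[OF i] _ _ _ _ a(1)[OF i] a(2)[OF i] b(1)[OF i] b(2)[OF i] P(1)[OF i] P(2)[OF i]
        P(3)[OF i] P(4)[OF i] p(1)[OF i] p(2)[OF i] p(3)[OF i] _ \<alpha>[OF i] \<beta>[OF i] _ b_left[OF i] assms(8) M[OF i]])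
    show "vertex G (opp G (\<gamma> ! i)) \<noteq> vertex G (\<gamma> ! i)" using V[OF i] Vinj[of "Suc i" i] i by simp
    show "L i \<in> darts G" "vertex G (L i) = vertex G (opp G (\<gamma> ! i))" "L i \<noteq> opp G (\<gamma> ! i)"
      using L[OF i] V(2)[OF i] by simp_all
    show "path_image (p i) \<subseteq> region D (VNode (vertex G (opp G (\<gamma> ! i))))"
      using p(4)[OF i] L[OF i] V(2)[OF i] by simp
    assume ub: "\<not> bounded (region D (VNode (vertex G (opp G (\<gamma> ! i)))))"
    \<comment> \<open>Every vertex before the last is the tail of an edge of the path, hence not the
      root, hence bounded.\<close>
    have "i = r - 1"
    proof (rule ccontr)
      assume "i \<noteq> r - 1"
      then have si: "Suc i < r" using i by simp
      show False using ub bounded_vertex[OF gd[OF si] groot[OF si]] V(1)[OF si] V(2)[OF i] by simp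
    qed
    then show "swings (region D (VNode (vertex G (opp G (\<gamma> ! i))))) (tip D (VLink (L i))) (base D (VLink (L i)))
        (src (b i)) (diag_mid (b i)) (p i)"
      using pk L_last b(3) p(5) V(2)[OF i] L[OF i] by simp
  qed
  have vstep: "ht (a (Suc i)) - ht (b i) = 2 * pi * (B i - A (Suc i))" if si: "Suc i < r" for i
  proof -
    have i: "i < r" using si by simp
    have vv: "vertex G (corner (a (Suc i))) = vertex G (\<gamma> ! Suc i)" "vertex G (corner (b i)) = vertex G (\<gamma> ! Suc i)"
      using a(2)[OF si] b(2)[OF i] vfn[OF i] V(1)[OF si] by simp_all
    show ?thesis
      unfolding A_def B_def m_def L_suc[OF si]
      by (rule vertex_step[OF gd[OF si] groot[OF si] cut_v[OF si] a(1)[OF si] vv(1) b(1)[OF i] vv(2)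
          P(1)[OF si] P(2)[OF si] P(3)[OF si] P(4)[OF si] p(1)[OF i] p(2)[OF i, unfolded L_suc[OF si]] p(3)[OF i]
          p(4)[OF i, unfolded L_suc[OF si]] assms(8)])
  qed
  \<comment> \<open>Alternating \<open>estep\<close> and \<open>vstep\<close>, each interior
    \<open>A (Suc i)\<close> and \<open>B i\<close> cancels, leaving the first \<open>A\<close> and
    the last \<open>B\<close>.\<close>
  have "ht (b n) - ht (a 0) = (\<Sum>i<Suc n. \<alpha> i + \<beta> i) + 2 * pi * (A 0 - B n)" if "n < r" for n
    using that
  proof (induction n)
    case 0
    then show ?case using estep[of 0] by simp
  next
    case (Suc n)
    then show ?case using estep[of "Suc n"] vstep[of n] by (simp add: right_diff_distrib)
  qed
  from this[OF r1] have "ht dk - ht d1 = w + 2 * pi * (A 0 - B (r - 1))" using r a(3) b(3) w by simp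
  moreover have "c1 = 2 * pi * (1 / 2 - A 0)"
    unfolding A_def m_def
  proof (rule first_angle[OF gd[OF r] groot[OF r] a(1)[OF r] _ _ subset_refl P(1)[OF r] P(2)[OF r] P(3)[OF r] P(4)[OF r]])
    show "vertex G (corner (a 0)) = vertex G (\<gamma> ! 0)" using a(2)[OF r] by simp
    show "ccw_angle (region D (VNode (vertex G (\<gamma> ! 0)))) (seg D (VLink (\<gamma> ! 0))) (tip_arm D (VLink (\<gamma> ! 0))) (src_arm (a 0)) c1"
      using assms(18) hd a(3) V(1)[OF r] V0 by simp
  qed
  moreover have "ck = 2 * pi * (1 / 2 - B (r - 1))"
    unfolding B_def using ck_eq L_last b(3) p(5) by simp
  ultimately show ?thesis by (simp add: right_diff_distrib)
qed

end
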